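(* Let $n \ge 2$ and let $p$ be a prime. For a positive number $B$, let $\mathcal{F}_n(B)$ be the set of monic polynomials $f(x) = x^n + \sum_{j=0}^{n-1} c_j x^j \in \mathbb{Z}[x]$ with $-B < c_j \le B$ for $0 \le j \le n-1$, and let $\mathcal{F}_n(B;p)$ be the subset of those $f \in \mathcal{F}_n(B)$ such that $\gcd(\mathrm{Disc}(f), p) = 1$, $f$ is irreducible over $\mathbb{Q}$, and the splitting field of $f$ over $\mathbb{Q}$ has Galois group $S_n$. Then: (1) $\displaystyle \lim_{B\to\infty} \frac{\#\mathcal{F}_n(B;p)}{\#\mathcal{F}_n(B)} = 1 - \frac{1}{p}$. (2) For each partition $\mu$ of $n$, $$\lim_{B\to\infty} \frac{\#\{ f \in \mathcal{F}_n(B;p) : f \bmod p \text{ has splitting type } \mu\}}{\#\mathcal{F}_n(B;p)} = \nu_{n,p}^{\ast}(C_\mu) = \frac{1}{p^{n-1}(p-1)}\prod_{i=1}^n \binom{M_i(p)}{c_i(\mu)}.$$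
   Context: $\mathrm{Disc}(f)$ is the polynomial discriminant. For $f$ with $p \nmid \mathrm{Disc}(f)$, the reduction $f \bmod p$ factors in $\mathbb{F}_p[x]$ as a product of distinct monic irreducible factors; its splitting type is the partition of $n$ formed by the degrees of these factors. For $m\ge 1$, $M_m(X) = \frac{1}{m}\sum_{d\mid m}\mu(d)X^{m/d}$ ($\mu$ the Möbius function); $\binom{w}{k} = \frac{w(w-1)\cdots(w-k+1)}{k!}$; $c_i(\mu)$ is the number of parts of $\mu$ equal to $i$; $C_\mu$ is the conjugacy class of $S_n$ of cycle type $\mu$; and $\nu_{n,p}^{\ast}(C_\mu)$ denotes the value given by the displayed formula. *)

theory Defs
  imports
    "HOL-Computational_Algebra.Squarefree"
    "HOL-Algebra.Bij"
    "HOL-Algebra.Generated_Fields"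
    "HOL-Algebra.Algebraic_Closure_Type"
    "HOL-Algebra.Sym_Groups"
    "Subresultants.Resultant_Prelim"
    "Berlekamp_Zassenhaus.Poly_Mod"
begin

text \<open>
  HOL-Algebra has its own polynomials with the same base names, hence the qualified
  \<open>Polynomial.degree\<close> etc.
\<close>

text \<open>
  \<open>Disc(f) = (-1)^(n(n-1)/2) Res(f, f') / lc(f)\<close>; the division is exact for integer polynomials
  of positive degree.
\<close>

definition discriminant :: "int poly \<Rightarrow> int" where
  "discriminant f =
     (let n = Polynomial.degree f
      in (-1) ^ (n * (n - 1) div 2) * resultant f (pderiv f) div Polynomial.lead_coeff f)"

text \<open>
  The splitting field over the rationals is realised inside the complex numbers, as the subfield
  generated by the rationals and all complex roots.
\<close>

definition splitting_field :: "rat poly \<Rightarrow> complex ring" where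
  "splitting_field f =
     ring_of_type_algebra
       \<lparr>carrier := generate_field ring_of_type_algebra
                    (\<rat> \<union> {z. poly (map_poly of_rat f) z = 0})\<rparr>"

definition galois_group :: "('a, 'm) ring_scheme \<Rightarrow> 'a set \<Rightarrow> ('a \<Rightarrow> 'a) monoid" where
  "galois_group K F =
     BijGroup (carrier K)
       \<lparr>carrier := {\<sigma> \<in> Bij (carrier K). \<sigma> \<in> ring_iso K K \<and> (\<forall>x\<in>F. \<sigma> x = x)}\<rparr>"

definition monic_box :: "nat \<Rightarrow> real \<Rightarrow> int poly set" where
  "monic_box n B =
     {f. Polynomial.degree f = n \<and> Polynomial.lead_coeff f = 1 \<and>
         (\<forall>j<n. - B < of_int (Polynomial.coeff f j) \<and> of_int (Polynomial.coeff f j) \<le> B)}"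

definition generic_box :: "nat \<Rightarrow> real \<Rightarrow> nat \<Rightarrow> int poly set" where
  "generic_box n B p =
     {f \<in> monic_box n B.
        gcd (discriminant f) (int p) = 1 \<and>
        irreducible (map_poly rat_of_int f) \<and>
        galois_group (splitting_field (map_poly rat_of_int f)) \<rat> \<cong> sym_group n}"

text \<open>
  \<open>poly_mod.factorization_m p f (1, fs)\<close> says that \<open>f\<close> is congruent modulo \<open>p\<close> to the product of
  the multiset \<open>fs\<close> of integer polynomials, each of which is monic and irreducible modulo \<open>p\<close>.
  For \<open>f\<close> monic and \<open>p\<close> prime, \<open>fs\<close> is unique up to congruence of its members, so \<open>\<mu>\<close> is unique;
  the factors are distinct modulo \<open>p\<close> when \<open>p\<close> does not divide the discriminant.
\<close>

definition has_splitting_type :: "nat \<Rightarrow> int poly \<Rightarrow> nat multiset \<Rightarrow> bool" where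
  "has_splitting_type p f \<mu> \<longleftrightarrow>
     (\<exists>fs. poly_mod.factorization_m (int p) f (1, fs) \<and>
           image_mset (\<lambda>g. Polynomial.degree (poly_mod.Mp (int p) g)) fs = \<mu>)"

definition is_partition_of :: "nat multiset \<Rightarrow> nat \<Rightarrow> bool" where
  "is_partition_of \<mu> n \<longleftrightarrow> 0 \<notin># \<mu> \<and> sum_mset \<mu> = n"

definition moebius_mu :: "nat \<Rightarrow> int" where
  "moebius_mu d = (if squarefree d then (-1) ^ card (prime_factors d) else 0)"

definition necklace :: "nat \<Rightarrow> real \<Rightarrow> real" where
  "necklace m x = (1 / real m) * (\<Sum>d | d dvd m. of_int (moebius_mu d) * x ^ (m div d))"

text \<open>
  The value \<open>\<nu>\<^sup>*(C\<^sub>\<mu>)\<close>, with the conjugacy class \<open>C\<^sub>\<mu>\<close> represented by its cycle type \<open>\<mu>\<close>.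
\<close>

definition splitting_measure :: "nat \<Rightarrow> nat \<Rightarrow> nat multiset \<Rightarrow> real" where
  "splitting_measure n p \<mu> =
     1 / (real p ^ (n - 1) * (real p - 1)) * (\<Prod>i=1..n. necklace i (real p) gchoose count \<mu> i)"

end

theory Submission
  imports Defs "HOL-Number_Theory.Cong"
begin

text \<open>
  Modulo a prime \<open>q\<close>, unique factorisation turns the monic polynomials of degree \<open>n\<close> into the
  multisets of total degree \<open>n\<close> over the monic irreducibles. Counting these multisets gives both the
  number \<open>q^n - q^(n-1)\<close> of separable polynomials and the number \<open>M\<^sub>i(q)\<close> of irreducibles of degree
  \<open>i\<close>, hence the number of separable polynomials of each splitting type; and residue classes are
  equidistributed in the box. So it remains to see that almost all polynomials are irreducible with
  Galois group \<open>S\<^sub>n\<close>.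

  Each splitting type has a proportion bounded below for large \<open>q\<close>, and distinct primes are
  independent, so almost every \<open>f\<close> has the types \<open>(n)\<close>, \<open>(n-1, 1)\<close> and \<open>(2, 1, ..., 1)\<close> modulo
  suitable large primes. By Dedekind's theorem the Galois group then contains an \<open>n\<close>-cycle, an
  \<open>(n-1)\<close>-cycle and a transposition, hence is \<open>S\<^sub>n\<close>.

  For Dedekind's theorem the Galois group is realised as the group \<open>G\<close> of those permutations of the
  set \<open>S\<close> of complex roots that preserve all integer polynomial relations between the roots. Summing
  an integer polynomial expression over all maps \<open>S \<rightarrow> S\<close> gives a polynomial in the power
  sums, hence an integer; weighting with an expression that vanishes off \<open>G\<close> yields that \<open>G\<close>-invariant
  elements of \<open>\<int>[S]\<close> are rational and that \<open>q\<close> is not invertible in \<open>\<int>[S]\<close>. Let \<open>J\<close> be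
  a prime ideal of \<open>\<int>[S]\<close> above \<open>q\<close> and let \<open>\<phi>\<close> be the permutation of \<open>S\<close> with
  \<open>s^q \<equiv> \<phi> s\<close> modulo \<open>J\<close>. For \<open>\<theta> = \<Sum> s T^(i s)\<close> the polynomial with the
  roots \<open>\<pi> \<theta>\<close>, \<open>\<pi> \<in> G\<close>, has coefficients in the prime field modulo \<open>J\<close>, so
  \<open>\<theta>^q \<equiv> \<phi> \<theta>\<close> is congruent to some \<open>\<pi> \<theta>\<close>; varying \<open>T\<close> gives
  \<open>\<phi> \<in> G\<close>.
\<close>

subsection \<open>Factorisation of integer polynomials modulo a prime\<close>

text \<open>Neither a prime field nor a ring of algebraic integers nor a fixed field is constructed.
  Polynomials over the prime field are integer polynomials up to congruence, with monic
  representatives so that division stays inside \<int>[x]; the residue ring of \<int>[S] is replaced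
  by congruences modulo \<open>J\<close>.

  The sums run over all maps S -> S, not over permutations, because such a sum of a monomial splits
  into a product of power sums; integrality then comes from Newton's identities alone. The price is
  the maps outside \<open>G\<close>, which the weight removes.

  The bound q > n * n! is a pigeonhole bound: each T with 0 <= T < q selects a member of
  \<open>G\<close>, and \<open>G\<close> has at most n! members, so one permutation is selected more
  than n times; a polynomial in T of degree less than n that vanishes so often modulo
  \<open>J\<close> has all coefficients in \<open>J\<close>.

  The primes that force the group S_n are chosen independently of \<open>p\<close>. Exceptional
  polynomials have density 0, so they do not disturb the density of a condition modulo
  \<open>p\<close>, and quotients are harmless because 1 - 1/p is positive.\<close>

lemma add_power_prime_exact:
  fixes u v :: "'a::comm_ring_1"
  assumes "prime (q::nat)"
  shows "(u + v) ^ q = u ^ q + v ^ q + of_nat q *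
    (\<Sum>k\<in>{1..<q}. of_nat ((q choose k) div q) * u ^ k * v ^ (q - k))"
proof -
  have q: "q \<ge> 2" using assms by (rule prime_ge_2_nat)
  have "(u + v) ^ q = (\<Sum>k\<le>q. of_nat (q choose k) * u ^ k * v ^ (q - k))"
    by (rule binomial_ring)
  also have "{..q} = insert 0 (insert q {1..<q})" using q by auto
  also have "(\<Sum>k\<in>\<dots>. of_nat (q choose k) * u ^ k * v ^ (q - k)) =
      v ^ q + (u ^ q + (\<Sum>k\<in>{1..<q}. of_nat (q choose k) * u ^ k * v ^ (q - k)))"
    using q by (subst sum.insert; simp)+
  \<comment> \<open>The cofactor of \<open>q\<close> is kept explicit: it has to be recognised later
    as an integer polynomial or as an element of the ring generated by the roots.\<close>
  also have "(\<Sum>k\<in>{1..<q}. of_nat (q choose k) * u ^ k * v ^ (q - k)) =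
      of_nat q * (\<Sum>k\<in>{1..<q}. of_nat ((q choose k) div q) * u ^ k * v ^ (q - k))"
    unfolding sum_distrib_left
  proof (rule sum.cong[OF refl])
    fix k assume "k \<in> {1..<q}"
    then have "q dvd q choose k" using assms by (intro dvd_choose_prime) auto
    then have "(of_nat (q choose k) :: 'a) = of_nat q * of_nat ((q choose k) div q)"
      by (metis dvd_mult_div_cancel of_nat_mult)
    then show "of_nat (q choose k) * u ^ k * v ^ (q - k) =
        of_nat q * (of_nat ((q choose k) div q) * u ^ k * v ^ (q - k))"
      by (simp add: mult.assoc)
  qed
  finally show ?thesis by (simp add: algebra_simps)
qed

lemma fermat_int:
  assumes "prime (q::nat)"
  shows "[a ^ q = a] (mod int q)"
proof -
  have nat: "[int k ^ q = int k] (mod int q)" for k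
  proof (induction k)
    case 0
    then show ?case using assms prime_gt_0_nat[of q] by (simp add: zero_power)
  next
    case (Suc k)
    define w where "w = (\<Sum>j\<in>{1..<q}. of_nat ((q choose j) div q) * int k ^ j * 1 ^ (q - j))"
    have "int (Suc k) ^ q = int k ^ q + 1 + int q * w"
      using add_power_prime_exact[OF assms, of "int k" 1] by (simp add: w_def add.commute)
    then have "[int (Suc k) ^ q = int k ^ q + 1] (mod int q)" by (simp add: cong_def)
    also have "[int k ^ q + 1 = int k + 1] (mod int q)" by (rule cong_add[OF Suc.IH cong_refl])
    finally show ?case by (simp add: add.commute)
  qed
  have "q > 0" using assms by (rule prime_gt_0_nat)
  then have "a mod int q \<ge> 0" by simp
  then obtain k where k: "a mod int q = int k" by (metis nonneg_int_cases)
  then have ak: "[a = int k] (mod int q)" by (metis cong_mod_right cong_refl)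
  then have "[a ^ q = int k ^ q] (mod int q)" by (rule cong_pow)
  also have "[int k ^ q = int k] (mod int q)" by (rule nat)
  also have "[int k = a] (mod int q)" by (rule cong_sym[OF ak])
  finally show ?thesis .
qed

text \<open>Pseudo-division multiplies the dividend by a power of the leading coefficient of the
  divisor; that power is 1 here.\<close>

lemma monic_div_mod_int:
  fixes f g :: "int poly"
  assumes "monic g"
  obtains q r where "f = g * q + r" "r = 0 \<or> degree r < degree g"
proof -
  obtain q r where qr: "pseudo_divmod f g = (q, r)" by (cases "pseudo_divmod f g") auto
  have "g \<noteq> 0" using assms by auto
  from pseudo_divmod[OF this qr] assms show ?thesis by (intro that[of q r]) auto
qed

lemma degree_monic_mult:
  fixes f g :: "int poly"
  assumes "monic f" "g \<noteq> 0"
  shows "degree (f * g) = degree f + degree g"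
  using assms by (intro degree_mult_eq) auto

section \<open>Congruence, division, gcds and unique factorisation modulo \<open>p\<close>\<close>

context poly_mod_prime
begin

lemma eq_m_iff: "f =m g \<longleftrightarrow> (\<exists>h. f = g + smult p h)"
proof
  assume "f =m g"
  then have "f = g + smult p (Dp f - Dp g)"
    using Dp_Mp_eq[of f] Dp_Mp_eq[of g] by (simp add: smult_diff_right)
  then show "\<exists>h. f = g + smult p h" ..
next
  assume "\<exists>h. f = g + smult p h"
  then obtain h where "f = g + smult p h" ..
  then have "Mp f = Mp (g + Mp (smult p h))" using plus_Mp(2)[of g "smult p h"] by simp
  then show "f =m g" by simp
qed

lemma eq_mE:
  assumes "f =m g" obtains h where "f = g + smult p h"
  using assms eq_m_iff by blast

lemma eq_mI: "f = g + smult p h \<Longrightarrow> f =m g"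
  using eq_m_iff by blast

lemma eq_m_add: "a =m b \<Longrightarrow> c =m d \<Longrightarrow> a + c =m b + d"
proof -
  assume "a =m b" "c =m d"
  then have "Mp (Mp a + Mp c) = Mp (Mp b + Mp d)" by simp
  then show ?thesis by (simp only: plus_Mp)
qed

lemma eq_m_mult: "a =m b \<Longrightarrow> c =m d \<Longrightarrow> a * c =m b * d"
proof -
  assume "a =m b" "c =m d"
  then have "Mp (Mp a * Mp c) = Mp (Mp b * Mp d)" by simp
  then show ?thesis by (simp only: mult_Mp)
qed

lemma eq_m_power: "a =m b \<Longrightarrow> a ^ k =m b ^ k"
proof (induction k)
  case (Suc k)
  then show ?case using eq_m_mult[of a b "a ^ k" "b ^ k"] by simp
qed simp

lemma eq_m_pderiv: "a =m b \<Longrightarrow> pderiv a =m pderiv b"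
  by (elim eq_mE) (auto simp: pderiv_add pderiv_smult intro!: eq_mI)

lemma dvdm_trans: "a dvdm b \<Longrightarrow> b dvdm c \<Longrightarrow> a dvdm c"
proof -
  assume "a dvdm b" "b dvdm c"
  then obtain h k where h: "b =m a * h" and k: "c =m b * k" unfolding dvdm_def by blast
  have "b * k =m a * h * k" by (rule eq_m_mult[OF h refl])
  then have "c =m a * (h * k)" using k by (simp add: mult.assoc)
  then show ?thesis unfolding dvdm_def by blast
qed

lemma dvdm_mult_left: "a dvdm b \<Longrightarrow> a dvdm c * b"
proof -
  assume "a dvdm b"
  then obtain h where h: "b =m a * h" unfolding dvdm_def by blast
  have "c * b =m c * (a * h)" by (rule eq_m_mult[OF refl h])
  then have "c * b =m a * (c * h)" by (simp add: mult.left_commute)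
  then show ?thesis unfolding dvdm_def by blast
qed

lemma dvdm_cong: "b =m c \<Longrightarrow> a dvdm b \<longleftrightarrow> a dvdm c"
  unfolding dvdm_def by simp

lemma dvdm_diff: "a dvdm b \<Longrightarrow> a dvdm c \<Longrightarrow> a dvdm b - c"
  using dvdm_add[of a b "- c"] by simp

lemma dvdm_smult_p: "a dvdm smult p b"
  unfolding div_mod_iff_dvdm by (intro exI[of _ 0] exI[of _ b]) simp

text \<open>The substitute for division by the leading coefficient: \<open>r\<close> and the monic
  \<open>h\<close> are associated modulo \<open>p\<close>, with both multipliers explicit.\<close>

lemma monic_normal:
  assumes "Mp r \<noteq> 0"
  obtains h c w c' w' where "monic h" "degree h = degree_m r" "h = smult c r + smult p w"
    "r = smult c' h + smult p w'"
proof -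
  define d l where "d = degree (Mp r)" and "l = coeff (Mp r) d"
  have l0: "l \<noteq> 0" using assms by (simp add: l_def d_def)
  have "l mod p = l" unfolding l_def by (metis M_def Mp_coeff Mp_Mp)
  then have "\<not> p dvd l" using l0 by (metis mod_0_imp_dvd dvd_imp_mod_0)
  then have "coprime l p" using prime_imp_coprime[OF prime, of l] coprime_commute[of l p] by simp
  then obtain c k where ck: "c * l + k * p = 1"
    using bezout_int[of l p] by auto
  \<comment> \<open>The leading coefficient of \<open>smult c (Mp r)\<close> is
    \<open>c * l\<close>, only congruent to 1. The added multiple of \<open>p\<close> makes it
    exactly 1, so that \<open>h\<close> is monic over the integers.\<close>
  define h where "h = smult c (Mp r) + smult p (monom k d)"
  have "coeff h d = c * l + p * k" unfolding h_def by (simp add: l_def)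
  then have cd: "coeff h d = 1" using ck by (simp only: mult.commute)
  have "coeff h i = 0" if "i > d" for i
    using that by (simp add: h_def d_def coeff_eq_0)
  then have "degree h \<le> d" by (intro degree_le) auto
  moreover have "d \<le> degree h" using cd by (intro le_degree) auto
  ultimately have dh: "degree h = d" by simp
  have r: "r = Mp r + smult p (Dp r)" by (rule Dp_Mp_eq)
  have h1: "h = smult c r + smult p (monom k d - smult c (Dp r))"
    unfolding h_def by (subst (2) r) (simp add: smult_add_right smult_diff_right mult.commute)
  define W where "W = smult k (Mp r) - smult l (monom k d)"
  have "smult l h = smult (l * c) (Mp r) + smult p (smult l (monom k d))"
    unfolding h_def by (simp add: smult_add_right mult.commute mult.left_commute)
  also have "l * c = 1 - k * p" using ck by (simp add: mult.commute)
  finally have eq: "Mp r = smult l h + smult p W"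
    unfolding W_def by (simp add: smult_add_right smult_diff_right smult_diff_left algebra_simps)
  have r2: "r = smult l h + smult p (W + Dp r)"
    by (simp only: smult_add_right add.assoc[symmetric] eq[symmetric]) (rule r)
  have "monic h" using cd dh by simp
  then show ?thesis using that[OF _ _ h1 r2] dh unfolding d_def by simp
qed

lemma dvdm_monic_degree:
  assumes "monic h" "h dvdm r" "Mp r \<noteq> 0"
  shows "degree h \<le> degree_m r"
  using dvdm_degree[of h "Mp r"] assms by simp

text \<open>Integer division by \<open>h\<close> leaves a remainder that is divisible by
  \<open>h\<close> modulo \<open>p\<close> but of smaller degree, hence 0 modulo \<open>p\<close>.
  The integer quotient therefore serves as the cofactor, and it is monic itself and not only modulo
  \<open>p\<close>.\<close>

lemma dvdm_monic_cofactor: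
  assumes f: "monic f" and h: "monic h" and d: "h dvdm f"
  obtains q where "monic q" "f =m h * q" "degree f = degree h + degree q"
proof -
  obtain q r where qr: "f = h * q + r" "r = 0 \<or> degree r < degree h"
    using monic_div_mod_int[OF h] by metis
  have "h dvdm h * q" unfolding dvdm_def by auto
  then have "h dvdm r" using dvdm_diff[OF d, of "h * q"] qr by simp
  have "Mp r = 0"
  proof (rule ccontr)
    assume a: "Mp r \<noteq> 0"
    then have "degree h \<le> degree_m r" using dvdm_monic_degree[OF h \<open>h dvdm r\<close>] by simp
    then show False using qr a degree_m_le[of r] by auto
  qed
  then have fq: "f =m h * q" using qr plus_Mp(2)[of "h * q" r] by simp
  have "q \<noteq> 0"
  proof
    assume "q = 0"
    then have "Mp f = 0" using fq by simp
    then show False using monic_Mp[OF f] by simp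
  qed
  have dg: "degree (h * q) = degree h + degree q" by (rule degree_monic_mult[OF h \<open>q \<noteq> 0\<close>])
  have "degree f = degree (h * q)" "lead_coeff f = lead_coeff (h * q)"
  proof -
    have "r = 0 \<or> degree r < degree (h * q)" using qr dg by auto
    then show "degree f = degree (h * q)" "lead_coeff f = lead_coeff (h * q)"
      using qr by (auto simp: degree_add_eq_left coeff_eq_0)
  qed
  then have "monic q" using f h by (simp add: lead_coeff_mult)
  then show ?thesis using that fq dg \<open>degree f = degree (h * q)\<close> by simp
qed

text \<open>Take a monic \<open>h\<close> of least degree in the ideal of \<int>[x] generated by
  \<open>a\<close>, \<open>b\<close> and \<open>p\<close>. A remainder of a division by
  \<open>h\<close> that is nonzero modulo \<open>p\<close> would, after normalisation, be a monic
  member of smaller degree; so \<open>h\<close> divides the whole ideal modulo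
  \<open>p\<close>.\<close>

lemma bezout_m:
  assumes "Mp a \<noteq> 0"
  obtains h u v w where "monic h" "h = u * a + v * b + smult p w" "h dvdm a" "h dvdm b"
proof -
  define J where "J = {h. \<exists>u v w. h = u * a + v * b + smult p w}"
  have J_comb: "x * s + y * t + smult p z \<in> J" if "s \<in> J" "t \<in> J" for x y z s t
  proof -
    from that obtain u v w u' v' w' where
      "s = u * a + v * b + smult p w" "t = u' * a + v' * b + smult p w'" unfolding J_def by auto
    then have "x * s + y * t + smult p z =
      (x * u + y * u') * a + (x * v + y * v') * b + smult p (x * w + y * w' + z)"
      by (simp add: algebra_simps smult_add_right)
    then show ?thesis unfolding J_def by blast
  qed
  have "a = 1 * a + 0 * b + smult p 0" "b = 0 * a + 1 * b + smult p 0" by auto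
  then have ab: "a \<in> J" "b \<in> J" unfolding J_def by blast+
  have norm: "\<exists>h. monic h \<and> h \<in> J \<and> degree h = degree_m r" if r: "r \<in> J" "Mp r \<noteq> 0" for r
  proof -
    from monic_normal[OF r(2)] obtain h c w where
      h: "monic h" "degree h = degree_m r" "h = smult c r + smult p w" by metis
    have "h = [:c:] * r + 0 * r + smult p w" using h by simp
    then show ?thesis using J_comb[OF r(1) r(1), of "[:c:]" 0 w] h by metis
  qed
  define P where "P h \<longleftrightarrow> monic h \<and> h \<in> J" for h
  have "\<exists>h. P h" using norm[OF ab(1) assms] unfolding P_def by auto
  then obtain h where h: "P h" and hmin: "\<And>h'. P h' \<Longrightarrow> degree h \<le> degree h'"
    using ex_has_least_nat[of P _ degree] by metis
  have dv: "h dvdm s" if s: "s \<in> J" for s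
  proof -
    obtain q r where qr: "s = h * q + r" "r = 0 \<or> degree r < degree h"
      using monic_div_mod_int h unfolding P_def by metis
    have "r = 1 * s + (- q) * h + smult p 0" using qr by simp
    then have rJ: "r \<in> J" using J_comb[OF s, of h 1 "- q" 0] h unfolding P_def by metis
    have "Mp r = 0"
    proof (rule ccontr)
      assume a: "Mp r \<noteq> 0"
      then have "degree h \<le> degree_m r" using norm[OF rJ a] hmin unfolding P_def by metis
      then show False using qr a degree_m_le[of r] by auto
    qed
    then have "s =m h * q" using qr plus_Mp(2)[of "h * q" r] by simp
    then show ?thesis unfolding dvdm_def by blast
  qed
  from h obtain u v w where "h = u * a + v * b + smult p w" unfolding P_def J_def by auto
  then show ?thesis using that h dv ab unfolding P_def by blast
qed

text \<open>One representative for each monic irreducible polynomial over the prime field: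
  \<open>Mp g = g\<close> turns congruence of members into equality, so that multisets of members
  can be counted.\<close>

definition irr_m :: "int poly set" where
  "irr_m = {g. irreducible\<^sub>d_m g \<and> monic g \<and> Mp g = g}"

lemma irr_mD:
  assumes "g \<in> irr_m" shows "irreducible\<^sub>d_m g" "monic g" "Mp g = g" "degree g > 0"
  using assms irreducible\<^sub>d_mD(1)[of g] by (auto simp: irr_m_def)

lemma monic_dvdm_irr:
  assumes h: "monic h" "h dvdm g" and g: "g \<in> irr_m"
  shows "h = 1 \<or> h =m g"
proof -
  obtain q where q: "monic q" "g =m h * q" "degree g = degree h + degree q"
    using dvdm_monic_cofactor[OF irr_mD(2)[OF g] h] by metis
  have "degree h = 0 \<or> degree q = 0"
  proof (rule ccontr)
    assume "\<not> ?thesis"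
    then have "degree_m h < degree_m g" "degree_m q < degree_m g"
      using q h irr_mD[OF g] by auto
    then show False using irreducible\<^sub>d_mD(2)[OF irr_mD(1)[OF g], of h q] q by blast
  qed
  then show ?thesis using q h by (auto simp: monic_degree_0)
qed

lemma irr_not_dvdm_1:
  assumes "g \<in> irr_m" shows "\<not> g dvdm 1"
proof
  assume "g dvdm 1"
  then have "g dvdm [:1:]" by (simp only: one_pCons)
  from monic_dvdm_constant[OF this] irr_mD[OF assms] m1 show False by auto
qed

lemma irr_coprime:
  assumes g: "g \<in> irr_m" and a: "\<not> g dvdm a"
  obtains u v w where "u * g + v * a = 1 + smult p w"
proof -
  have "Mp g \<noteq> 0" using irr_mD[OF g] by auto
  from bezout_m[OF this, of a] obtain h u v w where
    h: "monic h" "h = u * g + v * a + smult p w" "h dvdm g" "h dvdm a" by metis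
  have "\<not> h =m g" using h(4) a Mp_dvdm by metis
  then have "h = 1" using monic_dvdm_irr[OF h(1,3) g] by simp
  then have "u * g + v * a = 1 + smult p (- w)" using h by (simp add: algebra_simps)
  then show ?thesis using that by blast
qed

lemma irr_dvdm_mult:
  assumes g: "g \<in> irr_m" and ab: "g dvdm a * b"
  shows "g dvdm a \<or> g dvdm b"
proof (rule disjCI)
  assume "\<not> g dvdm b"
  then obtain u v w where "u * g + v * b = 1 + smult p w" using irr_coprime[OF g] by metis
  then have "a = (u * a) * g + v * (a * b) - smult p (w * a)"
    by (simp add: algebra_simps) (metis distrib_left mult.right_neutral mult_smult_right mult.commute)
  moreover have "g dvdm (u * a) * g" unfolding dvdm_def by (metis mult.commute)
  moreover have "g dvdm v * (a * b)" by (rule dvdm_mult_left[OF ab])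
  ultimately show "g dvdm a" using dvdm_add dvdm_diff dvdm_smult_p by metis
qed

lemma irr_dvdm_power:
  assumes g: "g \<in> irr_m" shows "g dvdm a ^ k \<Longrightarrow> g dvdm a"
proof (induction k)
  case (Suc k)
  then show ?case using irr_dvdm_mult[OF g, of a "a ^ k"] by auto
qed (use irr_not_dvdm_1[OF g] in simp)

lemma irr_dvdm_irr:
  assumes "g \<in> irr_m" "h \<in> irr_m" "g dvdm h" shows "g = h"
proof -
  have "g \<noteq> 1" using irr_mD(4)[OF assms(1)] by auto
  then have "Mp g = Mp h" using monic_dvdm_irr[OF irr_mD(2)[OF assms(1)] assms(3,2)] by blast
  then show ?thesis using irr_mD(3)[OF assms(1)] irr_mD(3)[OF assms(2)] by simp
qed

lemma irr_dvdm_prod_mset: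
  assumes g: "g \<in> irr_m" shows "set_mset fs \<subseteq> irr_m \<Longrightarrow> g dvdm prod_mset fs \<Longrightarrow> g \<in># fs"
proof (induction fs)
  case (add x fs)
  then show ?case using irr_dvdm_mult[OF g, of x "prod_mset fs"] irr_dvdm_irr[OF g, of x] by auto
qed (use irr_not_dvdm_1[OF g] in simp)

lemma monic_cancel_m:
  assumes g: "monic g" and ab: "g * a =m g * b"
  shows "a =m b"
proof -
  obtain w where w: "g * a = g * b + smult p w" using ab by (elim eq_mE)
  define c where "c = Mp (a - b)"
  have "g * (a - b) =m 0" using w by (intro eq_mI[of _ _ w]) (simp add: algebra_simps)
  then have gc: "Mp (g * c) = 0" unfolding c_def by simp
  have "c = 0"
  proof (rule ccontr)
    assume "c \<noteq> 0"
    have "coeff (g * c) (degree g + degree c) = lead_coeff c"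
      using g by (simp add: coeff_mult_degree_sum)
    then have "M (lead_coeff c) = 0" using gc Mp_coeff[of "g * c"] by (metis coeff_0)
    moreover have "M (lead_coeff c) = lead_coeff c" unfolding c_def by (metis Mp_Mp Mp_coeff)
    ultimately show False using \<open>c \<noteq> 0\<close> by simp
  qed
  then have "Mp (b + Mp (a - b)) = Mp b" unfolding c_def by simp
  then show ?thesis by simp
qed

lemma monic_prod_irr: "set_mset fs \<subseteq> irr_m \<Longrightarrow> monic (prod_mset fs)"
  by (rule monic_prod_mset) (auto dest: irr_mD)

lemma degree_prod_irr: "set_mset fs \<subseteq> irr_m \<Longrightarrow> degree (prod_mset fs) = sum_mset (image_mset degree fs)"
proof (induction fs)
  case (add g fs)
  have "monic (prod_mset fs)" using add.prems by (intro monic_prod_irr) auto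
  then have "prod_mset fs \<noteq> 0" by (metis leading_coeff_0_iff zero_neq_one)
  moreover have "monic g" using add.prems irr_mD(2)[of g] by simp
  ultimately show ?case using add degree_monic_mult by auto
qed simp

lemma irr_factorization_unique:
  "set_mset fs \<subseteq> irr_m \<Longrightarrow> set_mset gs \<subseteq> irr_m \<Longrightarrow> prod_mset fs =m prod_mset gs \<Longrightarrow> fs = gs"
proof (induction fs arbitrary: gs)
  case empty
  show ?case
  proof (cases gs)
    case (add g gs')
    then have "g dvdm 1" using empty unfolding dvdm_def by (auto intro!: exI[of _ "prod_mset gs'"])
    then show ?thesis using irr_not_dvdm_1 empty add by auto
  qed simp
next
  case (add g fs)
  then have g: "g \<in> irr_m" by simp
  have "prod_mset gs =m g * prod_mset fs" using add.prems(3) by simp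
  then have "g dvdm prod_mset gs" unfolding dvdm_def by blast
  then have "g \<in># gs" using irr_dvdm_prod_mset[OF g add.prems(2)] by simp
  then obtain gs' where gs: "gs = add_mset g gs'" by (metis multi_member_split)
  have "g * prod_mset fs =m g * prod_mset gs'" using add.prems(3) gs by simp
  then have "prod_mset fs =m prod_mset gs'" by (rule monic_cancel_m[OF irr_mD(2)[OF g]])
  then have "fs = gs'" using add gs by auto
  then show ?case using gs by simp
qed

lemma ex_irr_dvdm:
  assumes f: "monic f" "degree f > 0"
  obtains g where "g \<in> irr_m" "g dvdm f"
proof -
  define P where "P h \<longleftrightarrow> monic h \<and> degree h > 0 \<and> h dvdm f" for h
  have "f dvdm f" unfolding dvdm_def by (metis mult_1_right)
  then have "P f" using f unfolding P_def by simp
  then obtain h where h: "P h" and hmin: "\<And>h'. P h' \<Longrightarrow> degree h \<le> degree h'"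
    using ex_has_least_nat[of P _ degree] by metis
  have mh: "monic h" using h unfolding P_def by simp
  have "irreducible\<^sub>d_m h"
  proof (rule irreducible\<^sub>d_mI)
    show "degree_m h > 0" using h unfolding P_def by simp
    fix a b assume a: "Mp a = a" "degree a > 0" "degree a < degree_m h" "h =m a * b"
    then have "Mp a \<noteq> 0" by auto
    \<comment> \<open>The factors in the criterion for irreducibility need not be monic, whereas
      \<open>h\<close> is minimal only among monic divisors.\<close>
    then obtain a1 c' w' where a1: "monic a1" "degree a1 = degree_m a" "a = smult c' a1 + smult p w'"
      by (rule monic_normal)
    have "a =m smult c' a1" using a1 eq_mI by blast
    then have "h =m smult c' a1 * b" using a(4) eq_m_mult[of a "smult c' a1" b b] by simp
    then have "a1 dvdm h" unfolding dvdm_def by (metis mult_smult_left mult_smult_right)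
    then have "P a1" using h a1 a dvdm_trans unfolding P_def by auto
    moreover have "degree a1 = degree a" using a1(2) a(1) by simp
    ultimately show False using hmin[of a1] a(3) monic_degree_m[OF mh] by linarith
  qed
  then have "Mp h \<in> irr_m" using monic_Mp[OF mh] by (simp add: irr_m_def)
  then show ?thesis using that[of "Mp h"] h unfolding P_def by simp
qed

lemma irr_factorization_exists:
  "monic f \<Longrightarrow> \<exists>fs. set_mset fs \<subseteq> irr_m \<and> f =m prod_mset fs"
proof (induction "degree f" arbitrary: f rule: less_induct)
  case less
  show ?case
  proof (cases "degree f = 0")
    case True
    then have "f = 1" using less.prems by (simp add: monic_degree_0)
    then show ?thesis by (intro exI[of _ "{#}"]) auto
  next
    case False
    then obtain g where g: "g \<in> irr_m" "g dvdm f" using ex_irr_dvdm less.prems by auto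
    obtain q where q: "monic q" "f =m g * q" "degree f = degree g + degree q"
      using dvdm_monic_cofactor[OF less.prems irr_mD(2)[OF g(1)] g(2)] by metis
    then obtain fs where fs: "set_mset fs \<subseteq> irr_m" "q =m prod_mset fs"
      using less.hyps[of q] irr_mD(4)[OF g(1)] by auto
    have "f =m prod_mset (add_mset g fs)" using q(2) eq_m_mult[of g g, OF _ fs(2)] by simp
    then show ?thesis using fs g by (intro exI[of _ "add_mset g fs"]) auto
  qed
qed

section \<open>Derivatives and separability modulo \<open>p\<close>\<close>

lemma frobenius_poly: "h ^ nat p =m pcompose h (monom 1 (nat p))"
proof (induction h)
  case 0
  obtain k where "nat p = Suc k" using m1 by (cases "nat p") auto
  then show ?case by simp
next
  case (pCons a h)
  have pp: "prime (nat p)" using prime_int_nat_transfer[THEN iffD1, OF prime] by (rule conjunct2)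
  have pc: "pCons a h = [:a:] + [:0, 1:] * h" by simp
  define w where "w = (\<Sum>k\<in>{1..<nat p}. of_nat ((nat p choose k) div nat p) *
    [:a:] ^ k * ([:0, 1:] * h) ^ (nat p - k))"
  have "(pCons a h) ^ nat p = [:a:] ^ nat p + ([:0, 1:] * h) ^ nat p + of_nat (nat p) * w"
    unfolding pc w_def by (rule add_power_prime_exact[OF pp])
  also have "of_nat (nat p) * w = smult p w" using m1 by (simp add: of_nat_poly)
  finally have 1: "(pCons a h) ^ nat p =m [:a:] ^ nat p + ([:0, 1:] * h) ^ nat p"
    by (rule eq_mI)
  have "[a ^ nat p = a] (mod p)" using fermat_int[OF pp, of a] m1 by simp
  then have "Mp [:a ^ nat p:] = Mp [:a:]" by (simp add: Mp_const_poly cong_def)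
  then have 2: "[:a:] ^ nat p =m [:a:]" by (simp add: poly_const_pow)
  have 3: "([:0, 1:] * h) ^ nat p =m monom 1 (nat p) * pcompose h (monom 1 (nat p))"
    unfolding power_mult_distrib using eq_m_mult[OF _ pCons.IH, of "[:0,1:] ^ nat p" "monom 1 (nat p)"]
    by (simp add: monom_altdef)
  show ?case using 1 eq_m_add[OF 2 3] by (simp add: pcompose_pCons)
qed

text \<open>Prime fields are perfect: if the derivative vanishes modulo \<open>p\<close>, only
  exponents divisible by \<open>p\<close> survive, so \<open>g\<close> is congruent to some
  \<open>h\<close> evaluated at x^p, that is, to the p-th power of \<open>h\<close>. Then
  \<open>g\<close> divides \<open>h\<close>, whose degree is smaller.\<close>

lemma irr_pderiv_neq_0:
  assumes g: "g \<in> irr_m" shows "Mp (pderiv g) \<noteq> 0"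
proof
  assume 0: "Mp (pderiv g) = 0"
  define P where "P = nat p"
  have P: "P > 1" "p = int P" using m1 unfolding P_def by auto
  \<comment> \<open>Keeps the coefficients of \<open>g\<close> at multiples of \<open>P\<close>; by
    \<open>z\<close> below, all others vanish modulo \<open>p\<close>.\<close>
  define h where "h = (\<Sum>i\<le>degree g div P. monom (coeff g (P * i)) i)"
  have dh: "degree h \<le> degree g div P"
    unfolding h_def by (intro degree_sum_le) (auto intro: order.trans[OF degree_monom_le])
  have z: "M (coeff g i) = 0" if np: "\<not> P dvd i" for i
  proof -
    obtain j where j: "i = Suc j" using np by (cases i) auto
    have "M (coeff (pderiv g) j) = 0" using 0 Mp_coeff[of "pderiv g" j] by simp
    then have "p dvd int i * coeff g i" by (auto simp: coeff_pderiv j M_def)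
    moreover have "\<not> p dvd int i" using np P by simp
    ultimately have "p dvd coeff g i" using prime prime_dvd_mult_iff by blast
    then show ?thesis by (simp add: M_def)
  qed
  have hc: "pcompose h (monom 1 P) = (\<Sum>i\<le>degree g div P. monom (coeff g (P * i)) (P * i))"
    unfolding h_def pcompose_sum
    by (intro sum.cong refl) (simp add: monom_altdef pcompose_smult pcompose_hom.hom_power pcompose_pCons power_mult)
  have "Mp g = Mp (pcompose h (monom 1 P))"
  proof (rule poly_eqI)
    fix i
    have c: "coeff (pcompose h (monom 1 P)) i = (\<Sum>k\<le>degree g div P. if P * k = i then coeff g (P * k) else 0)"
      unfolding hc coeff_sum by (intro sum.cong) auto
    show "coeff (Mp g) i = coeff (Mp (pcompose h (monom 1 P))) i"
    proof (cases "P dvd i")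
      case True
      then obtain k where k: "i = P * k" ..
      have "coeff (pcompose h (monom 1 P)) i = (\<Sum>l\<le>degree g div P. if l = k then coeff g (P * k) else 0)"
        unfolding c using k P by (intro sum.cong) auto
      also have "\<dots> = coeff g i"
      proof (cases "k \<le> degree g div P")
        case False
        then have "degree g < i" using k P by (metis div_le_mono nonzero_mult_div_cancel_left not_le not_less_zero)
        then show ?thesis using False by (simp add: coeff_eq_0)
      qed (simp add: k)
      finally show ?thesis by (simp add: Mp_coeff)
    next
      case False
      then have "coeff (pcompose h (monom 1 P)) i = 0" unfolding c by (intro sum.neutral) auto
      then show ?thesis using z[OF False] by (simp add: Mp_coeff)
    qed
  qed
  then have gh: "g =m h ^ P" using frobenius_poly[of h] unfolding P_def by simp
  then have "h ^ P =m g * 1" by simp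
  then have "g dvdm h ^ P" unfolding dvdm_def by blast
  then have gdh: "g dvdm h" by (rule irr_dvdm_power[OF g])
  have "Mp h \<noteq> 0"
  proof
    assume "Mp h = 0"
    then have "h ^ P =m 0 ^ P" by (intro eq_m_power) simp
    then have "g =m 0" using gh P(1) by (simp add: zero_power)
    then show False using irr_mD[OF g] by auto
  qed
  then have "degree g \<le> degree h" using dvdm_degree[OF irr_mD(2)[OF g] gdh] by simp
  then have "degree g \<le> degree g div P" using dh by simp
  then show False using P irr_mD(4)[OF g] div_less_dividend[of P "degree g"] by linarith
qed

text \<open>A repeated factor divides both \<open>f\<close> and its derivative. Conversely, a common
  irreducible factor \<open>g\<close> of f = g k and of its derivative divides k g'; if
  \<open>g\<close> is simple it divides g', which is nonzero modulo \<open>p\<close> and of smaller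
  degree.\<close>

lemma separable_iff:
  assumes f: "monic f" and fs: "set_mset fs \<subseteq> irr_m" "f =m prod_mset fs"
  shows "(\<forall>g. count fs g \<le> 1) \<longleftrightarrow> (\<exists>u v w. u * f + v * pderiv f = 1 + smult p w)"
proof
  assume "\<exists>u v w. u * f + v * pderiv f = 1 + smult p w"
  then obtain u v w where uv: "u * f + v * pderiv f = 1 + smult p w" by blast
  show "\<forall>g. count fs g \<le> 1"
  proof (intro allI, rule ccontr)
    fix g assume "\<not> count fs g \<le> 1"
    then have "replicate_mset 2 g \<subseteq># fs" using count_le_replicate_mset_subset_eq[of 2 fs g] by simp
    then obtain k where k: "fs = add_mset g (add_mset g k)"
      by (auto simp: numeral_2_eq_2 mset_subset_eq_exists_conv)
    then have "g \<in># fs" by simp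
    from k have fg: "f =m g * (g * prod_mset k)" using fs by simp
    then have "pderiv f =m pderiv (g * (g * prod_mset k))" by (rule eq_m_pderiv)
    moreover have "pderiv (g * (g * prod_mset k)) = g * (pderiv (g * prod_mset k) + prod_mset k * pderiv g)"
      by (simp add: pderiv_mult algebra_simps)
    ultimately have "g dvdm pderiv f" unfolding dvdm_def by metis
    moreover have "g dvdm f" using fg unfolding dvdm_def by blast
    ultimately have "g dvdm u * f + v * pderiv f" by (intro dvdm_add dvdm_mult_left)
    then have "g dvdm 1" using uv dvdm_diff[OF _ dvdm_smult_p, of g _ w] by (metis add_diff_cancel_right')
    then show False using irr_not_dvdm_1 fs \<open>g \<in># fs\<close> by auto
  qed
next
  assume d: "\<forall>g. count fs g \<le> 1"
  have "Mp f \<noteq> 0" using monic_Mp[OF f] by auto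
  from bezout_m[OF this, of "pderiv f"] obtain h u v w where
    h: "monic h" "h = u * f + v * pderiv f + smult p w" "h dvdm f" "h dvdm pderiv f" by metis
  have "degree h = 0"
  proof (rule ccontr)
    assume "degree h \<noteq> 0"
    then obtain g where g: "g \<in> irr_m" "g dvdm h" using ex_irr_dvdm[OF h(1)] by auto
    then have gf: "g dvdm f" "g dvdm pderiv f" using h dvdm_trans by blast+
    then have "g dvdm prod_mset fs" using dvdm_cong[OF fs(2)] by simp
    then have "g \<in># fs" using irr_dvdm_prod_mset[OF g(1) fs(1)] by simp
    then obtain k where k: "fs = add_mset g k" by (metis multi_member_split)
    then have "count k g = 0" using d[rule_format, of g] by simp
    then have gk: "\<not> g dvdm prod_mset k" using irr_dvdm_prod_mset[OF g(1), of k] fs k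
      by (auto simp: count_eq_zero_iff)
    have "f =m g * prod_mset k" using fs k by simp
    then have "pderiv f =m pderiv (g * prod_mset k)" by (rule eq_m_pderiv)
    then have "g dvdm pderiv (g * prod_mset k)" using gf dvdm_cong by metis
    moreover have "g dvdm g * pderiv (prod_mset k)" unfolding dvdm_def by blast
    ultimately have "g dvdm prod_mset k * pderiv g"
      using dvdm_diff[of g "pderiv (g * prod_mset k)" "g * pderiv (prod_mset k)"]
      by (simp add: pderiv_mult)
    then have "g dvdm pderiv g" using irr_dvdm_mult[OF g(1)] gk by blast
    then have "degree g \<le> degree (pderiv g)"
      using dvdm_degree[OF irr_mD(2)[OF g(1)]] irr_pderiv_neq_0[OF g(1)] by simp
    then show False using irr_mD(4)[OF g(1)] by (simp add: degree_pderiv)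
  qed
  then have "h = 1" using monic_degree_0[OF h(1)] by simp
  then have "u * f + v * pderiv f = 1 + smult p (- w)" using h by simp
  then show "\<exists>u v w. u * f + v * pderiv f = 1 + smult p w" by blast
qed

end

subsection \<open>The discriminant modulo a prime\<close>

lemma det_cong_mod:
  fixes A B :: "int mat"
  assumes A: "A \<in> carrier_mat n n" and B: "B \<in> carrier_mat n n"
    and AB: "\<And>i j. i < n \<Longrightarrow> j < n \<Longrightarrow> [A $$ (i, j) = B $$ (i, j)] (mod p)"
  shows "[det A = det B] (mod p)"
  unfolding det_def'[OF A] det_def'[OF B]
proof (rule cong_sum, rule cong_mult[OF cong_refl], rule cong_prod)
  fix \<pi> i assume "\<pi> \<in> {\<pi>. \<pi> permutes {0..<n}}" "i \<in> {0..<n}"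
  then show "[A $$ (i, \<pi> i) = B $$ (i, \<pi> i)] (mod p)"
    using permutes_in_image[of \<pi> "{0..<n}" i] by (intro AB) auto
qed

text \<open>A row of the Sylvester matrix read as a polynomial, highest coefficient first; linear
  combinations of rows thus become combinations of \<open>f\<close> and \<open>g\<close>.\<close>

definition sylvester_row :: "int poly \<Rightarrow> int poly \<Rightarrow> nat \<Rightarrow> int poly" where
  "sylvester_row f g i = (if i < degree g then monom 1 (degree g - Suc i) * f
     else monom 1 (degree f + degree g - Suc i) * g)"

lemma sylvester_mat_row:
  assumes "i < degree f + degree g" "j < degree f + degree g"
  shows "sylvester_mat f g $$ (i, j) = coeff (sylvester_row f g i) (degree f + degree g - Suc j)"
proof (cases "i < degree g")
  case True
  let ?d = "degree f + degree g"
  have "(degree g - i \<le> ?d - j) = (degree g - Suc i \<le> ?d - Suc j)"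
    "?d - j - (degree g - i) = ?d - Suc j - (degree g - Suc i)"
    using assms True by linarith+
  then show ?thesis
    unfolding sylvester_index_mat2[OF assms] sylvester_row_def using True
    by (simp only: coeff_monom_mult if_True)
next
  case False
  let ?d = "degree f + degree g"
  have "(?d - i \<le> ?d - j) = (?d - Suc i \<le> ?d - Suc j)"
    "?d - j - (?d - i) = ?d - Suc j - (?d - Suc i)"
    using assms False by linarith+
  then show ?thesis
    unfolding sylvester_index_mat2[OF assms] sylvester_row_def using False
    by (simp only: coeff_monom_mult if_False)
qed

lemma sum_sylvester_rows:
  "(\<Sum>i<degree f + degree g. smult (c i) (sylvester_row f g i)) =
    (\<Sum>i<degree g. monom (c i) (degree g - Suc i)) * f +
    (\<Sum>i<degree f. monom (c (degree g + i)) (degree f - Suc i)) * g"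
proof -
  have eq: "{..<degree f + degree g} = {..<degree g} \<union> {degree g..<degree f + degree g}" by auto
  have "(\<Sum>i<degree f + degree g. smult (c i) (sylvester_row f g i)) =
    (\<Sum>i<degree g. smult (c i) (sylvester_row f g i)) +
    (\<Sum>i\<in>{degree g..<degree f + degree g}. smult (c i) (sylvester_row f g i))"
    by (subst eq, rule sum.union_disjoint) auto
  also have "(\<Sum>i<degree g. smult (c i) (sylvester_row f g i)) =
      (\<Sum>i<degree g. monom (c i) (degree g - Suc i)) * f"
    unfolding sum_distrib_right
    by (intro sum.cong refl) (simp add: sylvester_row_def smult_monom flip: mult_smult_left)
  also have "(\<Sum>i\<in>{degree g..<degree f + degree g}. smult (c i) (sylvester_row f g i)) =
      (\<Sum>i<degree f. smult (c (degree g + i)) (sylvester_row f g (degree g + i)))"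
    by (rule sum.reindex_bij_witness[of _ "\<lambda>i. degree g + i" "\<lambda>i. i - degree g"]) auto
  also have "\<dots> = (\<Sum>i<degree f. monom (c (degree g + i)) (degree f - Suc i)) * g"
    unfolding sum_distrib_right
    by (intro sum.cong refl) (simp add: sylvester_row_def smult_monom flip: mult_smult_left)
  finally show ?thesis .
qed

lemma resultant_combination:
  fixes f g :: "int poly"
  assumes "degree f + degree g > 0"
  obtains u v where "[:resultant f g:] = u * f + v * g"
proof -
  define d where "d = degree f + degree g"
  define S where "S = sylvester_mat f g"
  have S: "S \<in> carrier_mat d d" unfolding S_def d_def by auto
  \<comment> \<open>The last row of the adjugate: the rows of \<open>S\<close> combined with these
    weights vanish in every column except the last, which holds the constant coefficients and
    receives \<open>det S\<close>.\<close>
  define c where "c i = adj_mat S $$ (d - 1, i)" for i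
  define Q where "Q = (\<Sum>i<d. smult (c i) (sylvester_row f g i))"
  have d0: "d > 0" using assms unfolding d_def .
  have Q: "Q = [:resultant f g:]"
  proof (rule poly_eqI)
    fix k
    show "coeff Q k = coeff [:resultant f g:] k"
    proof (cases "k < d")
      case True
      have "coeff Q k = (\<Sum>i<d. c i * S $$ (i, d - Suc k))"
        unfolding Q_def coeff_sum using True
        by (intro sum.cong refl) (simp add: S_def sylvester_mat_row d_def)
      also have "\<dots> = (adj_mat S * S) $$ (d - 1, d - Suc k)"
        using S adj_mat(1)[OF S] d0 True
        by (auto simp: scalar_prod_def c_def lessThan_atLeast0 intro!: sum.cong)
      also have "\<dots> = (det S \<cdot>\<^sub>m 1\<^sub>m d) $$ (d - 1, d - Suc k)" using adj_mat(3)[OF S] by simp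
      also have "\<dots> = coeff [:resultant f g:] k"
        using d0 True by (auto simp: resultant_def S_def coeff_pCons split: nat.splits)
      finally show ?thesis .
    next
      case False
      have "degree (sylvester_row f g i) < d" if "i < d" for i
        using that le_less_trans[OF degree_mult_le, of "monom 1 _" f d]
          le_less_trans[OF degree_mult_le, of "monom 1 _" g d]
        by (auto simp: sylvester_row_def d_def degree_monom_eq)
      then have "coeff Q k = 0" unfolding Q_def coeff_sum using False
        by (intro sum.neutral) (auto intro!: coeff_eq_0 less_le_trans[of _ d k])
      then show ?thesis using False d0 by (simp add: coeff_pCons split: nat.splits)
    qed
  qed
  show ?thesis by (rule that[OF trans[OF Q[symmetric, unfolded Q_def d_def] sum_sylvester_rows]])
qed

context poly_mod_prime
begin

lemma resultant_not_dvd_imp: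
  assumes "degree f + degree g > 0" and r: "\<not> p dvd resultant f g"
  obtains u v w where "u * f + v * g = 1 + smult p w"
proof -
  obtain u v where uv: "[:resultant f g:] = u * f + v * g"
    using resultant_combination[OF assms(1)] by metis
  have "algebraic_semidom_class.coprime p (resultant f g)" by (rule prime_imp_coprime[OF prime r])
  then obtain a b where "a * p + b * resultant f g = 1"
    using bezout_int[of p "resultant f g"] by auto
  then have "b * resultant f g = 1 - p * a" by (simp add: algebra_simps)
  then have "smult b [:resultant f g:] = 1 + smult p [:- a:]"
    by (intro poly_eqI) (auto simp: coeff_pCons split: nat.splits)
  then have "smult b u * f + smult b v * g = 1 + smult p [:- a:]"
    unfolding uv by (simp add: smult_add_right)
  then show ?thesis using that by blast
qed

text \<open>From a Bezout identity modulo \<open>p\<close>, every x^k with k < \<open>d\<close> is a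
  combination of \<open>f\<close> and \<open>g\<close> modulo \<open>p\<close> whose cofactors have
  small degree. Small degrees are what makes this a combination of Sylvester rows, so the Sylvester
  matrix is invertible modulo \<open>p\<close>.\<close>

lemma resultant_not_dvd_if:
  assumes f: "monic f" and uv: "u * f + v * g = 1 + smult p w"
  shows "\<not> p dvd resultant f g"
proof -
  define d where "d = degree f + degree g"
  have ex: "\<exists>U V. (\<forall>i\<ge>degree g. coeff U i = 0) \<and> (\<forall>i\<ge>degree f. coeff V i = 0) \<and>
      U * f + V * g =m monom 1 k" if k: "k < d" for k
  proof -
    \<comment> \<open>The cofactor of \<open>g\<close> is reduced modulo \<open>f\<close>, and the
      quotient is moved to the cofactor of \<open>f\<close>.\<close>
    obtain t V where V: "monom 1 k * v = f * t + V" "V = 0 \<or> degree V < degree f"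
      using monic_div_mod_int[OF f] by metis
    define U where "U = monom 1 k * u + t * g"
    have "U * f + V * g = monom 1 k * (u * f + v * g) + (f * t + V - monom 1 k * v) * g"
      unfolding U_def by (simp add: algebra_simps)
    also have "\<dots> = monom 1 k + smult p (monom 1 k * w)"
      unfolding uv V(1)[symmetric] by (simp add: algebra_simps)
    finally have eq: "U * f + V * g =m monom 1 k" by (rule eq_mI)
    have V0: "coeff V i = 0" if "i \<ge> degree f" for i
      using V(2) that by (auto intro: coeff_eq_0)
    have eq2: "Mp U * f + V * g =m monom 1 k"
      using eq_m_add[of "Mp U * f" "U * f" "V * g" "V * g"] eq by simp
    \<comment> \<open>The other cofactor is small automatically, once reduced: if
      \<open>Mp U\<close> had degree at least that of \<open>g\<close>, the leading term of
      \<open>Mp U * f\<close> would lie above the degrees of both \<open>V * g\<close> and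
      x^k.\<close>
    have "coeff (Mp U) i = 0" if i: "i \<ge> degree g" for i
    proof (rule ccontr)
      assume ne: "coeff (Mp U) i \<noteq> 0"
      define D where "D = degree (Mp U)"
      have iD: "i \<le> D" unfolding D_def by (rule le_degree[OF ne])
      have l0: "coeff (Mp U) D \<noteq> 0" using ne unfolding D_def by auto
      have "coeff (V * g) (D + degree f) = 0"
      proof (cases "V = 0")
        case False
        then have "degree (V * g) < D + degree f"
          using V(2) iD i degree_mult_le[of V g] by linarith
        then show ?thesis by (rule coeff_eq_0)
      qed simp
      moreover have "coeff (Mp U * f) (D + degree f) = coeff (Mp U) D"
        using f unfolding D_def by (simp add: coeff_mult_degree_sum)
      moreover have "coeff (monom 1 k :: int poly) (D + degree f) = 0"
        using k iD i unfolding d_def by auto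
      ultimately have "M (coeff (Mp U) D) = M 0"
        using arg_cong[OF eq2, of "\<lambda>z. coeff z (D + degree f)"] by (simp add: Mp_coeff)
      then show False using l0 by (simp add: Mp_coeff)
    qed
    then show ?thesis using V0 eq2 by blast
  qed
  then obtain U V where U: "\<And>k i. k < d \<Longrightarrow> i \<ge> degree g \<Longrightarrow> coeff (U k) i = 0"
    and V: "\<And>k i. k < d \<Longrightarrow> i \<ge> degree f \<Longrightarrow> coeff (V k) i = 0"
    and UV: "\<And>k. k < d \<Longrightarrow> U k * f + V k * g =m monom 1 k" by metis
  define c where "c j i = (if i < degree g then coeff (U (d - Suc j)) (degree g - Suc i)
     else coeff (V (d - Suc j)) (d - Suc i))" for j i
  \<comment> \<open>Row \<open>j\<close> of \<open>T\<close> expresses \<open>x^(d-1-j)\<close> by the rows of the Sylvester matrix, so \<open>T\<close> inverts it modulo \<open>p\<close>.\<close>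
  define T where "T = mat d d (\<lambda>(j, i). c j i)"
  define S where "S = sylvester_mat f g"
  have S: "S \<in> carrier_mat d d" unfolding S_def d_def by auto
  have T: "T \<in> carrier_mat d d" unfolding T_def by auto
  have expand: "(\<Sum>i<n. monom (coeff q (n - Suc i)) (n - Suc i)) = q"
    if "\<And>i. i \<ge> n \<Longrightarrow> coeff q i = 0" for n and q :: "int poly"
  proof -
    have "(\<Sum>i<n. monom (coeff q (n - Suc i)) (n - Suc i)) = (\<Sum>i<n. monom (coeff q i) i)"
      by (rule sum.nat_diff_reindex)
    also have "\<dots> = q" using that by (intro poly_eqI) (auto simp: coeff_sum)
    finally show ?thesis .
  qed
  have TS: "[(T * S) $$ (j, l) = 1\<^sub>m d $$ (j, l)] (mod p)" if jl: "j < d" "l < d" for j l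
  proof -
    have k: "d - Suc j < d" using jl by simp
    have "(T * S) $$ (j, l) = (\<Sum>i<d. c j i * S $$ (i, l))"
      using S T jl by (auto simp: scalar_prod_def T_def lessThan_atLeast0 intro!: sum.cong)
    also have "\<dots> = coeff (\<Sum>i<d. smult (c j i) (sylvester_row f g i)) (d - Suc l)"
      unfolding coeff_sum using jl
      by (intro sum.cong refl) (simp add: S_def sylvester_mat_row d_def)
    also have "(\<Sum>i<d. smult (c j i) (sylvester_row f g i)) =
        U (d - Suc j) * f + V (d - Suc j) * g"
    proof -
      have "(\<Sum>i<degree g. monom (c j i) (degree g - Suc i)) = U (d - Suc j)"
        using expand[of "degree g" "U (d - Suc j)"] U[OF k] by (simp add: c_def)
      moreover have "(\<Sum>i<degree f. monom (c j (degree g + i)) (degree f - Suc i)) = V (d - Suc j)"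
        using expand[of "degree f" "V (d - Suc j)"] V[OF k] by (simp add: c_def d_def)
      ultimately show ?thesis using sum_sylvester_rows[of "c j" f g] unfolding d_def by (simp only:)
    qed
    finally have "(T * S) $$ (j, l) = coeff (U (d - Suc j) * f + V (d - Suc j) * g) (d - Suc l)" .
    moreover have "M (coeff (U (d - Suc j) * f + V (d - Suc j) * g) (d - Suc l)) =
       M (coeff (monom 1 (d - Suc j)) (d - Suc l))"
      using arg_cong[OF UV[OF k], of "\<lambda>z. coeff z (d - Suc l)"] by (simp only: Mp_coeff)
    moreover have "coeff (monom 1 (d - Suc j) :: int poly) (d - Suc l) = 1\<^sub>m d $$ (j, l)"
      using jl by auto
    ultimately show ?thesis by (simp add: cong_def M_def)
  qed
  have "[det (T * S) = det (1\<^sub>m d)] (mod p)"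
    using S T by (intro det_cong_mod[of _ d] TS) auto
  then have "[det T * det S = 1] (mod p)" using det_mult[OF T S] by simp
  then have "\<not> p dvd det S" using m1 by (auto simp: cong_def elim!: dvdE)
  then show ?thesis unfolding resultant_def S_def .
qed

lemma coprime_discriminant_iff:
  assumes f: "monic f" "degree f > 0"
  shows "gcd (discriminant f) p = 1 \<longleftrightarrow> (\<exists>u v w. u * f + v * pderiv f = 1 + smult p w)"
proof -
  define e where "e = degree f * (degree f - 1) div 2"
  have "discriminant f = (-1) ^ e * resultant f (pderiv f)"
    using f by (simp add: discriminant_def Let_def e_def)
  then have "p dvd discriminant f \<longleftrightarrow> p dvd resultant f (pderiv f)"
    by (cases "even e") auto
  moreover have "gcd (discriminant f) p = 1 \<longleftrightarrow> \<not> p dvd discriminant f"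
  proof
    assume "gcd (discriminant f) p = 1"
    then show "\<not> p dvd discriminant f" using m1 gcd_greatest[of p "discriminant f" p] by auto
  next
    assume "\<not> p dvd discriminant f"
    then have "algebraic_semidom_class.coprime p (discriminant f)" by (rule prime_imp_coprime[OF prime])
    then show "gcd (discriminant f) p = 1"
      using coprime_imp_gcd_eq_1[of p "discriminant f"] by (simp add: gcd.commute)
  qed
  moreover have "\<not> p dvd resultant f (pderiv f) \<longleftrightarrow> (\<exists>u v w. u * f + v * pderiv f = 1 + smult p w)"
  proof
    assume "\<not> p dvd resultant f (pderiv f)"
    then show "\<exists>u v w. u * f + v * pderiv f = 1 + smult p w"
      using resultant_not_dvd_imp[of f "pderiv f"] f(2) by (metis add_gr_0)
  next
    assume "\<exists>u v w. u * f + v * pderiv f = 1 + smult p w"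
    then obtain u v w where "u * f + v * pderiv f = 1 + smult p w" by blast
    then show "\<not> p dvd resultant f (pderiv f)" by (rule resultant_not_dvd_if[OF f(1)])
  qed
  ultimately show ?thesis by simp
qed

end

subsection \<open>Counting multisets of irreducibles\<close>

text \<open>Fix a prime \<open>q\<close> dividing \<open>n\<close>. The squarefree divisors pair off
  as d and q d, with d prime to \<open>q\<close>, and the two members of a pair have opposite
  signs.\<close>

lemma sum_moebius_mu:
  assumes "n > 0"
  shows "(\<Sum>d | d dvd n. moebius_mu d) = (if n = 1 then 1 else 0)"
proof (cases "n = 1")
  case True
  then have "{d. d dvd n} = {1}" by auto
  then show ?thesis using True by (simp add: moebius_mu_def)
next
  case False
  then obtain q where q: "prime q" "q dvd n" using prime_factor_nat by blast
  define A where "A = {d. d dvd n \<and> squarefree d \<and> \<not> q dvd d}"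
  have fin: "finite {d. d dvd n}" using assms by simp
  have finA: "finite A" unfolding A_def by (rule finite_subset[OF _ fin]) auto
  have q0: "q > 0" using q prime_gt_0_nat by auto
  have cop: "coprime q d" if "d \<in> A" for d
    using that q prime_imp_coprime[of q d] unfolding A_def by auto
  have im: "(*) q ` A = {d. d dvd n \<and> squarefree d \<and> q dvd d}"
  proof safe
    fix d assume d: "d \<in> A"
    show "q * d dvd n" using cop[OF d] d q unfolding A_def by (auto intro: divides_mult)
    show "squarefree (q * d)" using cop[OF d] d q unfolding A_def
      by (auto simp: squarefree_mult_coprime squarefree_prime)
  next
    fix d assume d: "d dvd n" "squarefree d" "q dvd d"
    then obtain e where e: "d = q * e" by blast
    have "\<not> q dvd e"
    proof
      assume "q dvd e"
      then have "q ^ 2 dvd d" using e by (auto simp: power2_eq_square)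
      then have "q dvd 1" using d(2) unfolding squarefree_def by auto
      then show False using q by auto
    qed
    moreover have "squarefree e" using d(2) e squarefree_multD by blast
    ultimately show "d \<in> (*) q ` A" using d e unfolding A_def by (auto intro: dvd_mult_right)
  qed auto
  have mu: "moebius_mu (q * d) = - moebius_mu d" if d: "d \<in> A" for d
  proof -
    have sf: "squarefree d" "squarefree (q * d)" using d im by (auto simp: A_def)
    have d0: "d \<noteq> 0" using d assms unfolding A_def by (metis dvd_0_left_iff mem_Collect_eq not_gr_zero)
    have "prime_factors (q * d) = insert q (prime_factors d)"
      using d0 q q0 by (simp add: prime_factors_product prime_prime_factors)
    moreover have "q \<notin> prime_factors d" using d unfolding A_def by auto
    ultimately show ?thesis using sf by (simp add: moebius_mu_def)
  qed
  have "(\<Sum>d | d dvd n. moebius_mu d) = (\<Sum>d \<in> A \<union> (*) q ` A. moebius_mu d)"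
    unfolding im by (rule sum.mono_neutral_right[OF fin]) (auto simp: A_def moebius_mu_def)
  also have "\<dots> = sum moebius_mu A + sum moebius_mu ((*) q ` A)"
    using finA by (intro sum.union_disjoint) (auto simp: A_def)
  also have "sum moebius_mu ((*) q ` A) = (\<Sum>d\<in>A. moebius_mu (q * d))"
    using q0 by (subst sum.reindex) (auto simp: inj_on_def)
  also have "\<dots> = - sum moebius_mu A" using mu by (simp add: sum_negf)
  finally show ?thesis using False by simp
qed

text \<open>Inserting the divisor sum for each power of \<open>q\<close> and exchanging the sums
  leaves, for each k dividing \<open>n\<close>, the sum of the Moebius function over the divisors of
  \<open>n div k\<close>, which is 0 unless k = \<open>n\<close>.\<close>

lemma moebius_inversion_necklace:
  fixes N :: "nat \<Rightarrow> nat" and q :: nat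
  assumes N: "\<And>n. n > 0 \<Longrightarrow> (\<Sum>k | k dvd n. k * N k) = q ^ n" and n: "n > 0"
  shows "real (N n) = necklace n (real q)"
proof -
  define a where "a k = real (k * N k)" for k
  have fin: "finite {d. d dvd m}" if "m dvd n" for m using that n by (auto intro!: finite_divisors_nat gr0I)
  have q_eq: "real q ^ m = (\<Sum>k | k dvd m. a k)" if "m > 0" for m
    using N[OF that] unfolding a_def by (metis of_nat_power of_nat_sum)
  have "(\<Sum>d | d dvd n. of_int (moebius_mu d) * real q ^ (n div d)) =
    (\<Sum>d | d dvd n. \<Sum>k | k dvd n div d. of_int (moebius_mu d) * a k)"
  proof (rule sum.cong[OF refl])
    fix d assume "d \<in> {d. d dvd n}"
    then have "n div d > 0" using n by (auto elim!: dvdE)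
    then show "of_int (moebius_mu d) * real q ^ (n div d) = (\<Sum>k | k dvd n div d. of_int (moebius_mu d) * a k)"
      by (simp add: q_eq sum_distrib_left)
  qed
  also have "\<dots> = (\<Sum>(d, k)\<in>(SIGMA d:{d. d dvd n}. {k. k dvd n div d}). of_int (moebius_mu d) * a k)"
    using n by (subst sum.Sigma) (auto intro!: finite_divisors_nat simp: dvd_div_eq_0_iff)
  also have "\<dots> = (\<Sum>(k, d)\<in>(SIGMA k:{k. k dvd n}. {d. d dvd n div k}). of_int (moebius_mu d) * a k)"
    by (rule sum.reindex_bij_witness[of _ "\<lambda>(k, d). (d, k)" "\<lambda>(d, k). (k, d)"])
      (use n in \<open>auto simp: dvd_div_iff_mult mult.commute dvd_div_iff_mult intro: dvd_mult_left dvd_mult_right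
          elim!: dvdE\<close>)
  also have "\<dots> = (\<Sum>k | k dvd n. \<Sum>d | d dvd n div k. of_int (moebius_mu d) * a k)"
    using n by (subst sum.Sigma) (auto intro!: finite_divisors_nat simp: dvd_div_eq_0_iff)
  also have "\<dots> = (\<Sum>k | k dvd n. if k = n then a k else 0)"
  proof (rule sum.cong[OF refl])
    fix k assume k: "k \<in> {k. k dvd n}"
    then have pos: "n div k > 0" using n by (auto elim!: dvdE)
    have "(\<Sum>d | d dvd n div k. of_int (moebius_mu d) * a k) =
        real_of_int (\<Sum>d | d dvd n div k. moebius_mu d) * a k"
      by (simp add: sum_distrib_right)
    also have "\<dots> = (if n div k = 1 then a k else 0)" by (simp add: sum_moebius_mu[OF pos])
    also have "(n div k = 1) = (k = n)" using k n by (auto elim!: dvdE)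
    finally show "(\<Sum>d | d dvd n div k. of_int (moebius_mu d) * a k) = (if k = n then a k else 0)" .
  qed
  also have "\<dots> = a n" using n by (simp add: sum.delta)
  finally show ?thesis using n unfolding necklace_def a_def by simp
qed

lemma sum_mset_eq_sum_count:
  "finite A \<Longrightarrow> set_mset M \<subseteq> A \<Longrightarrow> sum_mset (image_mset (f :: 'b \<Rightarrow> nat) M) = (\<Sum>x\<in>A. f x * count M x)"
proof (induction M)
  case (add x M)
  have "(\<Sum>y\<in>A. f y * count (add_mset x M) y) = (\<Sum>y\<in>A. f y * count M y + (if y = x then f y else 0))"
    by (intro sum.cong) auto
  also have "\<dots> = (\<Sum>y\<in>A. f y * count M y) + f x"
    using add.prems by (simp add: sum.distrib sum.delta)
  finally show ?case using add by simp
qed simp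

text \<open>The free commutative monoid on a graded set, with as many elements of degree n as there
  are monic polynomials over a field with \<open>q\<close> elements. The counts below depend on
  nothing else, so polynomials do not occur in them.\<close>

locale graded_primes =
  fixes P :: "'a set" and d :: "'a \<Rightarrow> nat" and q :: nat
  assumes d_pos: "\<And>g. g \<in> P \<Longrightarrow> d g > 0" and q_ge_2: "q \<ge> 2"
    and card_monoid: "\<And>n. card {M. set_mset M \<subseteq> P \<and> sum_mset (image_mset d M) = n} = q ^ n"
begin

definition W :: "nat \<Rightarrow> 'a multiset set" where
  "W n = {M. set_mset M \<subseteq> P \<and> sum_mset (image_mset d M) = n}"

definition level :: "nat \<Rightarrow> 'a set" where "level i = {g \<in> P. d g = i}"

definition N :: "nat \<Rightarrow> nat" where "N i = card (level i)"

definition sets_of_degree :: "nat \<Rightarrow> 'a set set" where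
  "sets_of_degree n = {A. finite A \<and> A \<subseteq> P \<and> sum d A = n}"

lemma card_W: "card (W n) = q ^ n" unfolding W_def by (rule card_monoid)

lemma finite_W: "finite (W n)"
  using card_W[of n] q_ge_2 by (intro card_ge_0_finite) simp

lemma finite_level: "finite (level i)"
proof (rule inj_on_finite[of "\<lambda>g. {#g#}" _ "W i"])
  show "(\<lambda>g. {#g#}) ` level i \<subseteq> W i" unfolding level_def W_def by auto
qed (auto simp: finite_W inj_on_def)

lemma d_le_W: "M \<in> W n \<Longrightarrow> g \<in># M \<Longrightarrow> d g \<le> n"
  by (auto simp: W_def dest!: multi_member_split)

text \<open>
  The total multiplicity of \<open>g\<close> in the multisets of degree \<open>n\<close>. Its recursion \<open>C_step\<close>, summed over
  \<open>g\<close>, takes the place of the logarithmic derivative of the zeta function.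
\<close>

definition C :: "nat \<Rightarrow> 'a \<Rightarrow> nat" where "C n g = (\<Sum>M\<in>W n. count M g)"

lemma C_small: "n < d g \<Longrightarrow> C n g = 0"
  unfolding C_def by (intro sum.neutral ballI) (meson d_le_W not_in_iff not_le)

text \<open>The multisets of degree \<open>n\<close> containing \<open>g\<close> arise from those of
  degree \<open>n - d g\<close> by adding one copy, which raises the multiplicity of
  \<open>g\<close> by 1 in each of the \<open>q ^ (n - d g)\<close> cases.\<close>

lemma C_rec:
  assumes g: "g \<in> P" and n: "d g \<le> n"
  shows "C n g = C (n - d g) g + q ^ (n - d g)"
proof -
  have "C n g = (\<Sum>M\<in>{M \<in> W n. g \<in># M}. count M g)"
    unfolding C_def by (rule sum.mono_neutral_right) (auto simp: finite_W not_in_iff)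
  also have "{M \<in> W n. g \<in># M} = add_mset g ` W (n - d g)"
  proof safe
    fix M assume M: "M \<in> W n" "g \<in># M"
    then obtain M' where M': "M = add_mset g M'" by (metis multi_member_split)
    then show "M \<in> add_mset g ` W (n - d g)" using M by (auto simp: W_def)
  qed (use g n in \<open>auto simp: W_def\<close>)
  also have "(\<Sum>M\<in>add_mset g ` W (n - d g). count M g) = (\<Sum>M\<in>W (n - d g). count M g + 1)"
    by (subst sum.reindex) (auto simp: inj_on_def)
  also have "\<dots> = C (n - d g) g + q ^ (n - d g)"
    unfolding sum.distrib C_def using card_W[of "n - d g"] by simp
  finally show ?thesis .
qed

text \<open>Unrolled, \<open>C_rec\<close> says that \<open>C n g\<close> is the sum of q^(n - j * d
  g) over j >= 1. Passing from n - 1 to n multiplies each term by \<open>q\<close> and adds the term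
  q^0 exactly if \<open>d g\<close> divides n.\<close>

lemma C_step:
  assumes g: "g \<in> P"
  shows "n > 0 \<Longrightarrow> C n g = q * C (n - 1) g + (if d g dvd n then 1 else 0)"
proof (induction n rule: less_induct)
  case (less n)
  note dg = d_pos[OF g]
  have C0: "C 0 g = 0" using dg by (rule C_small)
  consider "n < d g" | "n = d g" | "n > d g" by linarith
  then show ?case
  proof cases
    case 1
    then show ?thesis using less.prems by (auto simp: C_small dest: dvd_imp_le)
  next
    case 2
    then show ?thesis using C_rec[OF g, of n] C_small[of "n - 1" g] C0 less.prems by simp
  next
    case 3
    have "C n g = C (n - d g) g + q ^ (n - d g)" using C_rec[OF g] 3 by simp
    also have "C (n - d g) g = q * C (n - d g - 1) g + (if d g dvd n - d g then 1 else 0)"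
      using 3 dg by (intro less.IH) auto
    also have "q ^ (n - d g) = q * q ^ (n - d g - 1)"
      using 3 by (metis power_eq_if zero_less_diff less_irrefl)
    also have "d g dvd n - d g \<longleftrightarrow> d g dvd n" using 3 by (simp add: dvd_minus_self)
    finally have "C n g = q * (C (n - 1 - d g) g + q ^ (n - 1 - d g)) + (if d g dvd n then 1 else 0)"
      by (simp add: algebra_simps)
    then show ?thesis using C_rec[OF g, of "n - 1"] 3 by simp
  qed
qed

text \<open>Double counting of the total degree of the \<open>q ^ n\<close> multisets of degree
  \<open>n\<close>.\<close>

lemma sum_C:
  assumes A: "finite A" "{g \<in> P. d g \<le> n} \<subseteq> A"
  shows "(\<Sum>g\<in>A. d g * C n g) = n * q ^ n"
proof -
  have "(\<Sum>g\<in>A. d g * C n g) = (\<Sum>M\<in>W n. \<Sum>g\<in>A. d g * count M g)"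
    unfolding C_def sum_distrib_left by (rule sum.swap)
  also have "\<dots> = (\<Sum>M\<in>W n. n)"
  proof (rule sum.cong[OF refl])
    fix M assume M: "M \<in> W n"
    then have "set_mset M \<subseteq> A" using A(2) d_le_W[OF M] unfolding W_def by auto
    from sum_mset_eq_sum_count[OF A(1) this, of d] M show "(\<Sum>g\<in>A. d g * count M g) = n"
      unfolding W_def by simp
  qed
  also have "\<dots> = n * q ^ n" using card_W[of n] by simp
  finally show ?thesis .
qed

text \<open>The total for n minus \<open>q\<close> times the total for n - 1 is n q^n - (n - 1) q^n
  = q^n; by \<open>C_step\<close> it is also the sum of the degrees of those primes whose degree
  divides n.\<close>

lemma sum_divisors_N:
  assumes n: "n > 0"
  shows "(\<Sum>k | k dvd n. k * N k) = q ^ n"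
proof -
  define A where "A = (\<Union>i\<le>n. level i)"
  have A: "finite A" unfolding A_def by (simp add: finite_level)
  have Aeq: "A = {g \<in> P. d g \<le> n}" unfolding A_def level_def by auto
  have sub: "{g \<in> P. d g \<le> n - 1} \<subseteq> A" unfolding Aeq by auto
  have "n * q ^ n = (\<Sum>g\<in>A. d g * C n g)" using sum_C[OF A] Aeq by simp
  also have "\<dots> = (\<Sum>g\<in>A. q * (d g * C (n - 1) g) + (if d g dvd n then d g else 0))"
    using C_step[OF _ n] Aeq by (intro sum.cong) (auto simp: algebra_simps)
  also have "\<dots> = q * ((n - 1) * q ^ (n - 1)) + (\<Sum>g\<in>A. if d g dvd n then d g else 0)"
    using sum_C[OF A sub] by (simp add: sum.distrib sum_distrib_left[symmetric])
  also have "q * ((n - 1) * q ^ (n - 1)) = (n - 1) * q ^ n"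
    using n by (cases n) auto
  finally have "q ^ n = (\<Sum>g\<in>A. if d g dvd n then d g else 0)"
    using n by (cases n) auto
  also have "\<dots> = (\<Sum>g\<in>(\<Union>k\<in>{k. k dvd n}. level k). d g)"
    using n A by (subst sum.If_cases) (auto simp: Aeq level_def intro!: sum.cong dest: dvd_imp_le)
  also have "\<dots> = (\<Sum>k | k dvd n. \<Sum>g\<in>level k. d g)"
    using n by (intro sum.UNION_disjoint) (auto simp: finite_level, auto simp: level_def)
  also have "\<dots> = (\<Sum>k | k dvd n. k * N k)"
    by (intro sum.cong refl) (simp add: N_def level_def)
  finally show ?thesis by simp
qed

lemma N_eq_necklace: "n > 0 \<Longrightarrow> real (N n) = necklace n (real q)"
  by (rule moebius_inversion_necklace[OF sum_divisors_N])

text \<open>The multiset form of writing a polynomial as a square times a squarefree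
  polynomial.\<close>

lemma double_plus_set:
  "set_mset M \<subseteq> P \<Longrightarrow> \<exists>H A. finite A \<and> A \<subseteq> P \<and> set_mset H \<subseteq> P \<and> M = H + H + mset_set A"
proof (induction M)
  case empty
  then show ?case by (intro exI[of _ "{#}"] exI[of _ "{}"]) auto
next
  case (add x M)
  then obtain H A where *: "finite A" "A \<subseteq> P" "set_mset H \<subseteq> P" "M = H + H + mset_set A" by auto
  show ?case
  proof (cases "x \<in> A")
    case True
    then have "mset_set A = add_mset x (mset_set (A - {x}))" using * by (simp add: mset_set.remove)
    then show ?thesis using * add.prems
      by (intro exI[of _ "add_mset x H"] exI[of _ "A - {x}"]) auto
  next
    case False
    then show ?thesis using * add.prems by (intro exI[of _ H] exI[of _ "insert x A"]) auto
  qed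
qed

lemma sum_mset_set: "sum_mset (image_mset d (mset_set A)) = sum d A"
  by (simp add: sum_unfold_sum_mset)

lemma finite_sets_of_degree: "finite (sets_of_degree n)"
proof (rule inj_on_finite[of mset_set _ "W n"])
  show "mset_set ` sets_of_degree n \<subseteq> W n" unfolding sets_of_degree_def W_def by (auto simp: sum_mset_set)
  show "inj_on mset_set (sets_of_degree n)" unfolding sets_of_degree_def
    by (intro inj_onI) (metis (mono_tags, lifting) finite_set_mset_mset_set mem_Collect_eq)
qed (rule finite_W)

text \<open>All multisets are sorted by the degree k of the part that is doubled. The decomposition
  is unique because the set consists of the elements of odd multiplicity.\<close>

lemma pow_eq_sum_sets: "q ^ n = (\<Sum>k\<le>n div 2. q ^ k * card (sets_of_degree (n - 2 * k)))"
proof -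
  define Z where "Z = (SIGMA k:{..n div 2}. W k \<times> sets_of_degree (n - 2 * k))"
  define h where "h = (\<lambda>(k::nat, H, A). H + H + mset_set (A::'a set))"
  have "bij_betw h Z (W n)"
    unfolding bij_betw_def
  proof
    show "inj_on h Z"
    proof (intro inj_onI)
      fix x y assume xy: "x \<in> Z" "y \<in> Z" "h x = h y"
      obtain k H A where x: "x = (k, H, A)" by (cases x) auto
      obtain k' H' A' where y: "y = (k', H', A')" by (cases y) auto
      have f: "finite A" "finite A'" using xy x y unfolding Z_def sets_of_degree_def by auto
      have cnt: "2 * count H g + (if g \<in> A then 1 else 0) = 2 * count H' g + (if g \<in> A' then 1 else 0)" for g
        using arg_cong[OF xy(3), of "\<lambda>M. count M g"] f unfolding x y h_def
        by (simp add: count_mset_set' split: if_splits)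
      have "count H g = count H' g \<and> (g \<in> A \<longleftrightarrow> g \<in> A')" for g
        using cnt[of g] by (auto split: if_splits) presburger+
      then have "H = H'" "A = A'" by (auto intro: multiset_eqI)
      moreover have "k = k'" using xy x y \<open>H = H'\<close> unfolding Z_def W_def by auto
      ultimately show "x = y" using x y by simp
    qed
    show "h ` Z = W n"
    proof safe
      fix k H A assume "(k, H, A) \<in> Z"
      then have kHA: "k \<le> n div 2" "set_mset H \<subseteq> P" "sum_mset (image_mset d H) = k" "finite A"
        "A \<subseteq> P" "sum d A = n - 2 * k"
        unfolding Z_def W_def sets_of_degree_def by auto
      have "k + k + (n - 2 * k) = n" using kHA(1) by linarith
      then show "h (k, H, A) \<in> W n" unfolding W_def h_def using kHA by (simp add: sum_mset_set)
    next
      fix M assume M: "M \<in> W n"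
      then obtain H A where *: "finite A" "A \<subseteq> P" "set_mset H \<subseteq> P" "M = H + H + mset_set A"
        using double_plus_set[of M] unfolding W_def by auto
      define k where "k = sum_mset (image_mset d H)"
      have kk: "sum_mset (image_mset d H) = k" by (simp add: k_def)
      have "n = k + k + sum d A" using M *(4) kk unfolding W_def by (simp add: sum_mset_set)
      then have "k \<le> n div 2" "sum d A = n - 2 * k" by auto
      then have "(k, H, A) \<in> Z" using *(1-3) kk unfolding Z_def W_def sets_of_degree_def by simp
      moreover have "h (k, H, A) = M" using * unfolding h_def by simp
      ultimately show "M \<in> h ` Z" by (metis image_eqI)
    qed
  qed
  then have "card (W n) = card Z" by (simp add: bij_betw_same_card)
  also have "\<dots> = (\<Sum>k\<le>n div 2. card (W k \<times> sets_of_degree (n - 2 * k)))"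
    unfolding Z_def by (intro card_SigmaI) (auto simp: finite_W finite_sets_of_degree)
  finally show ?thesis by (simp add: card_W card_cartesian_product)
qed

text \<open>In \<open>pow_eq_sum_sets\<close> the term k = 0 is the wanted number, and the remaining
  terms are \<open>q\<close> times the same sum for n - 2, which is q * q^(n - 2).\<close>

lemma card_sets_of_degree:
  assumes n: "n \<ge> 2"
  shows "card (sets_of_degree n) = q ^ n - q ^ (n - 1)"
proof -
  have dv: "n div 2 = Suc ((n - 2) div 2)" using n by (simp add: le_div_geq)
  have "q ^ n = card (sets_of_degree n) +
      (\<Sum>k\<le>(n - 2) div 2. q ^ Suc k * card (sets_of_degree (n - 2 * Suc k)))"
    by (subst pow_eq_sum_sets) (simp add: dv sum.atMost_Suc_shift del: sum.atMost_Suc)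
  also have "(\<Sum>k\<le>(n - 2) div 2. q ^ Suc k * card (sets_of_degree (n - 2 * Suc k))) =
      q * (\<Sum>k\<le>(n - 2) div 2. q ^ k * card (sets_of_degree (n - 2 - 2 * k)))"
    unfolding sum_distrib_left by (intro sum.cong refl) (simp add: algebra_simps)
  also have "\<dots> = q * q ^ (n - 2)" by (subst pow_eq_sum_sets[of "n - 2"]) simp
  also have "\<dots> = q ^ (n - 1)" using n by (simp flip: power_Suc add: Suc_diff_Suc numeral_2_eq_2)
  finally show ?thesis by simp
qed

section \<open>Squarefree products with prescribed degrees of the factors\<close>

definition sets_of_type :: "nat multiset \<Rightarrow> 'a set set" where
  "sets_of_type \<mu> = {A. finite A \<and> A \<subseteq> P \<and> image_mset d (mset_set A) = \<mu>}"

lemma count_degrees: "finite A \<Longrightarrow> count (image_mset d (mset_set A)) i = card {g \<in> A. d g = i}"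
  by (simp add: count_image_mset_eq_card_vimage vimage_def Int_def)

text \<open>A set of type \<open>\<mu>\<close> amounts to an independent choice of
  \<open>count \<mu> i\<close> elements from each level i.\<close>

lemma card_sets_of_type:
  assumes \<mu>: "is_partition_of \<mu> n"
  shows "card (sets_of_type \<mu>) = (\<Prod>i=1..n. N i choose count \<mu> i)"
proof -
  have supp: "i \<in> {1..n}" if "i \<in># \<mu>" for i
    using that \<mu> by (auto simp: is_partition_of_def Suc_le_eq intro: gr0I dest!: multi_member_split)
  define Y where "Y = (\<Pi>\<^sub>E i\<in>{1..n}. {B. B \<subseteq> level i \<and> card B = count \<mu> i})"
  define h where "h A = (\<lambda>i\<in>{1..n}. {g \<in> A. d g = i})" for A
  have "bij_betw h (sets_of_type \<mu>) Y"
    unfolding bij_betw_def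
  proof
    have deg: "d g \<in> {1..n}" if "A \<in> sets_of_type \<mu>" "g \<in> A" for A g
    proof (rule supp)
      have "finite A" using that unfolding sets_of_type_def by simp
      then have "d g \<in># image_mset d (mset_set A)" using that(2) by simp
      moreover have "image_mset d (mset_set A) = \<mu>" using that(1) unfolding sets_of_type_def by simp
      ultimately show "d g \<in># \<mu>" by (simp only:)
    qed
    show "inj_on h (sets_of_type \<mu>)"
    proof (intro inj_onI)
      fix A B assume AB: "A \<in> sets_of_type \<mu>" "B \<in> sets_of_type \<mu>" "h A = h B"
      have "g \<in> B" if "g \<in> A" "A \<in> sets_of_type \<mu>" "h A = h B" for A B g
        using fun_cong[OF that(3), of "d g"] deg[OF that(2,1)] that(1) unfolding h_def by auto
      then show "A = B" using AB by (metis subsetI subset_antisym)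
    qed
    show "h ` sets_of_type \<mu> = Y"
    proof safe
      fix A assume A: "A \<in> sets_of_type \<mu>"
      then show "h A \<in> Y" unfolding Y_def h_def level_def sets_of_type_def
        using count_degrees[of A] by auto
    next
      fix F assume F: "F \<in> Y"
      define A where "A = (\<Union>i\<in>{1..n}. F i)"
      have Fi: "F i \<subseteq> level i" "card (F i) = count \<mu> i" if "i \<in> {1..n}" for i
        using F that unfolding Y_def by auto
      have finA: "finite A" unfolding A_def using Fi(1) finite_subset[OF _ finite_level] by blast
      have lev: "{g \<in> A. d g = i} = F i" if "i \<in> {1..n}" for i
        using Fi(1) that unfolding A_def level_def by blast
      have lev0: "{g \<in> A. d g = i} = {}" if "i \<notin> {1..n}" for i
        using Fi(1) that unfolding A_def level_def by blast
      have "image_mset d (mset_set A) = \<mu>"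
      proof (rule multiset_eqI)
        fix i
        show "count (image_mset d (mset_set A)) i = count \<mu> i"
        proof (cases "i \<in> {1..n}")
          case False
          then have "count \<mu> i = 0" using supp by (meson not_in_iff)
          then show ?thesis using lev0[OF False] count_degrees[OF finA, of i] by (simp only: card.empty)
        qed (use lev count_degrees[OF finA, of i] Fi(2) in simp)
      qed
      moreover have "A \<subseteq> P" using Fi(1) unfolding A_def level_def by blast
      ultimately have "A \<in> sets_of_type \<mu>" unfolding sets_of_type_def using finA by simp
      moreover have "h A = F"
      proof
        fix i show "h A i = F i"
          by (cases "i \<in> {1..n}") (use F lev in \<open>auto simp: h_def Y_def PiE_def extensional_def\<close>)
      qed
      ultimately show "F \<in> h ` sets_of_type \<mu>" by blast
    qed
  qed
  then have "card (sets_of_type \<mu>) = card Y" by (rule bij_betw_same_card)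
  also have "\<dots> = (\<Prod>i=1..n. N i choose count \<mu> i)"
    unfolding Y_def N_def by (subst card_PiE) (auto simp: n_subsets finite_level)
  finally show ?thesis .
qed

text \<open>In \<open>sum_divisors_N\<close> the proper divisors contribute at most i q^(i - 1),
  which is at most half of q^i when 2 i <= q.\<close>

lemma N_lower_bound:
  assumes i: "i > 0" and q: "2 * i \<le> q"
  shows "real q ^ i / (2 * real i) \<le> real (N i)"
proof -
  have up: "k * N k \<le> q ^ k" if "k > 0" for k
    using sum_divisors_N[OF that] that member_le_sum[of k "{k'. k' dvd k}" "\<lambda>k. k * N k"] by simp
  have "(\<Sum>k | k dvd i. k * N k) = i * N i + (\<Sum>k\<in>{k. k dvd i} - {i}. k * N k)"
    using i by (subst sum.remove[of _ i]) auto
  also have "(\<Sum>k\<in>{k. k dvd i} - {i}. k * N k) \<le> (\<Sum>k\<in>{1..<i}. k * N k)"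
  proof (rule sum_mono2)
    show "{k. k dvd i} - {i} \<subseteq> {1..<i}"
    proof
      fix k assume k: "k \<in> {k. k dvd i} - {i}"
      then have "k \<noteq> 0" "k \<le> i" "k \<noteq> i" using i dvd_imp_le[of k i] by auto
      then show "k \<in> {1..<i}" by simp
    qed
  qed auto
  also have "\<dots> \<le> (\<Sum>k\<in>{1..<i}. q ^ (i - 1))"
    using q_ge_2 by (intro sum_mono order.trans[OF up] power_increasing) auto
  also have "\<dots> \<le> i * q ^ (i - 1)" by simp
  finally have "q ^ i \<le> i * N i + i * q ^ (i - 1)" using sum_divisors_N[OF i] by simp
  moreover have "2 * (i * q ^ (i - 1)) \<le> q ^ i"
    using q i mult_right_mono[OF q, of "q ^ (i - 1)"] by (cases i) (auto simp: algebra_simps)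
  ultimately have "q ^ i \<le> 2 * i * N i" by linarith
  then have "real (q ^ i) \<le> real (2 * i * N i)" by (rule of_nat_mono)
  then show ?thesis using i by (simp add: field_simps)
qed

text \<open>Each binomial coefficient is at least (N/c)^c, and \<open>N_lower_bound\<close> supplies
  q^i per chosen element of degree i, altogether q^n since the degrees add up to \<open>n\<close>.
  The constant does not depend on \<open>q\<close>, as the sieve requires; for a degree that does
  not occur in \<open>\<mu>\<close> its factor is 0^0 = 1. The bound on \<open>q\<close> ensures
  both c <= N and the hypothesis of \<open>N_lower_bound\<close>.\<close>

lemma card_sets_of_type_ge:
  assumes \<mu>: "is_partition_of \<mu> n" and q: "2 * n * n \<le> q"
  shows "(\<Prod>i=1..n. (1 / (2 * real i * real (count \<mu> i))) ^ count \<mu> i) * real q ^ n \<le>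
    real (card (sets_of_type \<mu>))"
proof -
  have set\<mu>: "set_mset \<mu> \<subseteq> {1..n}"
    using \<mu> by (auto simp: is_partition_of_def Suc_le_eq intro: gr0I dest!: multi_member_split)
  have sum\<mu>: "(\<Sum>i=1..n. i * count \<mu> i) = n"
    using sum_mset_eq_sum_count[OF _ set\<mu>, of "\<lambda>i. i"] \<mu> by (simp add: is_partition_of_def)
  have c_le: "count \<mu> i \<le> n" if "i \<in> {1..n}" for i
  proof -
    have "count \<mu> i \<le> i * count \<mu> i" using that by simp
    also have "\<dots> \<le> (\<Sum>i=1..n. i * count \<mu> i)" using that by (intro member_le_sum) auto
    finally show ?thesis using sum\<mu> by simp
  qed
  have "(\<Prod>i=1..n. (1 / (2 * real i * real (count \<mu> i))) ^ count \<mu> i) * real q ^ n =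
    (\<Prod>i=1..n. (1 / (2 * real i * real (count \<mu> i))) ^ count \<mu> i) * (\<Prod>i=1..n. real q ^ (i * count \<mu> i))"
    using sum\<mu> by (simp flip: power_sum)
  also have "\<dots> = (\<Prod>i=1..n. (real q ^ i / (2 * real i) / real (count \<mu> i)) ^ count \<mu> i)"
    unfolding prod.distrib[symmetric]
    by (intro prod.cong refl) (simp add: power_mult mult.assoc flip: power_mult_distrib)
  also have "\<dots> \<le> (\<Prod>i=1..n. real (N i choose count \<mu> i))"
  proof (intro prod_mono conjI)
    fix i assume i: "i \<in> {1..n}"
    then have i0: "i > 0" by simp
    have "i \<le> n * n" using i le_square[of n] by (auto intro: order.trans)
    then have "2 * i \<le> 2 * n * n" by simp
    then have qi: "2 * i \<le> q" using q by linarith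
    have low: "real q ^ i / (2 * real i) \<le> real (N i)" by (rule N_lower_bound[OF i0 qi])
    have "real (count \<mu> i) \<le> real n" using c_le[OF i] by simp
    also have "real n \<le> real q / (2 * real i)"
    proof -
      have "2 * i * n \<le> 2 * n * n" using i by simp
      then have "real (2 * i * n) \<le> real q" using q by linarith
      then show ?thesis using i0 by (simp add: field_simps)
    qed
    also have "\<dots> \<le> real q ^ i / (2 * real i)"
      using i0 q_ge_2 by (intro divide_right_mono self_le_power) auto
    also note low
    finally have cN: "count \<mu> i \<le> N i" by simp
    have "(real q ^ i / (2 * real i) / real (count \<mu> i)) ^ count \<mu> i \<le> (real (N i) / real (count \<mu> i)) ^ count \<mu> i"
      using low by (intro power_mono divide_right_mono) auto
    also have "\<dots> \<le> real (N i choose count \<mu> i)"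
      using binomial_ge_n_over_k_pow_k[OF cN, where 'a = real] by simp
    finally show "(real q ^ i / (2 * real i) / real (count \<mu> i)) ^ count \<mu> i \<le> real (N i choose count \<mu> i)" .
  qed auto
  finally show ?thesis using card_sets_of_type[OF \<mu>] by simp
qed

end

subsection \<open>Polynomial relations between the roots\<close>

text \<open>
  Integer polynomials in variables indexed by \<open>S\<close>, as functions of the assignment \<open>\<kappa>\<close> of values to
  the variables. The variables are the roots themselves, so \<open>F id\<close> is the value of \<open>F\<close> at the roots,
  and a permutation \<open>\<pi>\<close> of the roots is itself the assignment of the conjugated roots.
\<close>

inductive_set polyfun :: "complex set \<Rightarrow> ((complex \<Rightarrow> complex) \<Rightarrow> complex) set" for S where
  const: "(\<lambda>_. of_int c) \<in> polyfun S"
| var: "s \<in> S \<Longrightarrow> F \<in> polyfun S \<Longrightarrow> (\<lambda>\<kappa>. \<kappa> s * F \<kappa>) \<in> polyfun S"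
| add: "F \<in> polyfun S \<Longrightarrow> H \<in> polyfun S \<Longrightarrow> (\<lambda>\<kappa>. F \<kappa> + H \<kappa>) \<in> polyfun S"

lemma polyfun_0: "(\<lambda>_. 0) \<in> polyfun S" and polyfun_1: "(\<lambda>_. 1) \<in> polyfun S"
  using polyfun.const[of 0 S] polyfun.const[of 1 S] by simp_all

lemma polyfun_cmult: "F \<in> polyfun S \<Longrightarrow> (\<lambda>\<kappa>. of_int c * F \<kappa>) \<in> polyfun S"
proof (induction rule: polyfun.induct)
  case (const c')
  then show ?case using polyfun.const[of "c * c'" S] by simp
next
  case (var s F)
  then show ?case using polyfun.var[OF var(1,3)] by (simp add: mult.left_commute)
next
  case (add F H)
  then show ?case using polyfun.add[OF add(3,4)] by (simp add: distrib_left)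
qed

lemma polyfun_mult: "F \<in> polyfun S \<Longrightarrow> H \<in> polyfun S \<Longrightarrow> (\<lambda>\<kappa>. F \<kappa> * H \<kappa>) \<in> polyfun S"
proof (induction rule: polyfun.induct)
  case (const c)
  then show ?case by (rule polyfun_cmult)
next
  case (var s F)
  then show ?case using polyfun.var[OF var(1) var(3)[OF var(4)]] by (simp add: mult.assoc)
next
  case (add F H')
  then show ?case using polyfun.add[OF add(3)[OF add(5)] add(4)[OF add(5)]] by (simp add: distrib_right)
qed

lemma polyfun_id: "s \<in> S \<Longrightarrow> (\<lambda>\<kappa>. \<kappa> s) \<in> polyfun S"
  using polyfun.var[OF _ polyfun_1] by simp

lemma polyfun_uminus: "F \<in> polyfun S \<Longrightarrow> (\<lambda>\<kappa>. - F \<kappa>) \<in> polyfun S"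
  using polyfun_cmult[of F S "- 1"] by simp

lemma polyfun_diff: "F \<in> polyfun S \<Longrightarrow> H \<in> polyfun S \<Longrightarrow> (\<lambda>\<kappa>. F \<kappa> - H \<kappa>) \<in> polyfun S"
  using polyfun.add[OF _ polyfun_uminus] by simp

lemma polyfun_sum: "(\<And>i. i \<in> I \<Longrightarrow> F i \<in> polyfun S) \<Longrightarrow> (\<lambda>\<kappa>. \<Sum>i\<in>I. F i \<kappa>) \<in> polyfun S"
  by (induction I rule: infinite_finite_induct) (auto intro: polyfun_0 polyfun.add)

lemma polyfun_prod: "(\<And>i. i \<in> I \<Longrightarrow> F i \<in> polyfun S) \<Longrightarrow> (\<lambda>\<kappa>. \<Prod>i\<in>I. F i \<kappa>) \<in> polyfun S"
  by (induction I rule: infinite_finite_induct) (auto intro: polyfun_1 polyfun_mult)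

lemma polyfun_power: "F \<in> polyfun S \<Longrightarrow> (\<lambda>\<kappa>. F \<kappa> ^ k) \<in> polyfun S"
  by (induction k) (auto intro: polyfun_1 polyfun_mult)

lemma polyfun_comp: "F \<in> polyfun S \<Longrightarrow> \<pi> ` S \<subseteq> S \<Longrightarrow> (\<lambda>\<kappa>. F (\<kappa> \<circ> \<pi>)) \<in> polyfun S"
proof (induction rule: polyfun.induct)
  case (var s F)
  then have "\<pi> s \<in> S" by auto
  then show ?case using polyfun.var[OF _ var(3)[OF var(4)]] by (simp only: comp_apply)
qed (auto intro: polyfun.intros)

lemma polyfun_cong: "F \<in> polyfun S \<Longrightarrow> (\<And>s. s \<in> S \<Longrightarrow> \<kappa> s = \<kappa>' s) \<Longrightarrow> F \<kappa> = F \<kappa>'"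
  by (induction rule: polyfun.induct) auto

lemma polyfun_coeff_prod:
  assumes "finite I" "\<And>i k. i \<in> I \<Longrightarrow> (\<lambda>\<kappa>. coeff (h i \<kappa>) k) \<in> polyfun S"
  shows "(\<lambda>\<kappa>. coeff (\<Prod>i\<in>I. h i \<kappa>) k) \<in> polyfun S"
  using assms
proof (induction I arbitrary: k rule: finite_induct)
  case empty
  then show ?case by (cases k) (auto intro: polyfun_0 polyfun_1)
next
  case (insert i I)
  then show ?case
    by (simp add: coeff_mult) (intro polyfun_sum polyfun_mult, auto)
qed

text \<open>If all power sums with positive exponent vanished, so would the sum of y h(y) for every
  polynomial h. With h vanishing at all values except that of \<open>y i0\<close>, this sum is a
  nonzero multiple of y h(y) at that value.\<close>

lemma ex_power_sum_nonzero:
  fixes y :: "'b \<Rightarrow> complex"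
  assumes I: "finite I" "i0 \<in> I" "y i0 \<noteq> 0"
  shows "\<exists>e\<ge>1. (\<Sum>i\<in>I. y i ^ e) \<noteq> 0"
proof (rule ccontr)
  assume "\<not> ?thesis"
  then have z: "(\<Sum>i\<in>I. y i ^ Suc e) = 0" for e by auto
  define h where "h = (\<Prod>v\<in>y ` I - {y i0}. [:- v, 1:])"
  have "(\<Sum>i\<in>I. y i * poly h (y i)) = (\<Sum>i\<in>I. \<Sum>e\<le>degree h. coeff h e * y i ^ Suc e)"
    by (simp add: poly_altdef sum_distrib_left algebra_simps)
  also have "\<dots> = (\<Sum>e\<le>degree h. coeff h e * (\<Sum>i\<in>I. y i ^ Suc e))"
    unfolding sum_distrib_left by (rule sum.swap)
  also have "\<dots> = 0" unfolding z by simp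
  finally have "(\<Sum>i\<in>I. y i * poly h (y i)) = 0" .
  also have "(\<Sum>i\<in>I. y i * poly h (y i)) = (\<Sum>i\<in>{i\<in>I. y i = y i0}. y i * poly h (y i))"
    using I by (intro sum.mono_neutral_right) (auto simp: h_def poly_prod)
  also have "\<dots> = of_nat (card {i\<in>I. y i = y i0}) * (y i0 * poly h (y i0))" by simp
  finally have "card {i\<in>I. y i = y i0} = 0 \<or> poly h (y i0) = 0" using I by auto
  moreover have "poly h (y i0) \<noteq> 0" using I unfolding h_def by (auto simp: poly_prod)
  moreover have "card {i\<in>I. y i = y i0} \<noteq> 0" using I by auto
  ultimately show False by blast
qed

text \<open>Integral power sums are all that is required of the set; that it consists of the roots
  of an integer polynomial enters only through them.\<close>

locale root_set =
  fixes S :: "complex set"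
  assumes fin_S: "finite S" and power_sums: "\<And>e. (\<Sum>s\<in>S. s ^ e) \<in> \<int>"
begin

definition G :: "(complex \<Rightarrow> complex) set" where
  "G = {\<pi>. \<pi> permutes S \<and> (\<forall>F\<in>polyfun S. F id = 0 \<longrightarrow> F \<pi> = 0)}"

text \<open>The ring \<int>[S].\<close>

definition R :: "complex set" where "R = (\<lambda>F. F id) ` polyfun S"

text \<open>The monomial with exponents \<open>e\<close> collects the variables met during the
  induction. For constant \<open>F\<close> the values at different roots are chosen independently,
  so the sum factors into power sums.\<close>

lemma trace_monom: "F \<in> polyfun S \<Longrightarrow> (\<Sum>\<kappa>\<in>S \<rightarrow>\<^sub>E S. F \<kappa> * (\<Prod>s\<in>S. \<kappa> s ^ e s)) \<in> \<int>"
proof (induction arbitrary: e rule: polyfun.induct)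
  case (const c)
  have "(\<Sum>\<kappa>\<in>S \<rightarrow>\<^sub>E S. (\<Prod>s\<in>S. \<kappa> s ^ e s)) = (\<Prod>s\<in>S. \<Sum>t\<in>S. t ^ e s)"
    using prod_sum_PiE[of S "\<lambda>_. S" "\<lambda>s t. t ^ e s"] fin_S by simp
  also have "\<dots> \<in> \<int>" by (intro Ints_prod power_sums)
  finally show ?case by (simp add: sum_distrib_left[symmetric])
next
  case (var s F)
  have "\<kappa> s * F \<kappa> * (\<Prod>t\<in>S. \<kappa> t ^ e t) = F \<kappa> * (\<Prod>t\<in>S. \<kappa> t ^ (e(s := Suc (e s))) t)" for \<kappa>
    using var(1) fin_S by (simp add: prod.remove[of S s])
  then show ?case using var(3)[of "e(s := Suc (e s))"] by (simp only:)
next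
  case (add F H)
  then show ?case by (simp add: distrib_right sum.distrib)
qed

lemma trace_int: "F \<in> polyfun S \<Longrightarrow> (\<Sum>\<kappa>\<in>S \<rightarrow>\<^sub>E S. F \<kappa>) \<in> \<int>"
  using trace_monom[of F "\<lambda>_. 0"] by simp

lemma finite_G: "finite G"
  by (rule finite_subset[OF _ finite_permutations[OF fin_S]]) (auto simp: G_def)

lemma card_G: "card G \<le> fact (card S)"
  using card_mono[OF finite_permutations[OF fin_S], of G] card_permutations[OF refl fin_S]
  by (auto simp: G_def)

lemma G_permutes: "\<pi> \<in> G \<Longrightarrow> \<pi> permutes S" by (simp add: G_def)

lemma G_zero: "\<pi> \<in> G \<Longrightarrow> F \<in> polyfun S \<Longrightarrow> F id = 0 \<Longrightarrow> F \<pi> = 0" by (simp add: G_def)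

lemma G_id: "id \<in> G" by (simp add: G_def permutes_id)

lemma G_comp: assumes "\<pi> \<in> G" "\<rho> \<in> G" shows "\<rho> \<circ> \<pi> \<in> G"
proof -
  have im: "\<pi> ` S \<subseteq> S" using permutes_image[OF G_permutes[OF assms(1)]] by simp
  have "F (\<rho> \<circ> \<pi>) = 0" if "F \<in> polyfun S" "F id = 0" for F
  proof -
    have "F \<pi> = 0" using G_zero[OF assms(1) that] .
    then show ?thesis using G_zero[OF assms(2) polyfun_comp[OF that(1) im]] by simp
  qed
  then show ?thesis using permutes_compose[OF G_permutes G_permutes] assms by (auto simp: G_def)
qed

text \<open>Membership in \<open>G\<close> demands that relations are preserved, not that they are
  reflected. Inverses exist because composing with \<open>\<pi>\<close> is an injective map of the
  finite set \<open>G\<close> into itself.\<close>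

lemma G_inverse:
  assumes "\<pi> \<in> G" obtains \<rho> where "\<rho> \<in> G" "\<rho> \<circ> \<pi> = id" "\<pi> \<circ> \<rho> = id"
proof -
  have bij: "bij \<pi>" using permutes_bij[OF G_permutes[OF assms]] .
  have "inj_on (\<lambda>\<rho>. \<pi> \<circ> \<rho>) G" using bij by (auto simp: inj_on_def fun_eq_iff bij_def inj_def)
  moreover have "(\<lambda>\<rho>. \<pi> \<circ> \<rho>) ` G \<subseteq> G" using G_comp assms by auto
  ultimately have "(\<lambda>\<rho>. \<pi> \<circ> \<rho>) ` G = G" using endo_inj_surj[OF finite_G] by blast
  then obtain \<rho> where \<rho>: "\<rho> \<in> G" "\<pi> \<circ> \<rho> = id" using G_id by (metis (mono_tags, lifting) imageE)
  have "\<pi> ((\<rho> \<circ> \<pi>) x) = \<pi> x" for x using \<rho>(2) by (metis comp_apply id_apply)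
  then have "\<rho> \<circ> \<pi> = id" using bij by (auto simp: fun_eq_iff bij_def inj_def)
  then show ?thesis using that \<rho> by blast
qed

lemma G_zero_iff:
  assumes "\<pi> \<in> G" "F \<in> polyfun S" shows "F \<pi> = 0 \<longleftrightarrow> F id = 0"
proof
  assume 0: "F \<pi> = 0"
  obtain \<rho> where \<rho>: "\<rho> \<in> G" "\<rho> \<circ> \<pi> = id" using G_inverse[OF assms(1)] by metis
  have im: "\<pi> ` S \<subseteq> S" using permutes_image[OF G_permutes[OF assms(1)]] by simp
  show "F id = 0" using G_zero[OF \<rho>(1) polyfun_comp[OF assms(2) im]] 0 \<rho>(2) by simp
qed (rule G_zero[OF assms])

lemma prod_G_comp:
  assumes "\<rho> \<in> G" shows "(\<Prod>\<pi>\<in>G. g (\<rho> \<circ> \<pi>)) = (\<Prod>\<pi>\<in>G. g \<pi>)"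
proof -
  obtain \<rho>' where \<rho>': "\<rho>' \<in> G" "\<rho>' \<circ> \<rho> = id" "\<rho> \<circ> \<rho>' = id" using G_inverse[OF assms] by metis
  have "\<rho>' \<circ> (\<rho> \<circ> \<pi>) = \<pi>" "\<rho> \<circ> (\<rho>' \<circ> \<pi>) = \<pi>" for \<pi>
    using \<rho>' by (simp_all add: comp_assoc[symmetric])
  then show ?thesis
    by (intro prod.reindex_bij_witness[of _ "\<lambda>\<pi>. \<rho>' \<circ> \<pi>" "\<lambda>\<pi>. \<rho> \<circ> \<pi>"])
      (use assms \<rho>'(1) G_comp in auto)
qed

text \<open>A permutation outside \<open>G\<close> violates a relation, but this gives an expression
  that is zero at \<open>id\<close> and nonzero at the permutation, the wrong way round. So the
  relation is taken for the inverse permutation and then composed with it, which exchanges the two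
  values.\<close>

lemma separate_one:
  assumes \<kappa>: "\<kappa> \<in> S \<rightarrow>\<^sub>E S" and nG: "\<kappa> \<notin> (\<lambda>\<pi>. restrict \<pi> S) ` G"
  shows "\<exists>F\<in>polyfun S. F id \<noteq> 0 \<and> F \<kappa> = 0"
proof (cases "inj_on \<kappa> S")
  case False
  then obtain a b where ab: "a \<in> S" "b \<in> S" "a \<noteq> b" "\<kappa> a = \<kappa> b" by (auto simp: inj_on_def)
  then show ?thesis
    by (intro bexI[of _ "\<lambda>\<kappa>. \<kappa> a - \<kappa> b"]) (auto intro: polyfun_diff polyfun_id)
next
  case True
  define \<pi> where "\<pi> x = (if x \<in> S then \<kappa> x else x)" for x
  have "\<kappa> ` S \<subseteq> S" using \<kappa> by auto
  then have "\<kappa> ` S = S" using endo_inj_surj[OF fin_S _ True] by simp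
  then have "bij_betw \<kappa> S S" using True by (simp add: bij_betw_def)
  then have "bij_betw \<pi> S S" by (rule bij_betw_cong[THEN iffD1, rotated]) (simp add: \<pi>_def)
  then have perm: "\<pi> permutes S" by (rule bij_imp_permutes) (simp add: \<pi>_def)
  have \<kappa>\<pi>: "\<kappa> = restrict \<pi> S" using \<kappa> by (auto simp: \<pi>_def PiE_def extensional_def restrict_def)
  define \<pi>' where "\<pi>' = inv_into UNIV \<pi>"
  have perm': "\<pi>' permutes S" unfolding \<pi>'_def by (rule permutes_inv[OF perm])
  have inv: "\<pi> \<circ> \<pi>' = id" unfolding \<pi>'_def by (rule permutes_inv_o(1)[OF perm])
  have "\<pi>' \<notin> G"
  proof
    assume "\<pi>' \<in> G"
    then obtain \<rho> where \<rho>: "\<rho> \<in> G" "\<pi>' \<circ> \<rho> = id" using G_inverse by metis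
    have "\<pi> = \<pi> \<circ> (\<pi>' \<circ> \<rho>)" using \<rho>(2) by simp
    also have "\<dots> = \<rho>" using inv by (simp add: comp_assoc[symmetric])
    finally show False using \<rho>(1) nG \<kappa>\<pi> by auto
  qed
  then obtain F where F: "F \<in> polyfun S" "F id = 0" "F \<pi>' \<noteq> 0" using perm' by (auto simp: G_def)
  have im: "\<pi>' ` S \<subseteq> S" using permutes_image[OF perm'] by simp
  have c: "(\<lambda>\<tau>. F (\<tau> \<circ> \<pi>')) \<in> polyfun S" by (rule polyfun_comp[OF F(1) im])
  have "F (\<kappa> \<circ> \<pi>') = F (\<pi> \<circ> \<pi>')"
    using polyfun_cong[OF c, of \<kappa> \<pi>] \<kappa>\<pi> by simp
  then show ?thesis using c F inv by (intro bexI[OF _ c]) auto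
qed

text \<open>
  The product of the expressions that separate \<open>id\<close> from each map outside \<open>G\<close> vanishes off \<open>G\<close>; a
  suitable power of it has nonzero sum over \<open>G\<close>.
\<close>

lemma ex_detector:
  obtains D where "D \<in> polyfun S" "(\<Sum>\<pi>\<in>G. D \<pi>) \<noteq> 0"
    "\<And>F. F \<in> polyfun S \<Longrightarrow> (\<Sum>\<pi>\<in>G. D \<pi> * F \<pi>) \<in> \<int>"
proof -
  \<comment> \<open>The sums over all maps use extensional functions, whereas permutations are the
    identity off \<open>S\<close>; \<open>r\<close> passes from the latter to the former.\<close>
  define r where "r = (\<lambda>\<pi>::complex \<Rightarrow> complex. restrict \<pi> S)"
  define E where "E = (S \<rightarrow>\<^sub>E S) - r ` G"
  have finE: "finite (S \<rightarrow>\<^sub>E S)" using fin_S by (simp add: finite_PiE)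
  have "\<forall>\<kappa>\<in>E. \<exists>F\<in>polyfun S. F id \<noteq> 0 \<and> F \<kappa> = 0" using separate_one unfolding E_def r_def by blast
  then obtain Q where Q: "\<And>\<kappa>. \<kappa> \<in> E \<Longrightarrow> Q \<kappa> \<in> polyfun S \<and> Q \<kappa> id \<noteq> 0 \<and> Q \<kappa> \<kappa> = 0" by metis
  define D0 where "D0 \<tau> = (\<Prod>\<kappa>\<in>E. Q \<kappa> \<tau>)" for \<tau>
  have D0: "D0 \<in> polyfun S" unfolding D0_def using Q by (intro polyfun_prod) auto
  have D0id: "D0 id \<noteq> 0" unfolding D0_def using Q finE by (auto simp: E_def)
  have D0E: "D0 \<kappa> = 0" if "\<kappa> \<in> E" for \<kappa>
    unfolding D0_def using Q[OF that] that finE by (auto simp: E_def)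
  obtain e where e: "e \<ge> 1" "(\<Sum>\<pi>\<in>G. D0 \<pi> ^ e) \<noteq> 0"
    using ex_power_sum_nonzero[OF finite_G G_id, of D0] D0id by auto
  define D where "D \<tau> = D0 \<tau> ^ e" for \<tau>
  have D: "D \<in> polyfun S" unfolding D_def by (rule polyfun_power[OF D0])
  have rG: "r ` G \<subseteq> S \<rightarrow>\<^sub>E S" unfolding r_def using permutes_in_image[OF G_permutes] by auto
  have inj: "inj_on r G"
  proof (intro inj_onI ext)
    fix \<pi> \<rho> x assume a: "\<pi> \<in> G" "\<rho> \<in> G" "r \<pi> = r \<rho>"
    show "\<pi> x = \<rho> x"
    proof (cases "x \<in> S")
      case True
      then show ?thesis using fun_cong[OF a(3), of x] by (simp add: r_def)
    next
      case False
      then show ?thesis using G_permutes[OF a(1)] G_permutes[OF a(2)] by (simp add: permutes_not_in)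
    qed
  qed
  have "(\<Sum>\<pi>\<in>G. D \<pi> * F \<pi>) \<in> \<int>" if F: "F \<in> polyfun S" for F
  proof -
    have DF: "(\<lambda>\<kappa>. D \<kappa> * F \<kappa>) \<in> polyfun S" by (rule polyfun_mult[OF D F])
    have "(\<Sum>\<pi>\<in>G. D \<pi> * F \<pi>) = (\<Sum>\<pi>\<in>G. D (r \<pi>) * F (r \<pi>))"
    proof (rule sum.cong[OF refl])
      fix \<pi>
      show "D \<pi> * F \<pi> = D (r \<pi>) * F (r \<pi>)"
        by (rule polyfun_cong[OF DF]) (simp add: r_def)
    qed
    also have "\<dots> = (\<Sum>\<kappa>\<in>r ` G. D \<kappa> * F \<kappa>)" using inj by (simp add: sum.reindex)
    also have "\<dots> = (\<Sum>\<kappa>\<in>S \<rightarrow>\<^sub>E S. D \<kappa> * F \<kappa>)"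
      using finE rG D0E e(1) by (intro sum.mono_neutral_left) (auto simp: E_def D_def)
    also have "\<dots> \<in> \<int>" by (rule trace_int[OF DF])
    finally show ?thesis .
  qed
  then show ?thesis using that[OF D] e(2) unfolding D_def by blast
qed

text \<open>The constant value of \<open>F\<close> on \<open>G\<close> can be pulled out of the
  weighted sum, so it is a quotient of two integers.\<close>

lemma fixed_rational:
  assumes F: "F \<in> polyfun S" and fixed: "\<And>\<pi>. \<pi> \<in> G \<Longrightarrow> F \<pi> = F id"
  shows "F id \<in> \<rat>"
proof -
  obtain D where D: "D \<in> polyfun S" "(\<Sum>\<pi>\<in>G. D \<pi>) \<noteq> 0"
    "\<And>F. F \<in> polyfun S \<Longrightarrow> (\<Sum>\<pi>\<in>G. D \<pi> * F \<pi>) \<in> \<int>" by (rule ex_detector) blast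
  have "(\<Sum>\<pi>\<in>G. D \<pi> * F \<pi>) = (\<Sum>\<pi>\<in>G. D \<pi>) * F id"
    unfolding sum_distrib_right using fixed by (intro sum.cong) auto
  then have "F id = (\<Sum>\<pi>\<in>G. D \<pi> * F \<pi>) / (\<Sum>\<pi>\<in>G. D \<pi> * 1)" using D(2) by simp
  moreover have "(\<Sum>\<pi>\<in>G. D \<pi> * F \<pi>) \<in> \<rat>" "(\<Sum>\<pi>\<in>G. D \<pi> * 1) \<in> \<rat>"
    using D(3)[OF F] D(3)[OF polyfun_1] Ints_subset_Rats by auto
  ultimately show ?thesis by (metis Rats_divide)
qed

text \<open>If \<open>F\<close> had the value 1/q at the roots, it would have this value on all of
  \<open>G\<close>. The weighted sums of its powers would then be d / q^e, an integer for every e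
  with the same nonzero integer \<open>d\<close>.\<close>

lemma prime_not_invertible:
  assumes F: "F \<in> polyfun S" and q: "q \<ge> (2::nat)"
  shows "of_nat q * F id \<noteq> 1"
proof
  assume "of_nat q * F id = 1"
  moreover have H: "(\<lambda>\<kappa>. of_nat q * F \<kappa> - 1) \<in> polyfun S"
    using polyfun_diff[OF polyfun_cmult[OF F, of "int q"] polyfun_1] by simp
  ultimately have Fp: "F \<pi> = 1 / of_nat q" if "\<pi> \<in> G" for \<pi>
    using G_zero[OF that H] q by (simp add: field_simps)
  obtain D where D: "D \<in> polyfun S" "(\<Sum>\<pi>\<in>G. D \<pi>) \<noteq> 0"
    "\<And>F. F \<in> polyfun S \<Longrightarrow> (\<Sum>\<pi>\<in>G. D \<pi> * F \<pi>) \<in> \<int>" by (rule ex_detector) blast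
  define d where "d = (\<Sum>\<pi>\<in>G. D \<pi>)"
  have all: "d / of_nat q ^ e \<in> \<int>" for e
  proof -
    have "(\<Sum>\<pi>\<in>G. D \<pi> * F \<pi> ^ e) = d / of_nat q ^ e"
      unfolding d_def sum_divide_distrib by (intro sum.cong) (auto simp: Fp power_divide)
    then show ?thesis using D(3)[OF polyfun_power[OF F, of e]] by simp
  qed
  obtain m where m: "d = of_int m" using all[of 0] by (auto elim: Ints_cases)
  have m0: "m \<noteq> 0" using D(2) m unfolding d_def by auto
  \<comment> \<open>Any exponent with q^e > |m| gives the contradiction; |m| itself is large enough
    because q >= 2.\<close>
  define e where "e = nat \<bar>m\<bar>"
  obtain k where k: "d / of_nat q ^ e = of_int k" using all[of e] by (auto elim: Ints_cases)
  then have "(of_int m :: complex) = of_int (k * int q ^ e)" using m q by (simp add: field_simps)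
  then have mk: "m = k * int q ^ e" by (simp only: of_int_eq_iff)
  then have "int q ^ e dvd m" by simp
  then have "int q ^ e \<le> \<bar>m\<bar>" using dvd_imp_le_int[OF m0, of "int q ^ e"] by simp
  moreover have "e < q ^ e"
    using less_le_trans[OF less_exp power_mono[OF q]] by simp
  then have "int e < int q ^ e" by (simp flip: of_nat_power)
  ultimately show False unfolding e_def by simp
qed

section \<open>The ring generated by the roots and its prime ideals\<close>

lemma R_I: "F \<in> polyfun S \<Longrightarrow> F id \<in> R" by (simp add: R_def)

lemma R_add: "x \<in> R \<Longrightarrow> y \<in> R \<Longrightarrow> x + y \<in> R"
  using R_I[OF polyfun.add] by (auto simp: R_def)
lemma R_diff: "x \<in> R \<Longrightarrow> y \<in> R \<Longrightarrow> x - y \<in> R"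
  using R_I[OF polyfun_diff] by (auto simp: R_def)
lemma R_mult: "x \<in> R \<Longrightarrow> y \<in> R \<Longrightarrow> x * y \<in> R"
  using R_I[OF polyfun_mult] by (auto simp: R_def)
lemma R_int: "of_int c \<in> R" using R_I[OF polyfun.const] by simp
lemma R_nat: "of_nat c \<in> R" using R_int[of "int c"] by simp
lemma R_0: "0 \<in> R" and R_1: "1 \<in> R" using R_int[of 0] R_int[of 1] by simp_all
lemma R_S: "s \<in> S \<Longrightarrow> s \<in> R" using R_I[OF polyfun_id] by simp
lemma R_uminus: "x \<in> R \<Longrightarrow> - x \<in> R" using R_diff[OF R_0] by simp
lemma R_sum: "(\<And>i. i \<in> I \<Longrightarrow> h i \<in> R) \<Longrightarrow> sum h I \<in> R"
  by (induction I rule: infinite_finite_induct) (auto intro: R_0 R_add)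
lemma R_prod: "(\<And>i. i \<in> I \<Longrightarrow> h i \<in> R) \<Longrightarrow> prod h I \<in> R"
  by (induction I rule: infinite_finite_induct) (auto intro: R_1 R_mult)
lemma R_power: "x \<in> R \<Longrightarrow> x ^ k \<in> R"
  by (induction k) (auto intro: R_1 R_mult)
lemma R_poly: "(\<And>i. coeff h i \<in> R) \<Longrightarrow> x \<in> R \<Longrightarrow> poly h x \<in> R"
  unfolding poly_altdef by (intro R_sum R_mult R_power)
lemma R_poly_int: "x \<in> R \<Longrightarrow> poly (of_int_poly h) x \<in> R"
  by (rule R_poly) (auto simp: R_int)

definition is_ideal :: "complex set \<Rightarrow> bool" where
  "is_ideal J \<longleftrightarrow> J \<subseteq> R \<and> 0 \<in> J \<and> (\<forall>x\<in>J. \<forall>y\<in>J. x + y \<in> J) \<and> (\<forall>r\<in>R. \<forall>x\<in>J. r * x \<in> J)"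

text \<open>An ideal maximal among those that contain \<open>q\<close> but not 1, by Zorn's lemma.
  The principal ideal of \<open>q\<close> starts the chain argument, thanks to
  \<open>prime_not_invertible\<close>.\<close>

lemma ex_prime_ideal:
  assumes q: "q \<ge> (2::nat)"
  obtains J where "is_ideal J" "of_nat q \<in> J" "1 \<notin> J"
    "\<And>x y. x \<in> R \<Longrightarrow> y \<in> R \<Longrightarrow> x * y \<in> J \<Longrightarrow> x \<in> J \<or> y \<in> J"
proof -
  define \<A> where "\<A> = {J. is_ideal J \<and> of_nat q \<in> J \<and> 1 \<notin> J}"
  have "(\<lambda>r. of_nat q * r) ` R \<in> \<A>"
  proof -
    have "1 \<notin> (\<lambda>r. of_nat q * r) ` R"
      using prime_not_invertible[OF _ q] by (auto simp: R_def)
    moreover have "is_ideal ((\<lambda>r. of_nat q * r) ` R)"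
      unfolding is_ideal_def
      by (auto simp: R_nat R_mult R_0 R_add distrib_left[symmetric] mult.left_commute[of _ "of_nat q"])
    ultimately show ?thesis unfolding \<A>_def using R_1 by auto
  qed
  then have ne: "\<A> \<noteq> {}" by blast
  have "\<exists>J\<in>\<A>. \<forall>J'\<in>\<A>. J \<subseteq> J' \<longrightarrow> J' = J"
  proof (rule subset_Zorn_nonempty[OF ne])
    fix \<C> assume \<C>: "\<C> \<noteq> {}" "subset.chain \<A> \<C>"
    then have mem: "J \<in> \<A>" if "J \<in> \<C>" for J using that by (auto simp: subset.chain_def)
    have idl: "is_ideal J" if "J \<in> \<C>" for J using mem[OF that] by (simp add: \<A>_def)
    have "x + y \<in> \<Union>\<C>" if xy: "x \<in> \<Union>\<C>" "y \<in> \<Union>\<C>" for x y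
    proof -
      obtain A B where AB: "A \<in> \<C>" "B \<in> \<C>" "x \<in> A" "y \<in> B" using xy by auto
      then have "A \<subseteq> B \<or> B \<subseteq> A" using \<C>(2) by (auto simp: subset.chain_def)
      then obtain J where "J \<in> \<C>" "x \<in> J" "y \<in> J" using AB by blast
      then show ?thesis using idl unfolding is_ideal_def by blast
    qed
    moreover have "\<Union>\<C> \<subseteq> R" "0 \<in> \<Union>\<C>" "\<And>r x. r \<in> R \<Longrightarrow> x \<in> \<Union>\<C> \<Longrightarrow> r * x \<in> \<Union>\<C>"
      using idl \<C>(1) unfolding is_ideal_def by blast+
    ultimately have "is_ideal (\<Union>\<C>)" unfolding is_ideal_def by blast
    then show "\<Union>\<C> \<in> \<A>" using mem \<C>(1) unfolding \<A>_def by blast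
  qed
  then obtain J where J: "J \<in> \<A>" and max: "\<And>J'. J' \<in> \<A> \<Longrightarrow> J \<subseteq> J' \<Longrightarrow> J' = J" by blast
  have idl: "is_ideal J" using J by (simp add: \<A>_def)
  have prime: "x \<in> J \<or> y \<in> J" if xy: "x \<in> R" "y \<in> R" "x * y \<in> J" for x y
  proof (rule ccontr)
    assume n: "\<not> ?thesis"
    define J' where "J' = {j + r * x | j r. j \<in> J \<and> r \<in> R}"
    have sub: "J \<subseteq> J'" unfolding J'_def using R_0 by force
    have xJ': "x \<in> J'" unfolding J'_def using R_1 idl unfolding is_ideal_def by force
    have "is_ideal J'"
      unfolding is_ideal_def
    proof (intro conjI ballI)
      show "J' \<subseteq> R" using idl xy(1) unfolding is_ideal_def J'_def by (auto intro!: R_add R_mult)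
      show "0 \<in> J'" using sub idl unfolding is_ideal_def by blast
      fix a b assume "a \<in> J'" "b \<in> J'"
      then obtain j r j' r' where "a = j + r * x" "b = j' + r' * x" "j \<in> J" "j' \<in> J" "r \<in> R" "r' \<in> R"
        unfolding J'_def by auto
      then have "a + b = (j + j') + (r + r') * x" "j + j' \<in> J" "r + r' \<in> R"
        using idl R_add unfolding is_ideal_def by (auto simp: algebra_simps)
      then show "a + b \<in> J'" unfolding J'_def by blast
    next
      fix c a assume c: "c \<in> R" and "a \<in> J'"
      then obtain j r where "a = j + r * x" "j \<in> J" "r \<in> R" unfolding J'_def by auto
      then have "c * a = c * j + (c * r) * x" "c * j \<in> J" "c * r \<in> R"
        using idl R_mult c unfolding is_ideal_def by (auto simp: algebra_simps)
      then show "c * a \<in> J'" unfolding J'_def by blast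
    qed
    then have "1 \<in> J'" using max[OF _ sub] xJ' n sub J unfolding \<A>_def by blast
    then obtain j r where jr: "1 = j + r * x" "j \<in> J" "r \<in> R" unfolding J'_def by auto
    have "y = (j + r * x) * y" using jr(1) by simp
    then have "y = y * j + r * (x * y)" by (simp add: algebra_simps)
    moreover have "y * j \<in> J" "r * (x * y) \<in> J" using idl jr xy unfolding is_ideal_def by auto
    ultimately have "y \<in> J" using idl unfolding is_ideal_def by metis
    then show False using n by simp
  qed
  show ?thesis using that[OF idl _ _ prime] J unfolding \<A>_def by blast
qed

end

subsection \<open>Frobenius permutations\<close>

text \<open>The identity \<open>bez\<close> expresses that \<open>f\<close> is separable modulo
  \<open>q\<close>; it is what keeps distinct roots incongruent modulo \<open>J\<close>.\<close>

locale prime_above = root_set S for S +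
  fixes q :: nat and J :: "complex set" and f u v w :: "int poly"
  assumes prime_q: "prime q" and idl: "is_ideal J" and q_J: "of_nat q \<in> J" and one_J: "1 \<notin> J"
    and prime_J: "\<And>x y. x \<in> R \<Longrightarrow> y \<in> R \<Longrightarrow> x * y \<in> J \<Longrightarrow> x \<in> J \<or> y \<in> J"
    and f_S: "of_int_poly f = (\<Prod>s\<in>S. [:- s, 1:])"
    and bez: "u * f + v * pderiv f = 1 + smult (int q) w"
begin

lemma J_R: "x \<in> J \<Longrightarrow> x \<in> R" using idl by (auto simp: is_ideal_def)
lemma J_0: "0 \<in> J" using idl by (auto simp: is_ideal_def)
lemma J_add: "x \<in> J \<Longrightarrow> y \<in> J \<Longrightarrow> x + y \<in> J" using idl by (auto simp: is_ideal_def)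
lemma J_mult: "r \<in> R \<Longrightarrow> x \<in> J \<Longrightarrow> r * x \<in> J" using idl by (auto simp: is_ideal_def)
lemma J_mult': "x \<in> J \<Longrightarrow> r \<in> R \<Longrightarrow> x * r \<in> J" using J_mult[of r x] by (simp add: mult.commute)
lemma J_uminus: "x \<in> J \<Longrightarrow> - x \<in> J" using J_mult[OF R_uminus[OF R_1]] by simp
lemma J_diff: "x \<in> J \<Longrightarrow> y \<in> J \<Longrightarrow> x - y \<in> J" using J_add[OF _ J_uminus] by simp
lemma J_sum: "(\<And>i. i \<in> I \<Longrightarrow> h i \<in> J) \<Longrightarrow> sum h I \<in> J"
  by (induction I rule: infinite_finite_induct) (auto intro: J_0 J_add)

lemma J_prod:
  "finite I \<Longrightarrow> (\<And>i. i \<in> I \<Longrightarrow> h i \<in> R) \<Longrightarrow> prod h I \<in> J \<Longrightarrow> \<exists>i\<in>I. h i \<in> J"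
proof (induction I rule: finite_induct)
  case (insert i I)
  then show ?case using prime_J[of "h i" "prod h I"] R_prod[of I h] by auto
qed (use one_J in simp)

lemma J_power: "x \<in> R \<Longrightarrow> x ^ k \<in> J \<Longrightarrow> x \<in> J"
proof (induction k)
  case (Suc k)
  then show ?case using prime_J[of x "x ^ k"] R_power by auto
qed (use one_J in simp)

lemma J_int_mult: "of_int (int q * a) \<in> J"
  using J_mult'[OF q_J R_int[of a]] by simp

lemma J_int: "of_int a \<in> J \<longleftrightarrow> int q dvd a"
proof
  assume a: "of_int a \<in> J"
  show "int q dvd a"
  proof (rule ccontr)
    assume "\<not> int q dvd a"
    then have "algebraic_semidom_class.coprime (int q) a"
      using prime_q by (intro prime_imp_coprime) auto
    then obtain x y where "x * int q + y * a = 1" using bezout_int[of "int q" a] by auto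
    then have "(1::complex) = of_int (x * int q + y * a)" by simp
    also have "\<dots> = of_int (int q * x) + of_int y * of_int a" by (simp add: mult.commute)
    also have "\<dots> \<in> J" by (intro J_add J_int_mult J_mult R_int a)
    finally show False using one_J by simp
  qed
qed (auto intro: J_int_mult elim!: dvdE simp del: of_int_mult)

definition eqJ :: "complex \<Rightarrow> complex \<Rightarrow> bool" (infix \<open>\<approx>\<close> 50) where
  "x \<approx> y \<longleftrightarrow> x - y \<in> J"

lemma eqJ_refl: "x \<approx> x" by (simp add: eqJ_def J_0)
lemma eqJ_sym: "x \<approx> y \<Longrightarrow> y \<approx> x" using J_uminus[of "x - y"] by (simp add: eqJ_def)
lemma eqJ_trans [trans]: "x \<approx> y \<Longrightarrow> y \<approx> z \<Longrightarrow> x \<approx> z"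
  using J_add[of "x - y" "y - z"] by (simp add: eqJ_def)
lemma eqJ_0: "x \<approx> 0 \<longleftrightarrow> x \<in> J" by (simp add: eqJ_def)
lemma eqJ_J: "x \<approx> y \<Longrightarrow> x \<in> J \<longleftrightarrow> y \<in> J"
  using eqJ_trans eqJ_sym eqJ_0 by blast
lemma eqJ_add: "x \<approx> y \<Longrightarrow> x' \<approx> y' \<Longrightarrow> x + x' \<approx> y + y'"
  using J_add[of "x - y" "x' - y'"] by (simp add: eqJ_def algebra_simps)
lemma eqJ_mult: "x \<approx> y \<Longrightarrow> x' \<approx> y' \<Longrightarrow> x' \<in> R \<Longrightarrow> y \<in> R \<Longrightarrow> x * x' \<approx> y * y'"
  using J_add[OF J_mult'[of "x - y" x'] J_mult[of y "x' - y'"]] by (simp add: eqJ_def algebra_simps)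
lemma eqJ_sum: "(\<And>i. i \<in> I \<Longrightarrow> a i \<approx> b i) \<Longrightarrow> sum a I \<approx> sum b I"
  by (induction I rule: infinite_finite_induct) (auto intro: eqJ_refl eqJ_add)

lemma eqJ_int: "of_int a \<approx> of_int b \<longleftrightarrow> int q dvd a - b"
  using J_int[of "a - b"] by (simp add: eqJ_def)

lemma eqJ_poly_coeff:
  assumes "\<And>k. coeff a k \<approx> coeff b k" "x \<in> R" shows "poly a x \<approx> poly b x"
proof -
  have "poly (a - b) x \<in> J" unfolding poly_altdef
    using assms by (intro J_sum J_mult' R_power) (auto simp: eqJ_def)
  then show ?thesis by (simp add: eqJ_def)
qed

lemma eqJ_poly_int:
  assumes "x \<approx> y" "x \<in> R" "y \<in> R" shows "poly (of_int_poly h) x \<approx> poly (of_int_poly h) y"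
proof (induction h)
  case (pCons c h)
  then show ?case using assms
    by (simp add: map_poly_pCons) (intro eqJ_add eqJ_refl eqJ_mult assms R_poly_int pCons)
qed (simp add: eqJ_refl)

section \<open>The Frobenius map modulo \<open>J\<close>\<close>

lemma frob_add:
  assumes "x \<in> R" "y \<in> R" shows "(x + y) ^ q \<approx> x ^ q + y ^ q"
proof -
  have "(x + y) ^ q - (x ^ q + y ^ q) = of_nat q *
    (\<Sum>k\<in>{1..<q}. of_nat ((q choose k) div q) * x ^ k * y ^ (q - k))"
    using add_power_prime_exact[OF prime_q, of x y] by simp
  also have "\<dots> \<in> J" using assms by (intro J_mult' q_J R_sum R_mult R_nat R_power)
  finally show ?thesis by (simp add: eqJ_def)
qed

lemma frob_sum: "finite I \<Longrightarrow> (\<And>i. i \<in> I \<Longrightarrow> h i \<in> R) \<Longrightarrow> sum h I ^ q \<approx> (\<Sum>i\<in>I. h i ^ q)"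
proof (induction I rule: finite_induct)
  case empty
  then show ?case using prime_gt_0_nat[OF prime_q] by (simp add: eqJ_refl zero_power)
next
  case (insert i I)
  have "(h i + sum h I) ^ q \<approx> h i ^ q + sum h I ^ q" using insert by (intro frob_add R_sum) auto
  also have "\<dots> \<approx> h i ^ q + (\<Sum>i\<in>I. h i ^ q)" using insert by (intro eqJ_add eqJ_refl) auto
  finally show ?case using insert by simp
qed

lemma frob_int: "of_int c ^ q \<approx> of_int c"
proof -
  have "int q dvd c ^ q - c" using fermat_int[OF prime_q, of c] by (simp add: cong_iff_dvd_diff)
  then show ?thesis using eqJ_int[of "c ^ q" c] by simp
qed

lemma frob_poly:
  assumes x: "x \<in> R" shows "poly (of_int_poly h) x ^ q \<approx> poly (of_int_poly h) (x ^ q)"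
proof (induction h)
  case 0
  then show ?case using prime_gt_0_nat[OF prime_q] by (simp add: eqJ_refl zero_power)
next
  case (pCons c h)
  let ?H = "poly (of_int_poly h)"
  have e: "poly (of_int_poly (pCons c h)) y = of_int c + y * ?H y" for y :: complex
    using pCons(1) by (simp add: map_poly_pCons)
  have "(of_int c + x * ?H x) ^ q \<approx> of_int c ^ q + (x * ?H x) ^ q"
    using x by (intro frob_add R_int R_mult R_poly_int)
  also have "\<dots> \<approx> of_int c + x ^ q * ?H (x ^ q)"
    unfolding power_mult_distrib using x
    by (intro eqJ_add frob_int eqJ_mult eqJ_refl pCons R_power R_poly_int)
  finally show ?case by (simp only: e)
qed

text \<open>A nonzero polynomial over a domain has at most as many roots as its degree, stated for
  the residue ring of \<open>R\<close> modulo \<open>J\<close> without forming it. A root is split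
  off by synthetic division, which keeps the coefficients in \<open>R\<close>, and primality of
  \<open>J\<close> cancels the linear factor.\<close>

lemma many_roots:
  "finite A \<Longrightarrow> card A > n \<Longrightarrow> degree h \<le> n \<Longrightarrow> (\<And>k. coeff h k \<in> R) \<Longrightarrow> A \<subseteq> R \<Longrightarrow>
   (\<And>x y. x \<in> A \<Longrightarrow> y \<in> A \<Longrightarrow> x \<noteq> y \<Longrightarrow> x - y \<notin> J) \<Longrightarrow> (\<And>x. x \<in> A \<Longrightarrow> poly h x \<in> J) \<Longrightarrow>
   coeff h k \<in> J"
proof (induction n arbitrary: A h k)
  case 0
  obtain x where "x \<in> A" using 0(2) by (metis card_gt_0_iff equals0I)
  moreover obtain c where "h = [:c:]" using 0(3) by (metis le_zero_eq degree_eq_zeroE)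
  ultimately show ?case using 0(7)[of x] J_0 by (cases k) auto
next
  case (Suc n)
  obtain x0 where x0: "x0 \<in> A" using Suc(3) by (metis card_gt_0_iff equals0I less_trans zero_less_Suc)
  define h1 where "h1 = synthetic_div h x0"
  have x0R: "x0 \<in> R" using x0 Suc by auto
  have h: "h = [:- x0, 1:] * h1 + [:poly h x0:]"
    unfolding h1_def using synthetic_div_correct'[of x0 h] by simp
  have cR: "coeff (synthetic_div h' x0) k \<in> R" if "\<And>k. coeff h' k \<in> R" for h' k
    using that
  proof (induction h' arbitrary: k)
    case (pCons a h')
    have h': "coeff h' k \<in> R" for k using pCons(3)[of "Suc k"] by simp
    show ?case by (cases k) (auto simp: synthetic_div_pCons pCons(2)[OF h'] R_poly[OF h' x0R])
  qed (simp add: R_0)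
  have c1: "coeff h1 k \<in> J" for k
  proof (rule Suc.IH[of "A - {x0}"])
    show "card (A - {x0}) > n" using Suc(2,3) x0 by simp
    show "degree h1 \<le> n" unfolding h1_def using Suc(4) by (simp add: degree_synthetic_div)
    show "\<And>k. coeff h1 k \<in> R" unfolding h1_def by (rule cR) (rule Suc(5))
    fix x assume x: "x \<in> A - {x0}"
    have "poly h x = (x - x0) * poly h1 x + poly h x0"
      using arg_cong[OF h, of "\<lambda>p. poly p x"] by (simp add: algebra_simps)
    then have "(x - x0) * poly h1 x = poly h x - poly h x0" by simp
    also have "\<dots> \<in> J" using Suc(8) x x0 by (intro J_diff) auto
    finally have "x - x0 \<in> J \<or> poly h1 x \<in> J"
      using x x0R Suc(6) \<open>\<And>k. coeff h1 k \<in> R\<close> by (intro prime_J R_diff R_poly) auto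
    then show "poly h1 x \<in> J" using Suc(7)[of x x0] x x0 by auto
  qed (use Suc in auto)
  have "coeff h k = - x0 * coeff h1 k + (case k of 0 \<Rightarrow> 0 | Suc k' \<Rightarrow> coeff h1 k')
     + (case k of 0 \<Rightarrow> poly h x0 | Suc k' \<Rightarrow> 0)"
    by (subst h) (auto simp: coeff_pCons split: nat.splits)
  also have "\<dots> \<in> J" using c1 Suc(8)[OF x0] x0R
    by (intro J_add J_mult R_uminus) (auto split: nat.splits intro: J_0)
  finally show ?case .
qed

text \<open>If two roots were congruent, the derivative of \<open>f\<close> would lie in
  \<open>J\<close> at \<open>s\<close>, as \<open>f\<close> does; evaluating \<open>bez\<close> at
  \<open>s\<close> would then put 1 into \<open>J\<close>.\<close>

lemma S_incong:
  assumes "s \<in> S" "t \<in> S" "s \<noteq> t" shows "s - t \<notin> J"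
proof
  assume st: "s - t \<in> J"
  define k where "k = (\<Prod>x\<in>S - {s} - {t}. [:- x, 1:])"
  have F: "of_int_poly f = [:- s, 1:] * ([:- t, 1:] * k)"
  proof -
    have "(\<Prod>x\<in>S. [:- x, 1:]) = [:- s, 1:] * (\<Prod>x\<in>S - {s}. [:- x, 1:])"
      using assms fin_S by (intro prod.remove) auto
    also have "(\<Prod>x\<in>S - {s}. [:- x, 1:]) = [:- t, 1:] * k"
      unfolding k_def using assms fin_S by (intro prod.remove) auto
    finally show ?thesis by (simp only: f_S)
  qed
  have fs: "poly (of_int_poly f) s = 0" unfolding F by simp
  have "poly (of_int_poly (pderiv f)) s = poly (pderiv (of_int_poly f)) s"
    by (simp add: of_int_hom.map_poly_pderiv)
  also have "\<dots> = (s - t) * poly k s" unfolding F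
    by (simp only: pderiv_mult poly_add poly_mult) (simp add: pderiv_pCons)
  also have "\<dots> \<in> J" using assms st
    by (intro J_mult') (auto simp: k_def poly_prod intro!: R_prod R_diff intro: R_S)
  finally have f's: "poly (of_int_poly (pderiv f)) s \<in> J" .
  have "poly (of_int_poly (u * f + v * pderiv f)) s = poly (of_int_poly (1 + smult (int q) w)) s"
    using bez by simp
  then have "1 = poly (of_int_poly v) s * poly (of_int_poly (pderiv f)) s -
      of_nat q * poly (of_int_poly w) s"
    using fs by (simp add: of_int_hom.map_poly_hom_add of_int_poly_hom.hom_mult of_int_hom.map_poly_hom_smult)
  also have "\<dots> \<in> J" using f's q_J assms by (intro J_diff J_mult J_mult' R_poly_int R_S)
  finally show False using one_J by simp
qed

definition \<phi> :: "complex \<Rightarrow> complex" where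
  "\<phi> s = (if s \<in> S then SOME t. t \<in> S \<and> s ^ q \<approx> t else s)"

lemma \<phi>: assumes s: "s \<in> S" shows "\<phi> s \<in> S" "s ^ q \<approx> \<phi> s"
proof -
  have "poly (of_int_poly f) s = 0" unfolding f_S using s fin_S by (auto simp: poly_prod)
  then have "poly (of_int_poly f) (s ^ q) \<approx> 0"
    using frob_poly[OF R_S[OF s], of f] prime_gt_0_nat[OF prime_q] by (simp add: zero_power eqJ_sym)
  then have "(\<Prod>t\<in>S. s ^ q - t) \<in> J" unfolding f_S by (simp add: eqJ_0 poly_prod)
  then have "\<exists>t\<in>S. s ^ q - t \<in> J" using s by (intro J_prod fin_S) (auto intro: R_diff R_power R_S)
  then have "\<exists>t. t \<in> S \<and> s ^ q \<approx> t" by (auto simp: eqJ_def)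
  from someI_ex[OF this] s show "\<phi> s \<in> S" "s ^ q \<approx> \<phi> s" by (auto simp: \<phi>_def)
qed

lemma \<phi>_permutes: "\<phi> permutes S"
proof (rule bij_imp_permutes)
  have "inj_on \<phi> S"
  proof (intro inj_onI, rule ccontr)
    fix s t assume st: "s \<in> S" "t \<in> S" "\<phi> s = \<phi> t" "s \<noteq> t"
    \<comment> \<open>Adding back \<open>t\<close> avoids the sign of a q-th power of
      \<open>- t\<close>.\<close>
    have "(s - t + t) ^ q \<approx> (s - t) ^ q + t ^ q" using st by (intro frob_add R_diff R_S)
    then have "s ^ q - t ^ q \<approx> (s - t) ^ q" by (simp add: eqJ_def algebra_simps)
    moreover have "s ^ q \<approx> t ^ q" using \<phi>[OF st(1)] \<phi>[OF st(2)] st(3) by (metis eqJ_sym eqJ_trans)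
    ultimately have "(s - t) ^ q \<in> J" by (metis eqJ_J eqJ_def)
    then show False using J_power[of "s - t" q] S_incong[OF st(1,2,4)] st by (auto intro: R_diff R_S)
  qed
  moreover have "\<phi> ` S \<subseteq> S" using \<phi> by auto
  ultimately show "bij_betw \<phi> S S" using endo_inj_surj[OF fin_S] by (auto simp: bij_betw_def)
qed (simp add: \<phi>_def)

lemma rat_int:
  assumes "x \<in> R" "x \<in> \<rat>" obtains c where "x \<approx> of_int c"
proof -
  obtain a b where ab: "b > 0" "algebraic_semidom_class.coprime a b" "x = of_int a / of_int b"
    using Rats_cases'[OF assms(2)] by metis
  then have bx: "of_int b * x = of_int a" by simp
  have nb: "\<not> int q dvd b"
  proof
    assume d: "int q dvd b"
    then have "of_int b * x \<in> J" using J_int assms by (intro J_mult') auto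
    then have "int q dvd a" using bx J_int by simp
    then have "int q dvd 1" using d ab(2) by (metis algebraic_semidom_class.coprime_def)
    then show False using prime_gt_1_nat[OF prime_q] by simp
  qed
  then have "algebraic_semidom_class.coprime (int q) b" using prime_q by (intro prime_imp_coprime) auto
  then obtain y z where yz: "y * int q + z * b = 1" using bezout_int[of "int q" b] by auto
  have "x - of_int (z * a) = x * (1 - of_int z * of_int b)"
    using bx by (simp add: algebra_simps)
  also have "1 - of_int z * of_int b = (of_int (int q * y) :: complex)"
    using arg_cong[OF yz, of "of_int :: int \<Rightarrow> complex"] by (simp add: algebra_simps)
  finally have "x \<approx> of_int (z * a)" unfolding eqJ_def using assms J_int_mult by (simp only: J_mult)
  then show ?thesis using that by blast
qed

text \<open>The polynomial x^q - x already has the \<open>q\<close> incongruent roots 0, ..., q - 1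
  modulo \<open>J\<close>; one more would contradict \<open>many_roots\<close>.\<close>

lemma fixed_by_frob_int:
  assumes x: "x \<in> R" "x ^ q \<approx> x" obtains c where "x \<approx> of_int c"
proof (rule ccontr)
  assume n: "\<not> thesis"
  then have nc: "x - of_int c \<notin> J" for c using that by (auto simp: eqJ_def)
  have nc': "of_int c - x \<notin> J" for c using nc[of c] J_uminus[of "of_int c - x"] by auto
  define A where "A = insert x (of_int ` {0..<int q})"
  define h where "h = monom (1::complex) q - monom 1 1"
  have q1: "q > 1" using prime_gt_1_nat[OF prime_q] .
  have "x \<notin> of_int ` {0..<int q}" using nc J_0 by (auto simp: image_iff) (metis diff_self)
  moreover have "card ((of_int :: int \<Rightarrow> complex) ` {0..<int q}) = q" by (subst card_image) (auto simp: inj_on_def)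
  ultimately have cA: "card A = Suc q" unfolding A_def by simp
  have "coeff h q \<in> J"
  proof (rule many_roots[of A q])
    show "degree h \<le> q" unfolding h_def using q1
      by (intro degree_diff_le order.trans[OF degree_monom_le]) auto
    show "coeff h k \<in> R" for k by (auto simp: h_def intro: R_0 R_1 R_diff R_uminus)
    show "A \<subseteq> R" using x R_int by (auto simp: A_def)
    show "poly h y \<in> J" if "y \<in> A" for y
      using that x frob_int by (auto simp: A_def h_def poly_monom eqJ_def)
    show "y - z \<notin> J" if "y \<in> A" "z \<in> A" "y \<noteq> z" for y z
    proof -
      have "of_int a - of_int b \<notin> J" if "a \<in> {0..<int q}" "b \<in> {0..<int q}" "a \<noteq> b" for a b
      proof
        assume "of_int a - of_int b \<in> J"
        then have "int q dvd a - b" using J_int[of "a - b"] by simp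
        then have "a mod int q = b mod int q" by (simp add: mod_eq_dvd_iff)
        then show False using that by simp
      qed
      then show ?thesis using that nc nc' unfolding A_def by auto
    qed
  qed (use cA in \<open>auto simp: A_def\<close>)
  moreover have "coeff h q = 1" using q1 by (simp add: h_def)
  ultimately show False using one_J by simp
qed

lemma R_int_poly_approx:
  assumes "\<And>k. \<exists>c. coeff h k \<approx> of_int c"
  obtains g where "\<And>k. coeff h k \<approx> of_int (coeff g k)" "degree g \<le> degree h"
proof -
  obtain c where c: "\<And>k. coeff h k \<approx> of_int (c k)" using assms by metis
  define g where "g = (\<Sum>k\<le>degree h. monom (c k) k)"
  have cg: "coeff g k = (if k \<le> degree h then c k else 0)" for k
    by (auto simp: g_def coeff_sum)
  have "coeff h k \<approx> of_int (coeff g k)" for k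
    using c[of k] by (auto simp: cg coeff_eq_0 eqJ_refl)
  moreover have "degree g \<le> degree h" using cg by (intro degree_le) auto
  ultimately show ?thesis using that by blast
qed

lemma \<phi>_in_G:
  assumes big: "q > card S * fact (card S)"
  shows "\<phi> \<in> G"
proof -
  define n where "n = card S"
  obtain idx where idx: "bij_betw idx S {0..<n}"
    using ex_bij_betw_finite_nat[OF fin_S] unfolding n_def by blast
  \<comment> \<open>Distinct roots carry distinct powers of \<open>T\<close>, all below the n-th.
    Hence the values for more than n incongruent \<open>T\<close> determine the assignment modulo
    \<open>J\<close>.\<close>
  define \<theta> where "\<theta> T \<kappa> = (\<Sum>s\<in>S. \<kappa> s * of_int (T ^ idx s))" for T :: int and \<kappa> :: "complex \<Rightarrow> complex"
  have \<theta>: "\<theta> T \<in> polyfun S" for T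
    unfolding \<theta>_def by (intro polyfun_sum polyfun.var polyfun.const)
  have \<theta>R: "\<theta> T \<pi> \<in> R" if "\<pi> ` S \<subseteq> S" for T \<pi>
    unfolding \<theta>_def using that by (intro R_sum R_mult R_int R_S) auto
  have im: "\<pi> ` S \<subseteq> S" if "\<pi> \<in> G" for \<pi> using permutes_image[OF G_permutes[OF that]] by simp
  have "\<exists>\<pi>\<in>G. \<theta> T \<phi> \<approx> \<theta> T \<pi>" for T
  proof -
    \<comment> \<open>Written for a general assignment, so that the coefficients are members of
      \<open>polyfun S\<close> and \<open>fixed_rational\<close> applies; composing with a member of
      \<open>G\<close> merely permutes the factors.\<close>
    define h where "h \<kappa> = (\<Prod>\<pi>\<in>G. [:- \<theta> T (\<kappa> \<circ> \<pi>), 1:])" for \<kappa>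
    have hF: "(\<lambda>\<kappa>. coeff (h \<kappa>) k) \<in> polyfun S" for k
      unfolding h_def
    proof (rule polyfun_coeff_prod[OF finite_G])
      fix \<pi> k assume "\<pi> \<in> G"
      then show "(\<lambda>\<kappa>. coeff [:- \<theta> T (\<kappa> \<circ> \<pi>), 1:] k) \<in> polyfun S"
        using polyfun_uminus[OF polyfun_comp[OF \<theta> im]]
        by (cases k) (auto simp: coeff_pCons intro: polyfun_1 polyfun_0 split: nat.splits)
    qed
    have "h \<rho> = h id" if "\<rho> \<in> G" for \<rho>
      using prod_G_comp[OF that, of "\<lambda>\<pi>. [:- \<theta> T \<pi>, 1:]"] unfolding h_def by simp
    then have "coeff (h id) k \<in> \<rat>" for k using fixed_rational[OF hF] by simp
    then have "\<exists>c. coeff (h id) k \<approx> of_int c" for k using rat_int[OF R_I[OF hF]] by metis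
    then obtain g where g: "\<And>k. coeff (h id) k \<approx> of_int (coeff g k)"
      using R_int_poly_approx by metis
    have hg: "poly (h id) x \<approx> poly (of_int_poly g) x" if "x \<in> R" for x
      using g that by (intro eqJ_poly_coeff) auto
    define t where "t = \<theta> T id"
    have tR: "t \<in> R" unfolding t_def by (rule \<theta>R) simp
    have "poly (h id) t = 0" unfolding h_def t_def using finite_G G_id by (auto simp: poly_prod)
    then have "poly (of_int_poly g) t \<in> J" using hg[OF tR] by (metis eqJ_0 eqJ_sym)
    then have "poly (of_int_poly g) t ^ q \<in> J"
      using prime_gt_0_nat[OF prime_q] R_power[OF R_poly_int[OF tR]]
      by (cases q) (auto intro!: J_mult')
    then have "poly (of_int_poly g) (t ^ q) \<in> J" using frob_poly[OF tR, of g] eqJ_J by blast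
    then have "poly (h id) (t ^ q) \<in> J" using hg[OF R_power[OF tR, of q]] eqJ_J by blast
    then have "(\<Prod>\<pi>\<in>G. t ^ q - \<theta> T \<pi>) \<in> J" unfolding h_def by (simp add: poly_prod)
    then obtain \<pi> where \<pi>: "\<pi> \<in> G" "t ^ q - \<theta> T \<pi> \<in> J"
      using J_prod[OF finite_G, of "\<lambda>\<pi>. t ^ q - \<theta> T \<pi>"] \<theta>R[OF im] tR by (blast intro: R_diff R_power)
    have "t ^ q \<approx> (\<Sum>s\<in>S. (s * of_int (T ^ idx s)) ^ q)"
      unfolding t_def \<theta>_def id_apply by (intro frob_sum fin_S R_mult R_S R_int)
    also have "\<dots> \<approx> \<theta> T \<phi>"
      unfolding \<theta>_def power_mult_distrib
      by (intro eqJ_sum eqJ_mult \<phi> frob_int R_power R_int R_S)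
    finally have "\<theta> T \<phi> \<approx> \<theta> T \<pi>" using \<pi>(2) by (metis eqJ_def eqJ_sym eqJ_trans)
    then show ?thesis using \<pi>(1) by blast
  qed
  then obtain \<pi>T where \<pi>T: "\<And>T. \<pi>T T \<in> G" "\<And>T. \<theta> T \<phi> \<approx> \<theta> T (\<pi>T T)" by metis
  have "\<exists>\<pi>\<in>G. card {T \<in> {0..<int q}. \<pi>T T = \<pi>} > n"
  proof (rule ccontr)
    assume "\<not> ?thesis"
    then have le: "card {T \<in> {0..<int q}. \<pi>T T = \<pi>} \<le> n" if "\<pi> \<in> G" for \<pi> using that by auto
    have "q = card {0..<int q}" by simp
    also have "{0..<int q} = (\<Union>\<pi>\<in>G. {T \<in> {0..<int q}. \<pi>T T = \<pi>})" using \<pi>T(1) by auto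
    also have "card \<dots> \<le> (\<Sum>\<pi>\<in>G. card {T \<in> {0..<int q}. \<pi>T T = \<pi>})" by (rule card_UN_le[OF finite_G])
    also have "\<dots> \<le> (\<Sum>\<pi>\<in>G. n)" by (intro sum_mono le)
    also have "\<dots> \<le> n * fact n" using card_G by (simp add: n_def)
    finally show False using big by (simp add: n_def)
  qed
  then obtain \<pi> where \<pi>: "\<pi> \<in> G" and many: "card {T \<in> {0..<int q}. \<pi>T T = \<pi>} > n" by blast
  define A where "A = {T \<in> {0..<int q}. \<pi>T T = \<pi>}"
  \<comment> \<open>Evaluated at \<open>T\<close> this is the difference of
    \<open>\<theta> T \<phi>\<close> and \<open>\<theta> T \<pi>\<close>. Once its coefficients lie
    in \<open>J\<close>, the two permutations agree modulo \<open>J\<close>, hence exactly, by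
    \<open>S_incong\<close>.\<close>
  define h where "h = (\<Sum>s\<in>S. monom (\<phi> s - \<pi> s) (idx s))"
  have injS: "idx s = idx t \<longleftrightarrow> s = t" if "s \<in> S" "t \<in> S" for s t
    using idx that by (auto simp: bij_betw_def inj_on_def)
  have ch: "coeff h (idx s) = \<phi> s - \<pi> s" if "s \<in> S" for s
  proof -
    have "coeff h (idx s) = (\<Sum>t\<in>S. if t = s then \<phi> s - \<pi> s else 0)"
      unfolding h_def coeff_sum using that injS by (intro sum.cong) auto
    then show ?thesis using that fin_S by simp
  qed
  have \<pi>S: "\<pi> s \<in> S" if "s \<in> S" for s using im[OF \<pi>] that by auto
  have "coeff h k \<in> J" for k
  proof (rule many_roots[of "of_int ` A" n])
    show "finite ((of_int :: int \<Rightarrow> complex) ` A)"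
      by (rule finite_imageI, rule finite_subset[of _ "{0..<int q}"]) (auto simp: A_def)
    show "card ((of_int :: int \<Rightarrow> complex) ` A) > n"
      using many by (subst card_image) (auto simp: inj_on_def A_def)
    have "degree (monom (\<phi> s - \<pi> s) (idx s)) \<le> n" if "s \<in> S" for s
      using bij_betwE[OF idx] that degree_monom_le[of "\<phi> s - \<pi> s" "idx s"] by fastforce
    then show "degree h \<le> n" unfolding h_def by (intro degree_sum_le fin_S) auto
    show "coeff h k \<in> R" for k unfolding h_def coeff_sum
      using R_S[OF \<phi>(1)] R_S[OF \<pi>S] by (intro R_sum) (auto intro!: R_diff R_0)
    show "of_int ` A \<subseteq> R" using R_int by auto
    show "x - y \<notin> J" if xy: "x \<in> of_int ` A" "y \<in> of_int ` A" "x \<noteq> y" for x y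
    proof
      assume xyJ: "x - y \<in> J"
      obtain a b where ab: "x = of_int a" "y = of_int b" "a \<in> A" "b \<in> A" using xy by auto
      then have "int q dvd a - b" using xyJ J_int[of "a - b"] by simp
      then have "a mod int q = b mod int q" by (simp add: mod_eq_dvd_iff)
      then show False using ab xy unfolding A_def by simp
    qed
    fix x :: complex assume "x \<in> of_int ` A"
    then obtain T where T: "x = of_int T" "\<pi>T T = \<pi>" by (auto simp: A_def)
    have "poly h x = \<theta> T \<phi> - \<theta> T \<pi>"
      unfolding h_def \<theta>_def T(1) by (simp add: poly_sum poly_monom sum_subtractf[symmetric] algebra_simps)
    then show "poly h x \<in> J" using \<pi>T(2)[of T] T(2) by (simp add: eqJ_def)
  qed
  then have "\<phi> s = \<pi> s" if "s \<in> S" for s using that S_incong[of "\<phi> s" "\<pi> s"] ch \<phi> \<pi>S by metis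
  then have "\<phi> = \<pi>" using permutes_not_in[OF \<phi>_permutes] permutes_not_in[OF G_permutes[OF \<pi>]]
    by (metis ext)
  then show ?thesis using \<pi> by simp
qed

end

subsection \<open>Orbits of the Frobenius permutation\<close>

text \<open>Newton's identities in generating form. With P the product of all 1 - s X, the sum of
  the quotients P / (1 - s X) is n P - X P', which has integer coefficients. Expanding 1 / (1 - s X)
  as a geometric series shows that its coefficients are the power sums convolved with those of P,
  and P has constant term 1.\<close>

lemma power_sums_int:
  fixes f :: "int poly"
  assumes fin: "finite S" and f: "of_int_poly f = (\<Prod>s\<in>S. [:- s, 1:])"
  shows "(\<Sum>s\<in>S. s ^ e :: complex) \<in> \<int>"
proof -
  define P where "P = (\<Prod>s\<in>S. [:1, - s:])"
  define A where "A s = (\<Prod>t\<in>S - {s}. [:1, - t:])" for s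
  have refl: "reflect_poly [:- s, 1:] = [:1, - s:]" for s :: complex
    by (cases "s = 0") (simp_all add: reflect_poly_def)
  have "P = reflect_poly (of_int_poly f)" unfolding P_def f reflect_poly_prod refl ..
  then have Pint: "coeff P k \<in> \<int>" for k by (auto simp: coeff_reflect_poly)
  have PA: "P = [:1, - s:] * A s" if "s \<in> S" for s
    unfolding P_def A_def using fin that by (rule prod.remove)
  have "pderiv P = (\<Sum>s\<in>S. A s * [:- s:])"
    unfolding P_def pderiv_prod A_def by (simp add: pderiv_pCons)
  moreover have "A s = P - [:0, 1:] * (A s * [:- s:])" if "s \<in> S" for s
    using PA[OF that] by (simp add: algebra_simps)
  then have "(\<Sum>s\<in>S. A s) = (\<Sum>s\<in>S. P - [:0, 1:] * (A s * [:- s:]))" by simp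
  ultimately have sumA: "(\<Sum>s\<in>S. A s) = of_nat (card S) * P - [:0, 1:] * pderiv P"
    by (simp only: sum_subtractf sum_constant sum_distrib_left[symmetric])
  have Aint: "coeff (\<Sum>s\<in>S. A s) k \<in> \<int>" for k
    unfolding sumA using Pint by (cases k) (auto simp: coeff_pderiv of_nat_poly)
  have P0: "coeff P 0 = 1" unfolding P_def by (simp add: poly_0_coeff_0[symmetric] poly_prod)
  have conv: "(\<Sum>s\<in>S. coeff (A s) m) = (\<Sum>i\<le>m. (\<Sum>s\<in>S. s ^ i) * coeff P (m - i))" for m
  proof -
    have "coeff (A s) m = (\<Sum>i\<le>m. s ^ i * coeff P (m - i))" if s: "s \<in> S" for s
    proof (induction m)
      case 0
      then show ?case unfolding PA[OF s] by simp
    next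
      case (Suc m)
      have "coeff P (Suc m) = coeff (A s) (Suc m) - s * coeff (A s) m" unfolding PA[OF s] by simp
      then have "coeff (A s) (Suc m) = coeff P (Suc m) + s * (\<Sum>i\<le>m. s ^ i * coeff P (m - i))"
        using Suc.IH by simp
      also have "\<dots> = (\<Sum>i\<le>Suc m. s ^ i * coeff P (Suc m - i))"
        by (simp add: sum.atMost_Suc_shift sum_distrib_left mult.assoc del: sum.atMost_Suc)
      finally show ?case .
    qed
    then have "(\<Sum>s\<in>S. coeff (A s) m) = (\<Sum>s\<in>S. \<Sum>i\<le>m. s ^ i * coeff P (m - i))" by simp
    also have "\<dots> = (\<Sum>i\<le>m. (\<Sum>s\<in>S. s ^ i) * coeff P (m - i))"
      unfolding sum_distrib_right by (rule sum.swap)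
    finally show ?thesis .
  qed
  show ?thesis
  proof (induction e rule: less_induct)
    case (less e)
    have "{..e} = insert e {..<e}" by auto
    then have "(\<Sum>s\<in>S. coeff (A s) e) = (\<Sum>s\<in>S. s ^ e) + (\<Sum>i<e. (\<Sum>s\<in>S. s ^ i) * coeff P (e - i))"
      using conv[of e] P0 by simp
    then have "(\<Sum>s\<in>S. s ^ e) = coeff (\<Sum>s\<in>S. A s) e - (\<Sum>i<e. (\<Sum>s\<in>S. s ^ i) * coeff P (e - i))"
      by (simp add: coeff_sum)
    also have "\<dots> \<in> \<int>" by (rule Ints_diff[OF Aint Ints_sum[OF Ints_mult]]) (use less Pint in auto)
    finally show ?case .
  qed
qed

context prime_above
begin

sublocale pm: poly_mod_prime "int q"
  using prime_q by unfold_locales simp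

lemma eq_m_eval:
  assumes "pm.eq_m a b" "x \<in> R" shows "poly (of_int_poly a) x \<approx> poly (of_int_poly b) x"
proof -
  obtain h where h: "a = b + smult (int q) h" using assms(1) by (rule pm.eq_mE)
  have "poly (of_int_poly a) x - poly (of_int_poly b) x = of_nat q * poly (of_int_poly h) x"
    unfolding h by (simp add: of_int_hom.map_poly_hom_add of_int_hom.map_poly_hom_smult)
  also have "\<dots> \<in> J" by (intro J_mult' q_J R_poly_int assms)
  finally show ?thesis by (simp add: eqJ_def)
qed

definition roots_of :: "int poly \<Rightarrow> complex set" where
  "roots_of g = {t \<in> S. poly (of_int_poly g) t \<in> J}"

definition orbit :: "complex \<Rightarrow> complex set" where "orbit s = range (\<lambda>k. (\<phi> ^^ k) s)"

lemma card_roots_of_le: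
  assumes "monic g" shows "card (roots_of g) \<le> degree g"
proof (rule ccontr)
  assume "\<not> ?thesis"
  then have "coeff (of_int_poly g) (degree g) \<in> J"
    using fin_S S_incong
    by (intro many_roots[of "roots_of g" "degree g"]) (auto simp: roots_of_def R_int R_S)
  then show False using assms one_J by simp
qed

lemma roots_of_\<phi>:
  assumes "t \<in> roots_of g" shows "\<phi> t \<in> roots_of g"
proof -
  have t: "t \<in> S" "poly (of_int_poly g) t \<in> J" using assms by (auto simp: roots_of_def)
  have tR: "t \<in> R" using t R_S by simp
  have "poly (of_int_poly g) t ^ q \<in> J"
    using t(2) prime_gt_0_nat[OF prime_q] R_power[OF J_R[OF t(2)]] by (cases q) (auto intro!: J_mult')
  then have "poly (of_int_poly g) (t ^ q) \<in> J" using frob_poly[OF tR, of g] eqJ_J by blast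
  moreover have "poly (of_int_poly g) (t ^ q) \<approx> poly (of_int_poly g) (\<phi> t)"
    by (rule eqJ_poly_int[OF \<phi>(2)[OF t(1)] R_power[OF tR] R_S[OF \<phi>(1)[OF t(1)]]])
  ultimately show ?thesis using \<phi>[OF t(1)] eqJ_J by (auto simp: roots_of_def)
qed

lemma orbit_subset: "s \<in> roots_of g \<Longrightarrow> orbit s \<subseteq> roots_of g"
proof -
  assume "s \<in> roots_of g"
  then have "(\<phi> ^^ k) s \<in> roots_of g" for k by (induction k) (auto intro: roots_of_\<phi>)
  then show ?thesis by (auto simp: orbit_def)
qed

lemma coeff_prod_R:
  "finite A \<Longrightarrow> (\<And>t. t \<in> A \<Longrightarrow> a t \<in> R) \<Longrightarrow> coeff (\<Prod>t\<in>A. [:- a t, 1:]) k \<in> R"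
proof (induction A arbitrary: k rule: finite_induct)
  case empty
  then show ?case by (cases k) (auto simp: R_0 R_1)
next
  case (insert t A)
  then show ?case by (cases k) (auto intro!: R_mult R_diff R_add R_uminus)
qed

text \<open>Raising the coefficients of a product of linear factors to the q-th power has the same
  effect modulo \<open>J\<close> as raising its roots.\<close>

lemma frob_coeff_prod:
  "finite A \<Longrightarrow> (\<And>t. t \<in> A \<Longrightarrow> a t \<in> R) \<Longrightarrow> (\<And>t. t \<in> A \<Longrightarrow> b t \<in> R) \<Longrightarrow>
   (\<And>t. t \<in> A \<Longrightarrow> a t ^ q \<approx> b t) \<Longrightarrow>
   coeff (\<Prod>t\<in>A. [:- a t, 1:]) k ^ q \<approx> coeff (\<Prod>t\<in>A. [:- b t, 1:]) k"
proof (induction A arbitrary: k rule: finite_induct)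
  case empty
  then show ?case using prime_gt_0_nat[OF prime_q] by (cases k) (auto simp: eqJ_refl zero_power)
next
  case (insert t A)
  define X1 Y where "X1 = (\<Prod>t\<in>A. [:- a t, 1:])" and "Y = (\<Prod>t\<in>A. [:- b t, 1:])"
  have XR: "coeff X1 k \<in> R" and YR: "coeff Y k \<in> R" for k
    unfolding X1_def Y_def using insert by (intro coeff_prod_R; simp)+
  have IH: "coeff X1 k ^ q \<approx> coeff Y k" for k unfolding X1_def Y_def using insert by auto
  have tR: "a t \<in> R" "b t \<in> R" using insert by auto
  have neg: "(- a t) ^ q \<approx> - b t"
  proof -
    \<comment> \<open>The sign is treated as an integer fixed by Frobenius modulo \<open>J\<close>,
      so that q = 2 needs no separate case.\<close>
    have "(of_int (- 1) ^ q) * a t ^ q \<approx> of_int (- 1) * b t"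
      using insert tR by (intro eqJ_mult frob_int R_power R_int) auto
    then show ?thesis by (simp add: power_minus[of "a t"])
  qed
  have p: "(- a t * coeff X1 k) ^ q \<approx> - b t * coeff Y k" for k
    unfolding power_mult_distrib using IH neg XR tR by (intro eqJ_mult R_power R_uminus) auto
  have "(- a t * coeff X1 k + (case k of 0 \<Rightarrow> 0 | Suc k' \<Rightarrow> coeff X1 k')) ^ q \<approx>
      - b t * coeff Y k + (case k of 0 \<Rightarrow> 0 | Suc k' \<Rightarrow> coeff Y k')"
  proof (cases k)
    case (Suc k')
    have "(- a t * coeff X1 k + coeff X1 k') ^ q \<approx> (- a t * coeff X1 k) ^ q + coeff X1 k' ^ q"
      using XR tR by (intro frob_add R_mult R_uminus) auto
    also have "\<dots> \<approx> - b t * coeff Y k + coeff Y k'" by (intro eqJ_add p IH)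
    finally show ?thesis using Suc by simp
  qed (use p in simp)
  moreover have "coeff (\<Prod>t\<in>insert t A. [:- a t, 1:]) k =
      - a t * coeff X1 k + (case k of 0 \<Rightarrow> 0 | Suc k' \<Rightarrow> coeff X1 k')"
    "coeff (\<Prod>t\<in>insert t A. [:- b t, 1:]) k =
      - b t * coeff Y k + (case k of 0 \<Rightarrow> 0 | Suc k' \<Rightarrow> coeff Y k')"
    using insert unfolding X1_def Y_def by (auto simp: coeff_pCons split: nat.splits)
  ultimately show ?case by (simp only:)
qed

text \<open>The polynomial with the orbit as its roots is unchanged by \<open>\<phi>\<close>, so its
  coefficients are congruent to integers. Its integer version vanishes at \<open>s\<close> modulo
  \<open>J\<close>, hence is divisible by the irreducible \<open>g\<close> modulo \<open>q\<close>.
  Thus deg g <= orbit size <= number of roots of g <= deg g.\<close>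

lemma orbit_eq:
  assumes g: "g \<in> pm.irr_m" and s: "s \<in> roots_of g"
  shows "orbit s = roots_of g" and "card (roots_of g) = degree g"
proof -
  have sub: "orbit s \<subseteq> roots_of g" by (rule orbit_subset[OF s])
  have finR: "finite (roots_of g)" using fin_S by (auto simp: roots_of_def)
  have finO: "finite (orbit s)" by (rule finite_subset[OF sub finR])
  have OS: "orbit s \<subseteq> S" using sub by (auto simp: roots_of_def)
  have sO: "s \<in> orbit s" unfolding orbit_def by (rule range_eqI[of _ _ 0]) simp
  have "\<phi> ` orbit s \<subseteq> orbit s"
  proof
    fix x assume "x \<in> \<phi> ` orbit s"
    then obtain k where "x = (\<phi> ^^ Suc k) s" by (auto simp: orbit_def)
    then show "x \<in> orbit s" unfolding orbit_def by blast
  qed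
  moreover have inj: "inj_on \<phi> (orbit s)" using permutes_inj[OF \<phi>_permutes] by (rule inj_on_subset) simp
  ultimately have im: "\<phi> ` orbit s = orbit s" using endo_inj_surj[OF finO] by blast
  define h where "h = (\<Prod>t\<in>orbit s. [:- t, 1:])"
  have hphi: "(\<Prod>t\<in>orbit s. [:- \<phi> t, 1:]) = h"
    using prod.reindex[OF inj, of "\<lambda>t. [:- t, 1:]"] im unfolding h_def by simp
  have cR: "coeff h k \<in> R" for k unfolding h_def using OS R_S by (intro coeff_prod_R finO) auto
  have "coeff h k ^ q \<approx> coeff h k" for k
    using frob_coeff_prod[of "orbit s" "\<lambda>t. t" \<phi> k] finO OS \<phi> R_S hphi unfolding h_def by (metis subsetD)
  then have "\<exists>c. coeff h k \<approx> of_int c" for k using fixed_by_frob_int[OF cR] by metis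
  then obtain a where a: "\<And>k. coeff h k \<approx> of_int (coeff a k)" "degree a \<le> degree h"
    using R_int_poly_approx by metis
  have dh: "degree h = card (orbit s)" unfolding h_def by (simp add: degree_prod_eq_sum_degree)
  have lh: "lead_coeff h = 1" unfolding h_def lead_coeff_prod by simp
  have sR: "s \<in> R" using OS sO R_S by blast
  have "poly h s = 0" unfolding h_def using finO sO by (auto simp: poly_prod)
  moreover have "poly h s \<approx> poly (of_int_poly a) s" using a(1) sR by (intro eqJ_poly_coeff) auto
  ultimately have as: "poly (of_int_poly a) s \<in> J" by (metis eqJ_0 eqJ_sym)
  have "pm.dvdm g a"
  \<comment> \<open>Otherwise a Bezout identity for \<open>g\<close> and \<open>a\<close>, evaluated
    at \<open>s\<close>, would put 1 into \<open>J\<close>.\<close>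
  proof (rule ccontr)
    assume "\<not> pm.dvdm g a"
    then obtain u v w where "u * g + v * a = 1 + smult (int q) w" using pm.irr_coprime[OF g] by metis
    then have "poly (of_int_poly (u * g + v * a)) s = poly (of_int_poly (1 + smult (int q) w)) s" by simp
    then have "1 = poly (of_int_poly u) s * poly (of_int_poly g) s
        + poly (of_int_poly v) s * poly (of_int_poly a) s - of_nat q * poly (of_int_poly w) s"
      by (simp add: of_int_hom.map_poly_hom_add of_int_poly_hom.hom_mult of_int_hom.map_poly_hom_smult)
    also have "\<dots> \<in> J" using as s sR q_J
      by (intro J_diff J_add J_mult J_mult' R_poly_int) (auto simp: roots_of_def)
    finally show False using one_J by simp
  qed
  moreover have "pm.Mp a \<noteq> 0"
  proof
    assume "pm.Mp a = 0"
    then have "pm.M (coeff a (degree h)) = 0" by (metis coeff_0 pm.Mp_coeff)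
    then have "of_int (coeff a (degree h)) \<in> J" unfolding J_int pm.M_def by auto
    then show False using a(1)[of "degree h"] lh one_J eqJ_J by auto
  qed
  ultimately have "degree g \<le> degree a"
    using pm.dvdm_degree[OF pm.irr_mD(2)[OF g]] by blast
  then have 1: "degree g \<le> card (orbit s)" using a(2) dh by simp
  have 2: "card (orbit s) \<le> card (roots_of g)" using sub finR by (rule card_mono[rotated])
  have 3: "card (roots_of g) \<le> degree g" by (rule card_roots_of_le[OF pm.irr_mD(2)[OF g]])
  show "card (roots_of g) = degree g" using 1 2 3 by simp
  show "orbit s = roots_of g" using 1 2 3 by (intro card_subset_eq finR sub) simp
qed

context
  fixes fs assumes fs: "set_mset fs \<subseteq> pm.irr_m" "pm.eq_m f (prod_mset fs)"
begin

lemma ex_factor_root: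
  assumes s: "s \<in> S" shows "\<exists>g\<in>#fs. s \<in> roots_of g"
proof -
  have sR: "s \<in> R" using s R_S by simp
  have "poly (of_int_poly f) s = 0" unfolding f_S using s fin_S by (auto simp: poly_prod)
  then have "poly (of_int_poly (prod_mset fs)) s \<in> J"
    using eq_m_eval[OF fs(2) sR] by (metis eqJ_0 eqJ_sym)
  then have "\<exists>g\<in>#fs. poly (of_int_poly g) s \<in> J"
  proof (induction fs)
    case (add g fs)
    then have "poly (of_int_poly g) s \<in> J \<or> poly (of_int_poly (prod_mset fs)) s \<in> J"
      using sR by (intro prime_J R_poly_int) (auto simp: of_int_poly_hom.hom_mult)
    then show ?case using add.IH by auto
  qed (use one_J in simp)
  then show ?thesis using s by (auto simp: roots_of_def)
qed

lemma card_S: "card S = sum_mset (image_mset degree fs)"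
proof -
  have "monic (prod_mset fs)" by (rule pm.monic_prod_irr[OF fs(1)])
  moreover have "degree f = card S"
    using arg_cong[OF f_S, of degree] by (simp add: degree_prod_eq_sum_degree)
  moreover have "lead_coeff f = 1"
    using arg_cong[OF f_S, of lead_coeff] by (simp add: lead_coeff_prod)
  ultimately show ?thesis
    using pm.degree_prod_irr[OF fs(1)] fs(2) pm.monic_degree_m[of f] pm.monic_degree_m[of "prod_mset fs"] by simp
qed

text \<open>If some factor had no root in \<open>S\<close>, the other factors would have to account
  for all of \<open>S\<close>, which is more than the sum of their degrees.\<close>

lemma roots_of_factor:
  assumes g: "g \<in># fs" shows "card (roots_of g) = degree g" "\<And>s. s \<in> roots_of g \<Longrightarrow> orbit s = roots_of g"
proof -
  have gi: "g \<in> pm.irr_m" using g fs by auto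
  obtain fs' where fs': "fs = add_mset g fs'" using g by (metis multi_member_split)
  have "roots_of g \<noteq> {}"
  proof
    assume e: "roots_of g = {}"
    have "S \<subseteq> (\<Union>h\<in>set_mset fs'. roots_of h)" using ex_factor_root e fs' by fastforce
    then have "card S \<le> card (\<Union>h\<in>set_mset fs'. roots_of h)"
      using fin_S by (intro card_mono) (auto simp: roots_of_def)
    also have "\<dots> \<le> (\<Sum>h\<in>set_mset fs'. card (roots_of h))" by (rule card_UN_le) simp
    also have "\<dots> \<le> (\<Sum>h\<in>set_mset fs'. degree h * count fs' h)"
    proof (rule sum_mono)
      fix h assume h: "h \<in># fs'"
      then have "card (roots_of h) \<le> degree h" using fs fs' pm.irr_mD(2) by (intro card_roots_of_le) auto
      also have "\<dots> \<le> degree h * count fs' h" using h by simp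
      finally show "card (roots_of h) \<le> degree h * count fs' h" .
    qed
    also have "\<dots> = sum_mset (image_mset degree fs')"
      by (rule sum_mset_eq_sum_count[symmetric]) auto
    finally show False using card_S fs' pm.irr_mD(4)[OF gi] by simp
  qed
  then obtain s where "s \<in> roots_of g" by blast
  then show "card (roots_of g) = degree g" using orbit_eq[OF gi] by simp
  show "\<And>s. s \<in> roots_of g \<Longrightarrow> orbit s = roots_of g" using orbit_eq[OF gi] by simp
qed

lemma \<phi>_fixed:
  assumes "g \<in># fs" "degree g = 1" "s \<in> roots_of g" shows "\<phi> s = s"
proof -
  have "card (roots_of g) = 1" using roots_of_factor(1)[OF assms(1)] assms(2) by simp
  then obtain x where "roots_of g = {x}" by (rule card_1_singletonE)
  then show ?thesis using assms(3) roots_of_\<phi>[OF assms(3)] by simp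
qed

lemma type_full:
  assumes "image_mset degree fs = {#card S#}" "s \<in> S" "t \<in> S"
  shows "\<exists>k. (\<phi> ^^ k) s = t"
proof -
  obtain g where g: "fs = {#g#}" using msed_map_invR[OF assms(1)] by auto
  have "s \<in> roots_of g" "t \<in> roots_of g" using ex_factor_root assms g by auto
  then have "t \<in> orbit s" using roots_of_factor(2)[of g s] g by simp
  then show ?thesis by (auto simp: orbit_def)
qed

lemma type_point_stabilizer:
  assumes "image_mset degree fs = {#1, card S - 1#}"
  shows "\<exists>s0\<in>S. \<phi> s0 = s0 \<and> (\<forall>s\<in>S - {s0}. \<forall>t\<in>S - {s0}. \<exists>k. (\<phi> ^^ k) s = t)"
proof -
  obtain g fs' where 1: "fs = add_mset g fs'" "degree g = 1" "image_mset degree fs' = {#card S - 1#}"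
    using msed_map_invR[of degree fs 1 "{#card S - 1#}"] assms by auto
  obtain h where 2: "fs' = {#h#}" using msed_map_invR[OF 1(3)] by auto
  have gh: "g \<in># fs" "h \<in># fs" using 1 2 by auto
  have "card (roots_of g) = 1" using roots_of_factor(1)[OF gh(1)] 1 by simp
  then obtain s0 where s0: "roots_of g = {s0}" by (rule card_1_singletonE)
  have sr: "s \<in> roots_of h" if "s \<in> S - {s0}" for s using ex_factor_root[of s] that 1 2 s0 by auto
  have "\<exists>k. (\<phi> ^^ k) s = t" if "s \<in> S - {s0}" "t \<in> S - {s0}" for s t
  proof -
    have "t \<in> orbit s" using sr[OF that(1)] sr[OF that(2)] roots_of_factor(2)[OF gh(2), of s] by simp
    then show ?thesis by (auto simp: orbit_def)
  qed
  moreover have "\<phi> s0 = s0" using \<phi>_fixed[OF gh(1) 1(2), of s0] s0 by simp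
  moreover have "s0 \<in> S" using s0 by (auto simp: roots_of_def)
  ultimately show ?thesis by blast
qed

lemma type_transposition:
  assumes "image_mset degree fs = add_mset 2 (replicate_mset (card S - 2) 1)"
  shows "\<exists>a\<in>S. \<exists>b\<in>S. a \<noteq> b \<and> \<phi> = Transposition.transpose a b"
proof -
  obtain g fs' where 1: "fs = add_mset g fs'" "degree g = 2" "image_mset degree fs' = replicate_mset (card S - 2) 1"
    using msed_map_invR[of degree fs 2] assms(1) by auto
  have g: "g \<in># fs" using 1 by auto
  have deg1: "degree h = 1" if "h \<in># fs'" for h
    using that arg_cong[OF 1(3), of set_mset] by (auto split: if_splits)
  have "card (roots_of g) = 2" using roots_of_factor(1)[OF g] 1 by simp
  then obtain a b where ab: "roots_of g = {a, b}" "a \<noteq> b" by (auto simp: card_2_iff)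
  have abS: "a \<in> S" "b \<in> S" using ab by (auto simp: roots_of_def)
  have mv: "\<phi> x \<noteq> x" if "x \<in> roots_of g" for x
  proof
    assume "\<phi> x = x"
    then have "(\<phi> ^^ k) x = x" for k by (induction k) auto
    then have "orbit x = {x}" by (auto simp: orbit_def)
    then show False using roots_of_factor(2)[OF g that] ab by auto
  qed
  have "\<phi> a = b" "\<phi> b = a" using mv[of a] mv[of b] roots_of_\<phi>[of a g] roots_of_\<phi>[of b g] ab by auto
  moreover have "\<phi> x = x" if x: "x \<noteq> a" "x \<noteq> b" for x
  proof (cases "x \<in> S")
    case True
    then obtain h where "h \<in># fs" "x \<in> roots_of h" using ex_factor_root by blast
    moreover have "h \<in># fs'" using calculation 1 ab x by auto
    ultimately show ?thesis using \<phi>_fixed deg1 by blast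
  qed (simp add: \<phi>_def)
  ultimately have "\<phi> = Transposition.transpose a b" by (auto simp: fun_eq_iff transpose_def)
  then show ?thesis using ab abS by blast
qed

end
end

section \<open>Generating the symmetric group\<close>

context root_set
begin

lemma G_funpow: "\<pi> \<in> G \<Longrightarrow> \<pi> ^^ k \<in> G"
  by (induction k) (auto intro: G_id G_comp)

lemma G_conj_transpose:
  assumes "\<pi> \<in> G" "Transposition.transpose a b \<in> G"
  shows "Transposition.transpose (\<pi> a) (\<pi> b) \<in> G"
proof -
  have inj: "inj \<pi>" using permutes_inj[OF G_permutes[OF assms(1)]] .
  obtain \<rho> where \<rho>: "\<rho> \<in> G" "\<pi> \<circ> \<rho> = id" using G_inverse[OF assms(1)] by metis
  have "Transposition.transpose (\<pi> a) (\<pi> b) \<circ> \<pi> = \<pi> \<circ> Transposition.transpose a b"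
    using inj by (auto simp: fun_eq_iff transpose_def inj_eq)
  then have "Transposition.transpose (\<pi> a) (\<pi> b) \<circ> (\<pi> \<circ> \<rho>) = \<pi> \<circ> Transposition.transpose a b \<circ> \<rho>"
    by (simp only: comp_assoc[symmetric])
  then have "Transposition.transpose (\<pi> a) (\<pi> b) = \<pi> \<circ> Transposition.transpose a b \<circ> \<rho>"
    using \<rho>(2) by simp
  then show ?thesis using G_comp[OF \<rho>(1) G_comp[OF assms(2,1)]] by simp
qed

text \<open>Conjugation moves the given transposition first to one that involves \<open>s0\<close>,
  and then, by the stabilizer of \<open>s0\<close>, to every transposition that involves
  \<open>s0\<close>. Conjugating these by each other gives all transpositions.\<close>

lemma G_full:
  assumes trans: "\<And>s t. s \<in> S \<Longrightarrow> t \<in> S \<Longrightarrow> \<exists>\<pi>\<in>G. \<pi> s = t"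
    and stab: "s0 \<in> S" "\<And>s t. s \<in> S - {s0} \<Longrightarrow> t \<in> S - {s0} \<Longrightarrow> \<exists>\<pi>\<in>G. \<pi> s0 = s0 \<and> \<pi> s = t"
    and transp: "a \<in> S" "b \<in> S" "a \<noteq> b" "Transposition.transpose a b \<in> G"
    and \<pi>: "\<pi> permutes S"
  shows "\<pi> \<in> G"
proof -
  have star: "Transposition.transpose s0 x \<in> G" if x: "x \<in> S - {s0}" for x
  proof -
    obtain \<rho> where \<rho>: "\<rho> \<in> G" "\<rho> a = s0" using trans[OF transp(1) stab(1)] by blast
    have "\<rho> b \<noteq> s0" using \<rho> transp(3) permutes_inj[OF G_permutes[OF \<rho>(1)]] by (metis injD)
    moreover have "\<rho> b \<in> S" using permutes_in_image[OF G_permutes[OF \<rho>(1)]] transp(2) by simp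
    ultimately obtain \<sigma> where \<sigma>: "\<sigma> \<in> G" "\<sigma> s0 = s0" "\<sigma> (\<rho> b) = x" using stab(2)[of "\<rho> b" x] x by blast
    have "Transposition.transpose s0 (\<rho> b) \<in> G" using G_conj_transpose[OF \<rho>(1) transp(4)] \<rho>(2) by simp
    from G_conj_transpose[OF \<sigma>(1) this] \<sigma> show ?thesis by simp
  qed
  have all: "Transposition.transpose x y \<in> G" if "x \<in> S" "y \<in> S" "x \<noteq> y" for x y
  proof (cases "x = s0 \<or> y = s0")
    case True
    then show ?thesis using star[of x] star[of y] that by (auto simp: transpose_commute)
  next
    case False
    then have 1: "Transposition.transpose s0 x \<in> G" "Transposition.transpose s0 y \<in> G" using star that by auto
    from G_conj_transpose[OF 1] False that show ?thesis by (simp add: transpose_def)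
  qed
  show ?thesis using \<pi> fin_S
  proof (induction rule: permutes_induct)
    case (swap a b p)
    then show ?case by (intro G_comp all)
  qed (rule G_id)
qed

end

subsection \<open>The Galois group of the splitting field\<close>

abbreviation CR :: "complex ring" where "CR \<equiv> ring_of_type_algebra"

lemma CR_simps [simp]:
  "carrier CR = UNIV" "\<one>\<^bsub>CR\<^esub> = 1" "\<zero>\<^bsub>CR\<^esub> = 0"
  "x \<oplus>\<^bsub>CR\<^esub> y = x + y" "x \<otimes>\<^bsub>CR\<^esub> y = x * y"
  by (simp_all add: ring_of_type_algebra_def)

lemma CR_a_inv [simp]: "\<ominus>\<^bsub>CR\<^esub> x = - x"
proof -
  interpret field CR by (rule field_from_type_algebra)
  show ?thesis by (rule minus_equality) auto
qed

lemma CR_m_inv: "x \<noteq> 0 \<Longrightarrow> inv\<^bsub>CR\<^esub> x = inverse x"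
proof -
  assume x: "x \<noteq> 0"
  interpret field CR by (rule field_from_type_algebra)
  show ?thesis by (rule comm_inv_char) (use x in auto)
qed

context root_set
begin

definition K :: "complex set" where "K = generate_field CR (\<rat> \<union> S)"

lemma K_add: "x \<in> K \<Longrightarrow> y \<in> K \<Longrightarrow> x + y \<in> K"
  unfolding K_def using generate_field.eng_add[of x CR "\<rat> \<union> S" y] by simp

lemma K_mult: "x \<in> K \<Longrightarrow> y \<in> K \<Longrightarrow> x * y \<in> K"
  unfolding K_def using generate_field.eng_mult[of x CR "\<rat> \<union> S" y] by simp

lemma K_Rats: "x \<in> \<rat> \<Longrightarrow> x \<in> K"
  unfolding K_def using generate_field.incl[of x "\<rat> \<union> S" CR] by simp

lemma K_S: "x \<in> S \<Longrightarrow> x \<in> K"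
  unfolding K_def using generate_field.incl[of x "\<rat> \<union> S" CR] by simp

lemma K_inverse: "x \<in> K \<Longrightarrow> inverse x \<in> K"
proof (cases "x = 0")
  case False
  assume "x \<in> K"
  then show ?thesis using generate_field.m_inv[of x CR "\<rat> \<union> S"] False
    unfolding K_def by (simp add: CR_m_inv)
qed simp

lemma polyfun_K: "F \<in> polyfun S \<Longrightarrow> F id \<in> K"
  by (induction rule: polyfun.induct) (auto intro: K_add K_mult K_Rats K_S)

lemma frac_K: "F \<in> polyfun S \<Longrightarrow> H \<in> polyfun S \<Longrightarrow> F id / H id \<in> K"
  unfolding divide_inverse by (intro K_mult K_inverse polyfun_K)

text \<open>Fractions of values at the roots make it possible to define an automorphism by
  substituting a permutation in numerator and denominator.\<close>

lemma K_frac: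
  assumes "x \<in> K"
  obtains F H where "F \<in> polyfun S" "H \<in> polyfun S" "H id \<noteq> 0" "x = F id / H id"
proof -
  have "x \<in> generate_field CR (\<rat> \<union> S) \<Longrightarrow>
    \<exists>F\<in>polyfun S. \<exists>H\<in>polyfun S. H id \<noteq> 0 \<and> x = F id / H id"
  proof (induction rule: generate_field.induct)
    case one
    show ?case by (intro bexI[OF _ polyfun_1] bexI[OF _ polyfun_1]) simp
  next
    case (incl h)
    then show ?case
    proof
      assume "h \<in> \<rat>"
      then obtain a b where "b \<noteq> 0" "h = of_int a / of_int b" by (metis Rats_cases' less_irrefl)
      then show ?thesis by (intro bexI[OF _ polyfun.const[of a]] bexI[OF _ polyfun.const[of b]]) simp
    next
      assume "h \<in> S"
      then show ?thesis
        by (intro bexI[OF _ polyfun_id[OF \<open>h \<in> S\<close>]] bexI[OF _ polyfun_1]) simp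
    qed
  next
    case (a_inv h)
    then obtain F H where "F \<in> polyfun S" "H \<in> polyfun S" "H id \<noteq> 0" "h = F id / H id" by blast
    then show ?case by (intro bexI[OF _ polyfun_uminus[of F]] bexI[of _ H]) (auto simp: id_def)
  next
    case (m_inv h)
    then obtain F H where *: "F \<in> polyfun S" "H \<in> polyfun S" "H id \<noteq> 0" "h = F id / H id" by blast
    show ?case by (rule bexI[OF _ *(2)], rule bexI[OF _ *(1)]) (use * m_inv(2) in \<open>auto simp: CR_m_inv id_def\<close>)
  next
    case (eng_add h1 h2)
    then obtain F H F' H' where *: "F \<in> polyfun S" "H \<in> polyfun S" "H id \<noteq> 0" "h1 = F id / H id"
      "F' \<in> polyfun S" "H' \<in> polyfun S" "H' id \<noteq> 0" "h2 = F' id / H' id" by blast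
    show ?case
      by (rule bexI[OF _ polyfun.add[OF polyfun_mult[OF *(1,6)] polyfun_mult[OF *(5,2)]]],
          rule bexI[OF _ polyfun_mult[OF *(2,6)]]) (use * in \<open>simp add: add_frac_eq id_def\<close>)
  next
    case (eng_mult h1 h2)
    then obtain F H F' H' where *: "F \<in> polyfun S" "H \<in> polyfun S" "H id \<noteq> 0" "h1 = F id / H id"
      "F' \<in> polyfun S" "H' \<in> polyfun S" "H' id \<noteq> 0" "h2 = F' id / H' id" by blast
    show ?case
      by (rule bexI[OF _ polyfun_mult[OF *(1,5)]], rule bexI[OF _ polyfun_mult[OF *(2,6)]]) (use * in \<open>simp add: id_def\<close>)
  qed
  then show ?thesis using that assms unfolding K_def by blast
qed

text \<open>The field automorphism induced by a member of \<open>G\<close>; restricted to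
  \<open>K\<close> because the elements of \<open>Bij\<close> are extensional.\<close>

definition ext :: "(complex \<Rightarrow> complex) \<Rightarrow> complex \<Rightarrow> complex" where
  "ext \<pi> = (\<lambda>x\<in>K. SOME y. \<exists>F\<in>polyfun S. \<exists>H\<in>polyfun S. H id \<noteq> 0 \<and> x = F id / H id \<and> y = F \<pi> / H \<pi>)"

text \<open>Two representations F/H and F'/H' of one element yield the relation F H' - F' H, which
  \<open>\<pi>\<close> preserves; the denominators stay nonzero because \<open>G\<close> also
  reflects relations.\<close>

lemma ext_frac:
  assumes \<pi>: "\<pi> \<in> G" and F: "F \<in> polyfun S" and H: "H \<in> polyfun S" "H id \<noteq> 0"
  shows "ext \<pi> (F id / H id) = F \<pi> / H \<pi>"
proof -
  define Q where "Q y \<longleftrightarrow> (\<exists>F'\<in>polyfun S. \<exists>H'\<in>polyfun S. H' id \<noteq> 0 \<and>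
      F id / H id = F' id / H' id \<and> y = F' \<pi> / H' \<pi>)" for y
  have "Q (F \<pi> / H \<pi>)" unfolding Q_def using assms by blast
  then have "Q (SOME y. Q y)" by (rule someI)
  then obtain F' H' where *: "F' \<in> polyfun S" "H' \<in> polyfun S" "H' id \<noteq> 0" "F id / H id = F' id / H' id"
    "(SOME y. Q y) = F' \<pi> / H' \<pi>" unfolding Q_def by blast
  have "(\<lambda>\<kappa>. F \<kappa> * H' \<kappa> - F' \<kappa> * H \<kappa>) \<in> polyfun S"
    by (intro polyfun_diff polyfun_mult F H *(1,2))
  moreover have "F id * H' id - F' id * H id = 0" using * H by (simp add: field_simps)
  ultimately have "F \<pi> * H' \<pi> - F' \<pi> * H \<pi> = 0" by (rule G_zero[OF \<pi>])
  moreover have "H \<pi> \<noteq> 0" "H' \<pi> \<noteq> 0" using G_zero_iff[OF \<pi>] H * by auto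
  ultimately have "F \<pi> / H \<pi> = F' \<pi> / H' \<pi>" by (simp add: field_simps)
  then show ?thesis using *(5) frac_K[OF F H(1)] unfolding ext_def Q_def by simp
qed

lemma ext_K: assumes \<pi>: "\<pi> \<in> G" and x: "x \<in> K" shows "ext \<pi> x \<in> K"
proof -
  obtain F H where *: "F \<in> polyfun S" "H \<in> polyfun S" "H id \<noteq> 0" "x = F id / H id"
    using K_frac[OF x] by metis
  have im: "\<pi> ` S \<subseteq> S" using permutes_image[OF G_permutes[OF \<pi>]] by simp
  have "ext \<pi> x = F \<pi> / H \<pi>" unfolding *(4) by (rule ext_frac[OF \<pi> *(1-3)])
  then show ?thesis using frac_K[OF polyfun_comp[OF *(1) im] polyfun_comp[OF *(2) im]] by simp
qed

lemma ext_comp: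
  assumes \<pi>: "\<pi> \<in> G" and \<rho>: "\<rho> \<in> G" and x: "x \<in> K"
  shows "ext \<rho> (ext \<pi> x) = ext (\<rho> \<circ> \<pi>) x"
proof -
  obtain F H where *: "F \<in> polyfun S" "H \<in> polyfun S" "H id \<noteq> 0" "x = F id / H id"
    using K_frac[OF x] by metis
  have im: "\<pi> ` S \<subseteq> S" using permutes_image[OF G_permutes[OF \<pi>]] by simp
  have "ext \<pi> x = F \<pi> / H \<pi>" unfolding *(4) by (rule ext_frac[OF \<pi> *(1-3)])
  moreover have "H \<pi> \<noteq> 0" using G_zero_iff[OF \<pi> *(2)] *(3) by simp
  ultimately have "ext \<rho> (ext \<pi> x) = F (\<rho> \<circ> \<pi>) / H (\<rho> \<circ> \<pi>)"
    using ext_frac[OF \<rho> polyfun_comp[OF *(1) im] polyfun_comp[OF *(2) im]] by simp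
  moreover have "ext (\<rho> \<circ> \<pi>) x = F (\<rho> \<circ> \<pi>) / H (\<rho> \<circ> \<pi>)"
    unfolding *(4) by (rule ext_frac[OF G_comp[OF \<pi> \<rho>] *(1-3)])
  ultimately show ?thesis by simp
qed

lemma ext_id: "x \<in> K \<Longrightarrow> ext id x = x"
proof -
  assume "x \<in> K"
  then obtain F H where *: "F \<in> polyfun S" "H \<in> polyfun S" "H id \<noteq> 0" "x = F id / H id"
    using K_frac by metis
  show ?thesis unfolding *(4) by (rule ext_frac[OF G_id *(1-3)])
qed

lemma ext_bij: assumes "\<pi> \<in> G" shows "bij_betw (ext \<pi>) K K"
proof -
  obtain \<rho> where \<rho>: "\<rho> \<in> G" "\<rho> \<circ> \<pi> = id" "\<pi> \<circ> \<rho> = id" using G_inverse[OF assms] by metis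
  show ?thesis
    by (rule bij_betw_byWitness[of _ "ext \<rho>"])
      (use ext_comp[OF assms \<rho>(1)] ext_comp[OF \<rho>(1) assms] \<rho> ext_id ext_K[OF assms] ext_K[OF \<rho>(1)] in auto)
qed

lemma ext_S: assumes "\<pi> \<in> G" "s \<in> S" shows "ext \<pi> s = \<pi> s"
  using ext_frac[OF assms(1) polyfun_id[OF assms(2)] polyfun_1] by simp

lemma ext_Rats: assumes "\<pi> \<in> G" "x \<in> \<rat>" shows "ext \<pi> x = x"
proof -
  obtain a b where "b \<noteq> 0" "x = of_int a / of_int b" using assms(2) by (metis Rats_cases' less_irrefl)
  then show ?thesis using ext_frac[OF assms(1) polyfun.const[of a] polyfun.const[of b]] by simp
qed

lemma ext_add_mult:
  assumes \<pi>: "\<pi> \<in> G" and xy: "x \<in> K" "y \<in> K"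
  shows "ext \<pi> (x + y) = ext \<pi> x + ext \<pi> y" "ext \<pi> (x * y) = ext \<pi> x * ext \<pi> y"
proof -
  obtain F H where *: "F \<in> polyfun S" "H \<in> polyfun S" "H id \<noteq> 0" "x = F id / H id"
    using K_frac[OF xy(1)] by metis
  obtain F' H' where **: "F' \<in> polyfun S" "H' \<in> polyfun S" "H' id \<noteq> 0" "y = F' id / H' id"
    using K_frac[OF xy(2)] by metis
  have nz: "H \<pi> \<noteq> 0" "H' \<pi> \<noteq> 0" using G_zero_iff[OF \<pi>] * ** by auto
  have x: "ext \<pi> x = F \<pi> / H \<pi>" unfolding *(4) by (rule ext_frac[OF \<pi> *(1-3)])
  have y: "ext \<pi> y = F' \<pi> / H' \<pi>" unfolding **(4) by (rule ext_frac[OF \<pi> **(1-3)])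
  have HH: "(\<lambda>\<kappa>. H \<kappa> * H' \<kappa>) \<in> polyfun S" "H id * H' id \<noteq> 0"
    using polyfun_mult[OF *(2) **(2)] *(3) **(3) by auto
  have "x + y = (F id * H' id + F' id * H id) / (H id * H' id)" using * ** by (simp add: add_frac_eq)
  then have "ext \<pi> (x + y) = (F \<pi> * H' \<pi> + F' \<pi> * H \<pi>) / (H \<pi> * H' \<pi>)"
    using ext_frac[OF \<pi> polyfun.add[OF polyfun_mult[OF *(1) **(2)] polyfun_mult[OF **(1) *(2)]] HH] by (simp add: id_def)
  then show "ext \<pi> (x + y) = ext \<pi> x + ext \<pi> y" unfolding x y using nz by (simp add: add_frac_eq)
  have "x * y = (F id * F' id) / (H id * H' id)" using * ** by simp
  then show "ext \<pi> (x * y) = ext \<pi> x * ext \<pi> y"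
    unfolding x y using ext_frac[OF \<pi> polyfun_mult[OF *(1) **(1)] HH] by (simp add: id_def)
qed

text \<open>An automorphism is determined by its action on the roots since \<open>K\<close> consists
  of fractions of expressions in them, and every permutation arises since \<open>ext\<close> extends
  it.\<close>

lemma galois_symmetric:
  fixes f :: "int poly"
  assumes f: "of_int_poly f = (\<Prod>s\<in>S. [:- s, 1:])" and full: "\<And>\<pi>. \<pi> permutes S \<Longrightarrow> \<pi> \<in> G"
  shows "galois_group (splitting_field (map_poly rat_of_int f)) \<rat> \<cong> sym_group (card S)"
proof -
  have roots: "poly (of_int_poly f) z = 0 \<longleftrightarrow> z \<in> S" for z :: complex
    unfolding f using fin_S by (auto simp: poly_prod)
  have "map_poly of_rat (map_poly rat_of_int f) = (of_int_poly f :: complex poly)"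
    by (rule poly_eqI) (simp add: coeff_map_poly)
  then have SF: "splitting_field (map_poly rat_of_int f) = CR\<lparr>carrier := K\<rparr>"
    unfolding splitting_field_def K_def using roots by simp
  define Gal where "Gal = galois_group (splitting_field (map_poly rat_of_int f)) \<rat>"
  have carr: "carrier Gal = {\<sigma> \<in> Bij K. \<sigma> \<in> ring_iso (CR\<lparr>carrier := K\<rparr>) (CR\<lparr>carrier := K\<rparr>) \<and> (\<forall>x\<in>\<rat>. \<sigma> x = x)}"
    unfolding Gal_def galois_group_def SF by simp
  have mult: "x \<otimes>\<^bsub>Gal\<^esub> y = compose K x y" if "x \<in> carrier Gal" "y \<in> carrier Gal" for x y
    using that unfolding carr unfolding Gal_def galois_group_def SF BijGroup_def by simp
  have galD: "\<sigma> \<in> extensional K" "bij_betw \<sigma> K K" "\<And>x y. x \<in> K \<Longrightarrow> y \<in> K \<Longrightarrow> \<sigma> (x + y) = \<sigma> x + \<sigma> y"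
    "\<And>x y. x \<in> K \<Longrightarrow> y \<in> K \<Longrightarrow> \<sigma> (x * y) = \<sigma> x * \<sigma> y" "\<And>x. x \<in> \<rat> \<Longrightarrow> \<sigma> x = x"
    if "\<sigma> \<in> carrier Gal" for \<sigma>
    using that unfolding carr Bij_def ring_iso_def Ring.ring_hom_def by auto
  have galI: "\<sigma> \<in> carrier Gal" if "\<sigma> \<in> extensional K" "bij_betw \<sigma> K K"
    "\<And>x y. x \<in> K \<Longrightarrow> y \<in> K \<Longrightarrow> \<sigma> (x + y) = \<sigma> x + \<sigma> y"
    "\<And>x y. x \<in> K \<Longrightarrow> y \<in> K \<Longrightarrow> \<sigma> (x * y) = \<sigma> x * \<sigma> y" "\<And>x. x \<in> \<rat> \<Longrightarrow> \<sigma> x = x" for \<sigma>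
    using that bij_betwE[OF that(2)] unfolding carr Bij_def ring_iso_def Ring.ring_hom_def by auto
  \<comment> \<open>An automorphism is itself an assignment of values to the roots; only its values
    on \<open>S\<close> matter for \<open>F \<sigma>\<close>.\<close>
  have ev: "\<sigma> (F id) = F \<sigma>" if \<sigma>: "\<sigma> \<in> carrier Gal" and F: "F \<in> polyfun S" for \<sigma> F
    using F
  proof (induction rule: polyfun.induct)
    case (const c)
    then show ?case using galD(5)[OF \<sigma>, of "of_int c"] by simp
  next
    case (var s F)
    then show ?case using galD(4)[OF \<sigma> K_S polyfun_K, of s F] by (simp add: id_def)
  next
    case (add F H)
    then show ?case using galD(3)[OF \<sigma> polyfun_K polyfun_K, of F H] by (simp add: id_def)
  qed
  have \<sigma>S: "\<sigma> s \<in> S" if \<sigma>: "\<sigma> \<in> carrier Gal" and s: "s \<in> S" for \<sigma> s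
  proof -
    have F: "(\<lambda>\<kappa>. poly (of_int_poly f) (\<kappa> s)) \<in> polyfun S"
      unfolding poly_altdef using s
      by (intro polyfun_sum polyfun_mult polyfun_power polyfun_id) (auto intro: polyfun.const)
    have "\<sigma> 0 = 0" using galD(5)[OF \<sigma>, of 0] by simp
    then have "poly (of_int_poly f) (\<sigma> s) = 0" using ev[OF \<sigma> F] s roots[of s] by simp
    then show ?thesis using roots by simp
  qed
  define n where "n = card S"
  obtain h where h: "bij_betw h S {1..n}"
    using finite_same_card_bij[OF fin_S, of "{1..n}"] unfolding n_def by auto
  define h' where "h' = inv_into S h"
  have hh': "h (h' i) = i" "h' i \<in> S" if "i \<in> {1..n}" for i
    using that h unfolding h'_def by (auto simp: bij_betw_def f_inv_into_f inv_into_into)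
  have h'h: "h' (h s) = s" "h s \<in> {1..n}" if "s \<in> S" for s
    using that h bij_betwE[OF h] unfolding h'_def by (auto simp: bij_betw_def inv_into_f_f)
  define \<Psi> where "\<Psi> \<sigma> i = (if i \<in> {1..n} then h (\<sigma> (h' i)) else i)" for \<sigma> :: "complex \<Rightarrow> complex" and i
  have \<Psi>perm: "\<Psi> \<sigma> permutes {1..n}" if \<sigma>: "\<sigma> \<in> carrier Gal" for \<sigma>
  proof (rule bij_imp_permutes)
    have "inj_on (\<Psi> \<sigma>) {1..n}"
    proof (rule inj_onI)
      fix i j assume ij: "i \<in> {1..n}" "j \<in> {1..n}" "\<Psi> \<sigma> i = \<Psi> \<sigma> j"
      then have "h (\<sigma> (h' i)) = h (\<sigma> (h' j))" unfolding \<Psi>_def by simp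
      then have "\<sigma> (h' i) = \<sigma> (h' j)" using h'h(1)[OF \<sigma>S[OF \<sigma> hh'(2)]] ij by metis
      then have "h' i = h' j" using galD(2)[OF \<sigma>] hh'(2) ij K_S by (auto simp: bij_betw_def inj_on_def)
      then show "i = j" using hh'(1) ij by metis
    qed
    moreover have "\<Psi> \<sigma> ` {1..n} \<subseteq> {1..n}" unfolding \<Psi>_def using h'h(2)[OF \<sigma>S[OF \<sigma> hh'(2)]] by auto
    ultimately show "bij_betw (\<Psi> \<sigma>) {1..n} {1..n}" using endo_inj_surj[of "{1..n}" "\<Psi> \<sigma>"] by (auto simp: bij_betw_def)
  qed (auto simp: \<Psi>_def)
  have "\<Psi> \<in> hom Gal (sym_group n)"
  proof (rule homI)
    fix \<sigma> assume "\<sigma> \<in> carrier Gal"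
    then show "\<Psi> \<sigma> \<in> carrier (sym_group n)" using \<Psi>perm by (simp add: sym_group_def)
  next
    fix \<sigma> \<tau> assume st: "\<sigma> \<in> carrier Gal" "\<tau> \<in> carrier Gal"
    have "\<Psi> (compose K \<sigma> \<tau>) = \<Psi> \<sigma> \<circ> \<Psi> \<tau>"
    proof
      fix i
      show "\<Psi> (compose K \<sigma> \<tau>) i = (\<Psi> \<sigma> \<circ> \<Psi> \<tau>) i"
      proof (cases "i \<in> {1..n}")
        case True
        have "\<tau> (h' i) \<in> S" by (rule \<sigma>S[OF st(2) hh'(2)[OF True]])
        then show ?thesis using True h'h K_S[OF hh'(2)[OF True]] by (auto simp: \<Psi>_def compose_def)
      qed (auto simp: \<Psi>_def)
    qed
    then show "\<Psi> (\<sigma> \<otimes>\<^bsub>Gal\<^esub> \<tau>) = \<Psi> \<sigma> \<otimes>\<^bsub>sym_group n\<^esub> \<Psi> \<tau>"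
      using mult[OF st] by (simp add: sym_group_def)
  qed
  moreover have "bij_betw \<Psi> (carrier Gal) (carrier (sym_group n))"
    unfolding bij_betw_def
  proof
    show "inj_on \<Psi> (carrier Gal)"
    proof (rule inj_onI)
      fix \<sigma> \<tau> assume st: "\<sigma> \<in> carrier Gal" "\<tau> \<in> carrier Gal" "\<Psi> \<sigma> = \<Psi> \<tau>"
      have onS: "\<sigma> s = \<tau> s" if s: "s \<in> S" for s
      proof -
        have "h (\<sigma> s) = h (\<tau> s)" using fun_cong[OF st(3), of "h s"] h'h[OF s] by (simp add: \<Psi>_def)
        then show ?thesis using h'h(1)[OF \<sigma>S[OF st(1) s]] h'h(1)[OF \<sigma>S[OF st(2) s]] by metis
      qed
      show "\<sigma> = \<tau>"
      proof
        fix x show "\<sigma> x = \<tau> x"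
        proof (cases "x \<in> K")
          case True
          then obtain F H where *: "F \<in> polyfun S" "H \<in> polyfun S" "H id \<noteq> 0" "x = F id / H id"
            using K_frac by metis
          have eqF: "\<sigma> (E id) = \<tau> (E id)" if "E \<in> polyfun S" for E
            using ev[OF st(1) that] ev[OF st(2) that] polyfun_cong[OF that, of \<sigma> \<tau>] onS by simp
          have xH: "x * H id = F id" using * by simp
          have "\<sigma> x * \<sigma> (H id) = \<sigma> (F id)" "\<tau> x * \<tau> (H id) = \<tau> (F id)"
            using galD(4)[OF st(1) True polyfun_K[OF *(2)]] galD(4)[OF st(2) True polyfun_K[OF *(2)]] xH by simp_all
          moreover have "\<sigma> (H id) \<noteq> 0"
          proof
            assume "\<sigma> (H id) = 0"
            then have "\<sigma> (H id) = \<sigma> 0" using galD(5)[OF st(1), of 0] by simp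
            then have "H id = 0" using galD(2)[OF st(1)] polyfun_K[OF *(2)] K_Rats[of 0]
              by (auto simp: bij_betw_def inj_on_def)
            then show False using * by simp
          qed
          ultimately show ?thesis using eqF[OF *(1)] eqF[OF *(2)] by (metis mult_right_cancel)
        next
          case False
          then show ?thesis using galD(1)[OF st(1)] galD(1)[OF st(2)] by (simp add: extensional_def)
        qed
      qed
    qed
    show "\<Psi> ` carrier Gal = carrier (sym_group n)"
    proof
      show "\<Psi> ` carrier Gal \<subseteq> carrier (sym_group n)" using \<Psi>perm by (auto simp: sym_group_def)
      show "carrier (sym_group n) \<subseteq> \<Psi> ` carrier Gal"
      proof
        fix \<tau> assume "\<tau> \<in> carrier (sym_group n)"
        then have \<tau>: "\<tau> permutes {1..n}" by (simp add: sym_group_def)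
        define \<pi> where "\<pi> x = (if x \<in> S then h' (\<tau> (h x)) else x)" for x
        have \<tau>in: "\<tau> i \<in> {1..n}" if "i \<in> {1..n}" for i using permutes_in_image[OF \<tau>] that by blast
        have "\<pi> permutes S"
        proof (rule bij_imp_permutes)
          have "inj_on \<pi> S"
          proof (rule inj_onI)
            fix s t assume st: "s \<in> S" "t \<in> S" "\<pi> s = \<pi> t"
            then have "\<tau> (h s) = \<tau> (h t)" using hh'(1)[OF \<tau>in[OF h'h(2)]] unfolding \<pi>_def by metis
            then have "h s = h t" using permutes_inj[OF \<tau>] by (metis injD)
            then show "s = t" using h'h(1) st by metis
          qed
          moreover have "\<pi> ` S \<subseteq> S" unfolding \<pi>_def using hh'(2)[OF \<tau>in[OF h'h(2)]] by auto
          ultimately show "bij_betw \<pi> S S" using endo_inj_surj[OF fin_S] by (auto simp: bij_betw_def)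
        qed (simp add: \<pi>_def)
        then have \<pi>G: "\<pi> \<in> G" by (rule full)
        have "ext \<pi> \<in> extensional K" by (simp add: ext_def)
        then have "ext \<pi> \<in> carrier Gal"
          by (rule galI) (auto simp: ext_bij[OF \<pi>G] ext_add_mult[OF \<pi>G] ext_Rats[OF \<pi>G])
        moreover have "\<Psi> (ext \<pi>) = \<tau>"
        proof
          fix i show "\<Psi> (ext \<pi>) i = \<tau> i"
          proof (cases "i \<in> {1..n}")
            case True
            have "ext \<pi> (h' i) = h' (\<tau> i)" using ext_S[OF \<pi>G hh'(2)[OF True]] hh'[OF True] by (simp add: \<pi>_def)
            then show ?thesis using True hh'(1)[OF \<tau>in[OF True]] by (simp add: \<Psi>_def)
          next
            case False
            then show ?thesis using permutes_not_in[OF \<tau> False] unfolding \<Psi>_def by (simp only: if_False)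
          qed
        qed
        ultimately show "\<tau> \<in> \<Psi> ` carrier Gal" by blast
      qed
    qed
  qed
  ultimately have "\<Psi> \<in> iso Gal (sym_group n)" by (simp add: iso_def)
  then show ?thesis unfolding is_iso_def Gal_def n_def by blast
qed

end

subsection \<open>Densities in the coefficient box\<close>

text \<open>The common form of the coefficient box, of the residue system modulo an integer and of a
  residue class inside the box; one cardinality formula serves all three.\<close>

definition monic_polys :: "nat \<Rightarrow> (nat \<Rightarrow> int set) \<Rightarrow> int poly set" where
  "monic_polys n A = {f. degree f = n \<and> lead_coeff f = 1 \<and> (\<forall>j<n. coeff f j \<in> A j)}"

definition of_coeffs :: "nat \<Rightarrow> (nat \<Rightarrow> int) \<Rightarrow> int poly" where
  "of_coeffs n c = monom 1 n + (\<Sum>j<n. monom (c j) j)"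

lemma coeff_of_coeffs: "coeff (of_coeffs n c) j = (if j < n then c j else if j = n then 1 else 0)"
  by (auto simp: of_coeffs_def coeff_sum)

lemma degree_of_coeffs: "degree (of_coeffs n c) = n"
proof (rule antisym)
  show "degree (of_coeffs n c) \<le> n" by (rule degree_le) (simp add: coeff_of_coeffs)
  show "n \<le> degree (of_coeffs n c)" by (rule le_degree) (simp add: coeff_of_coeffs)
qed

lemma of_coeffs_in: "(\<And>j. j < n \<Longrightarrow> c j \<in> A j) \<Longrightarrow> of_coeffs n c \<in> monic_polys n A"
  by (simp add: monic_polys_def degree_of_coeffs coeff_of_coeffs)

lemma of_coeffs_eq:
  assumes "degree f = n" "lead_coeff f = 1" "\<And>j. j < n \<Longrightarrow> coeff f j = c j"
  shows "f = of_coeffs n c"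
proof (rule poly_eqI)
  fix j
  consider "j < n" | "j = n" | "j > n" by linarith
  then show "coeff f j = coeff (of_coeffs n c) j"
    by cases (use assms in \<open>simp_all add: coeff_of_coeffs coeff_eq_0\<close>)
qed

lemma bij_monic_polys: "bij_betw (\<lambda>f. restrict (coeff f) {..<n}) (monic_polys n A) (PiE {..<n} A)"
proof (rule bij_betw_byWitness[of _ "of_coeffs n"])
  show "\<forall>f\<in>monic_polys n A. of_coeffs n (restrict (coeff f) {..<n}) = f"
    by (intro ballI, rule of_coeffs_eq[symmetric]) (auto simp: monic_polys_def)
  show "\<forall>c\<in>PiE {..<n} A. restrict (coeff (of_coeffs n c)) {..<n} = c"
    by (auto simp: coeff_of_coeffs fun_eq_iff PiE_def extensional_def)
  show "(\<lambda>f. restrict (coeff f) {..<n}) ` monic_polys n A \<subseteq> PiE {..<n} A"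
    by (auto simp: monic_polys_def split: if_splits)
  show "of_coeffs n ` PiE {..<n} A \<subseteq> monic_polys n A"
  proof safe
    fix c assume "c \<in> PiE {..<n} A"
    then show "of_coeffs n c \<in> monic_polys n A" by (intro of_coeffs_in) auto
  qed
qed

lemma card_monic_polys: "card (monic_polys n A) = (\<Prod>j<n. card (A j))"
  unfolding bij_betw_same_card[OF bij_monic_polys, of n A] by (simp add: card_PiE)

lemma finite_monic_polys: "(\<And>j. j < n \<Longrightarrow> finite (A j)) \<Longrightarrow> finite (monic_polys n A)"
  unfolding bij_betw_finite[OF bij_monic_polys, of n A] by (rule finite_PiE) simp_all

definition residues_n :: "nat \<Rightarrow> nat \<Rightarrow> int poly set" where
  "residues_n n Q = monic_polys n (\<lambda>_. {0..<int Q})"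

lemma finite_residues_n: "finite (residues_n n Q)"
  unfolding residues_n_def by (rule finite_monic_polys) simp

lemma card_residues_n: "card (residues_n n Q) = Q ^ n"
  unfolding residues_n_def card_monic_polys by simp

definition cong_coeffs :: "nat \<Rightarrow> int poly \<Rightarrow> int poly \<Rightarrow> bool" where
  "cong_coeffs Q f g \<longleftrightarrow> (\<forall>j. [coeff f j = coeff g j] (mod int Q))"

definition periodic :: "nat \<Rightarrow> (int poly \<Rightarrow> bool) \<Rightarrow> bool" where
  "periodic Q P \<longleftrightarrow> (\<forall>f g. cong_coeffs Q f g \<longrightarrow> P f = P g)"

definition interval :: "real \<Rightarrow> int set" where
  "interval B = {z. - B < of_int z \<and> of_int z \<le> B}"

lemma monic_box_eq: "monic_box n B = monic_polys n (\<lambda>_. interval B)"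
  by (simp add: monic_box_def monic_polys_def interval_def)

definition residue_count :: "nat \<Rightarrow> int \<Rightarrow> real \<Rightarrow> nat" where
  "residue_count Q r B = card {z \<in> interval B. z mod int Q = r}"

lemma finite_interval: "finite (interval B)"
proof (rule finite_subset)
  show "interval B \<subseteq> {- \<lceil>B\<rceil>..\<lceil>B\<rceil>}"
    unfolding interval_def by (auto simp: le_ceiling_iff; linarith)
qed simp

text \<open>Writing z = r + Q k turns the count into that of the integers k in a real interval, open
  on the left and closed on the right like the box, which is a difference of floors.\<close>

lemma residue_count_eq:
  assumes Q: "Q > 0" and r: "0 \<le> r" "r < int Q" and B: "B > 0"
  shows "int (residue_count Q r B) = \<lfloor>(B - of_int r) / Q\<rfloor> - \<lfloor>(- B - of_int r) / Q\<rfloor>"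
proof -
  define l u where "l = \<lfloor>(- B - of_int r) / Q\<rfloor>" and "u = \<lfloor>(B - of_int r) / Q\<rfloor>"
  have "bij_betw (\<lambda>k. r + int Q * k) {l<..u} {z \<in> interval B. z mod int Q = r}"
  proof (rule bij_betw_byWitness[of _ "\<lambda>z. z div int Q"])
    have iff: "r + int Q * k \<in> interval B \<longleftrightarrow> k \<in> {l<..u}" for k
    proof -
      have "k \<le> u \<longleftrightarrow> of_int k \<le> (B - of_int r) / Q" unfolding u_def by (rule le_floor_iff)
      also have "\<dots> \<longleftrightarrow> of_int (r + int Q * k) \<le> B" using Q by (simp add: field_simps)
      finally have 1: "k \<le> u \<longleftrightarrow> of_int (r + int Q * k) \<le> B" .
      have "l < k \<longleftrightarrow> (- B - of_int r) / Q < of_int k" unfolding l_def by (rule floor_less_iff)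
      also have "\<dots> \<longleftrightarrow> - B < of_int (r + int Q * k)" using Q by (simp add: field_simps)
      finally show ?thesis using 1 unfolding interval_def by auto
    qed
    show "(\<lambda>k. r + int Q * k) ` {l<..u} \<subseteq> {z \<in> interval B. z mod int Q = r}"
    proof safe
      fix k assume "k \<in> {l<..u}"
      then show "r + int Q * k \<in> interval B" by (simp only: iff)
      show "(r + int Q * k) mod int Q = r" using r Q by simp
    qed
    have dm: "r + int Q * (z div int Q) = z" if "z mod int Q = r" for z
      using that mult_div_mod_eq[of "int Q" z] by (simp add: add.commute)
    show "(\<lambda>z. z div int Q) ` {z \<in> interval B. z mod int Q = r} \<subseteq> {l<..u}"
    proof safe
      fix z assume "z \<in> interval B" "r = z mod int Q"
      then show "z div int Q \<in> {l<..u}" using iff[of "z div int Q"] dm[of z] by (simp only:)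
    qed
    show "\<forall>k\<in>{l<..u}. (r + int Q * k) div int Q = k" using r Q by simp
    show "\<forall>z\<in>{z \<in> interval B. z mod int Q = r}. r + int Q * (z div int Q) = z" using dm by auto
  qed
  then have "residue_count Q r B = card {l<..u}"
    unfolding residue_count_def by (rule bij_betw_same_card[symmetric])
  also have "l \<le> u" unfolding l_def u_def using B Q by (intro floor_mono divide_right_mono) auto
  then have "int (card {l<..u}) = u - l" by simp
  finally show ?thesis unfolding l_def u_def .
qed

lemma residue_count_limit:
  assumes Q: "Q > 0" and r: "0 \<le> r" "r < int Q"
  shows "((\<lambda>B. real (residue_count Q r B) / B) \<longlongrightarrow> 2 / real Q) at_top"
proof -
  \<comment> \<open>A difference of floors is within 1 of the difference of the arguments, which is
    2 B / Q.\<close>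
  have bd: "\<bar>real (residue_count Q r B) / B - 2 / real Q\<bar> \<le> 1 / B" if B: "B > 0" for B
  proof -
    define x y where "x = (B - of_int r) / Q" and "y = (- B - of_int r) / Q"
    have "real (residue_count Q r B) = of_int (\<lfloor>x\<rfloor> - \<lfloor>y\<rfloor>)"
      using residue_count_eq[OF Q r B] unfolding x_def y_def by (metis of_int_of_nat_eq)
    moreover have "x - y = 2 * B / Q" unfolding x_def y_def using Q by (simp add: field_simps)
    moreover have "of_int \<lfloor>x\<rfloor> \<le> x" "x < of_int \<lfloor>x\<rfloor> + 1" "of_int \<lfloor>y\<rfloor> \<le> y" "y < of_int \<lfloor>y\<rfloor> + 1" by linarith+
    ultimately have "\<bar>real (residue_count Q r B) - 2 * B / Q\<bar> \<le> 1" by simp linarith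
    then have "\<bar>real (residue_count Q r B) - 2 * B / Q\<bar> / B \<le> 1 / B" using B by (simp add: divide_right_mono)
    moreover have "\<bar>real (residue_count Q r B) - 2 * B / Q\<bar> / B = \<bar>real (residue_count Q r B) / B - 2 / Q\<bar>"
    proof -
      have "real (residue_count Q r B) / B - 2 / Q = (real (residue_count Q r B) - 2 * B / Q) / B"
        using B by (simp add: diff_divide_distrib)
      then show ?thesis using B by (simp add: abs_divide)
    qed
    ultimately show ?thesis by simp
  qed
  have "((\<lambda>B. real (residue_count Q r B) / B - 2 / real Q) \<longlongrightarrow> 0) at_top"
  proof (rule tendsto_0_le[where K = 1])
    show "\<forall>\<^sub>F B in at_top. norm (real (residue_count Q r B) / B - 2 / real Q) \<le> norm (1 / B) * 1"
      using eventually_gt_at_top[of 0]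
    proof eventually_elim
      case (elim B)
      then show ?case using bd[OF elim] by simp
    qed
    show "((\<lambda>B::real. 1 / B) \<longlongrightarrow> 0) at_top"
      by (rule tendsto_divide_0[OF tendsto_const filterlim_at_top_imp_at_infinity[OF filterlim_ident]])
  qed
  then show ?thesis by (simp add: LIM_zero_iff)
qed

lemma interval_count: "card (interval B) = residue_count 1 0 B"
  unfolding residue_count_def by simp

lemma residue_ratio_limit:
  assumes Q: "Q > 0" and r: "0 \<le> r" "r < int Q"
  shows "((\<lambda>B. real (residue_count Q r B) / real (card (interval B))) \<longlongrightarrow> 1 / real Q) at_top"
proof -
  have "((\<lambda>B. (real (residue_count Q r B) / B) / (real (card (interval B)) / B)) \<longlongrightarrow> (2 / real Q) / (2 / real 1)) at_top"
    unfolding interval_count by (intro tendsto_divide residue_count_limit Q r) auto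
  then show ?thesis
  proof (rule Lim_transform_eventually[rotated, THEN tendsto_eq_rhs, rotated])
    show "\<forall>\<^sub>F B in at_top. (real (residue_count Q r B) / B) / (real (card (interval B)) / B) =
        real (residue_count Q r B) / real (card (interval B))"
      using eventually_gt_at_top[of 0] by eventually_elim simp
  qed (simp)
qed

lemma finite_monic_box: "finite (monic_box n B)"
  unfolding monic_box_eq by (rule finite_monic_polys) (rule finite_interval)

definition proportion :: "nat \<Rightarrow> (int poly \<Rightarrow> bool) \<Rightarrow> real \<Rightarrow> real" where
  "proportion n P B = real (card {f \<in> monic_box n B. P f}) / real (card (monic_box n B))"

lemma proportion_nonneg: "proportion n P B \<ge> 0"
  by (simp add: proportion_def)

lemma proportion_mono:
  assumes "\<And>f. f \<in> monic_box n B \<Longrightarrow> P f \<Longrightarrow> P' f"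
  shows "proportion n P B \<le> proportion n P' B"
  unfolding proportion_def using assms
  by (intro divide_right_mono of_nat_mono card_mono) (auto simp: finite_monic_box)

lemma proportion_disj: "proportion n (\<lambda>f. P f \<or> P' f) B \<le> proportion n P B + proportion n P' B"
proof -
  have "{f \<in> monic_box n B. P f \<or> P' f} = {f \<in> monic_box n B. P f} \<union> {f \<in> monic_box n B. P' f}" by auto
  then have "card {f \<in> monic_box n B. P f \<or> P' f} \<le> card {f \<in> monic_box n B. P f} + card {f \<in> monic_box n B. P' f}"
    using card_Un_le by metis
  then have "real (card {f \<in> monic_box n B. P f \<or> P' f}) \<le>
      real (card {f \<in> monic_box n B. P f} + card {f \<in> monic_box n B. P' f})" by (rule of_nat_mono)
  then show ?thesis unfolding proportion_def add_divide_distrib[symmetric] by (intro divide_right_mono) auto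
qed

text \<open>The box is the disjoint union of residue classes. Each class is a product over the
  coefficients, and each coefficient contributes the limit share 1/Q.\<close>

lemma periodic_density:
  assumes Q: "Q > 0" and P: "periodic Q P"
  shows "(proportion n P \<longlongrightarrow> real (card {f \<in> residues_n n Q. P f}) / real Q ^ n) at_top"
proof -
  define cls where "cls B g = monic_polys n (\<lambda>j. {z \<in> interval B. z mod int Q = coeff g j})" for B g
  have split: "{f \<in> monic_box n B. P f} = (\<Union>g\<in>{g \<in> residues_n n Q. P g}. cls B g)" for B
  proof safe
    fix f assume f: "f \<in> monic_box n B" "P f"
    define g where "g = of_coeffs n (\<lambda>j. coeff f j mod int Q)"
    have fn: "degree f = n" "coeff f n = 1" using f by (auto simp: monic_box_def)
    have "cong_coeffs Q f g"
      unfolding cong_coeffs_def g_def coeff_of_coeffs using fn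
      by (auto simp: cong_def coeff_eq_0)
    then have "P g" using P f unfolding periodic_def by blast
    moreover have "g \<in> residues_n n Q" unfolding g_def residues_n_def using Q by (intro of_coeffs_in) auto
    moreover have "f \<in> cls B g" using f unfolding cls_def monic_box_eq g_def
      by (auto simp: monic_polys_def coeff_of_coeffs)
    ultimately show "f \<in> (\<Union>g\<in>{g \<in> residues_n n Q. P g}. cls B g)" by blast
  next
    fix f g assume g: "g \<in> residues_n n Q" "P g" and f: "f \<in> cls B g"
    show "f \<in> monic_box n B" using f unfolding cls_def monic_box_eq by (auto simp: monic_polys_def)
    have "cong_coeffs Q f g"
      unfolding cong_coeffs_def
    proof
      fix j
      show "[coeff f j = coeff g j] (mod int Q)"
      proof (cases "j < n")
        case True
        then have "coeff f j mod int Q = coeff g j" "coeff g j \<in> {0..<int Q}"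
          using f g unfolding cls_def residues_n_def monic_polys_def by auto
        then show ?thesis by (simp add: cong_def)
      next
        case False
        then have "coeff f j = coeff g j" using f g unfolding cls_def residues_n_def monic_polys_def
          by (cases "j = n") (auto simp: coeff_eq_0)
        then show ?thesis by simp
      qed
    qed
    then show "P f" using P g unfolding periodic_def by blast
  qed
  have dis: "cls B g \<inter> cls B h = {}" if "g \<in> residues_n n Q" "h \<in> residues_n n Q" "g \<noteq> h" for B g h
  proof (rule ccontr)
    assume "\<not> ?thesis"
    then obtain f where f: "f \<in> cls B g" "f \<in> cls B h" by auto
    have gn: "degree g = n" "lead_coeff g = 1" using that(1) by (auto simp: residues_n_def monic_polys_def)
    have "g = of_coeffs n (coeff h)" using f
      by (intro of_coeffs_eq gn) (auto simp: cls_def monic_polys_def)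
    also have "\<dots> = h" using that(2)
      by (intro of_coeffs_eq[symmetric]) (auto simp: residues_n_def monic_polys_def)
    finally show False using that by simp
  qed
  have ratio: "proportion n P B =
     (\<Sum>g\<in>{g \<in> residues_n n Q. P g}. \<Prod>j<n. real (residue_count Q (coeff g j) B) / real (card (interval B)))" for B
  proof -
    have fc: "finite (cls B g)" for g unfolding cls_def by (rule finite_monic_polys) (simp add: finite_interval)
    have "card {f \<in> monic_box n B. P f} = (\<Sum>g\<in>{g \<in> residues_n n Q. P g}. card (cls B g))"
      unfolding split using dis finite_residues_n fc by (intro card_UN_disjoint) auto
    also have "\<dots> = (\<Sum>g\<in>{g \<in> residues_n n Q. P g}. \<Prod>j<n. residue_count Q (coeff g j) B)"
      unfolding cls_def card_monic_polys residue_count_def ..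
    finally show ?thesis
      by (simp add: proportion_def sum_divide_distrib prod_dividef monic_box_eq card_monic_polys)
  qed
  have "((\<lambda>B. \<Sum>g\<in>{g \<in> residues_n n Q. P g}. \<Prod>j<n. real (residue_count Q (coeff g j) B) / real (card (interval B)))
     \<longlongrightarrow> (\<Sum>g\<in>{g \<in> residues_n n Q. P g}. \<Prod>j<n. 1 / real Q)) at_top"
    by (intro tendsto_sum tendsto_prod residue_ratio_limit Q) (auto simp: residues_n_def monic_polys_def)
  moreover have "(\<Sum>g\<in>{g \<in> residues_n n Q. P g}. \<Prod>j<n. 1 / real Q) = real (card {f \<in> residues_n n Q. P f}) / real Q ^ n"
    by (simp add: power_one_over divide_inverse power_inverse)
  ultimately show ?thesis unfolding ratio[abs_def] by simp
qed

section \<open>Independence of coprime moduli and the sieve\<close>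

lemma cong_coeffs_dvd: "cong_coeffs Q f g \<Longrightarrow> Q' dvd Q \<Longrightarrow> cong_coeffs Q' f g"
proof -
  assume c: "cong_coeffs Q f g" and "Q' dvd Q"
  from this(2) have d: "int Q' dvd int Q" by simp
  show ?thesis unfolding cong_coeffs_def
  proof
    fix j
    have "[coeff f j = coeff g j] (mod int Q)" using c unfolding cong_coeffs_def by blast
    then show "[coeff f j = coeff g j] (mod int Q')" by (rule cong_dvd_modulus[OF _ d])
  qed
qed

lemma ex_residue:
  assumes "Q > 0" "degree f = n" "lead_coeff f = 1"
  obtains g where "g \<in> residues_n n Q" "cong_coeffs Q f g"
proof -
  define g where "g = of_coeffs n (\<lambda>j. coeff f j mod int Q)"
  have "cong_coeffs Q f g"
    unfolding cong_coeffs_def g_def coeff_of_coeffs using assms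
    by (auto simp: cong_def coeff_eq_0)
  moreover have "g \<in> residues_n n Q" unfolding g_def residues_n_def using assms by (intro of_coeffs_in) auto
  ultimately show ?thesis using that by blast
qed

lemma residues_eqI:
  assumes "f \<in> residues_n n Q" "g \<in> residues_n n Q" "cong_coeffs Q f g" shows "f = g"
proof -
  have "f = of_coeffs n (coeff g)"
  proof (rule of_coeffs_eq)
    fix j assume "j < n"
    then have "coeff f j \<in> {0..<int Q}" "coeff g j \<in> {0..<int Q}"
      using assms(1,2) unfolding residues_n_def monic_polys_def by blast+
    moreover have "coeff f j mod int Q = coeff g j mod int Q"
      using assms(3) unfolding cong_coeffs_def cong_def by blast
    ultimately show "coeff f j = coeff g j" by simp
  qed (use assms in \<open>auto simp: residues_n_def monic_polys_def\<close>)
  also have "\<dots> = g" using assms(2)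
    by (intro of_coeffs_eq[symmetric]) (auto simp: residues_n_def monic_polys_def)
  finally show ?thesis .
qed

text \<open>The Chinese remainder theorem for coefficients: reduction to the pair of moduli is
  injective by coprimality, and surjective because both sides have (Q1 Q2)^n elements.\<close>

lemma card_residues_mult:
  assumes cop: "algebraic_semidom_class.coprime Q1 Q2" and Q: "Q1 > 0" "Q2 > 0"
    and P: "periodic Q1 P1" "periodic Q2 P2"
  shows "card {f \<in> residues_n n (Q1 * Q2). P1 f \<and> P2 f} =
    card {f \<in> residues_n n Q1. P1 f} * card {f \<in> residues_n n Q2. P2 f}"
proof -
  define r where "r Q f = (SOME g. g \<in> residues_n n Q \<and> cong_coeffs Q f g)" for Q f
  have r: "r Q f \<in> residues_n n Q \<and> cong_coeffs Q f (r Q f)"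
    if "Q > 0" "f \<in> residues_n n Q'" for Q Q' f
    unfolding r_def
  proof (rule someI_ex)
    have fn: "degree f = n" "lead_coeff f = 1"
      using that(2) unfolding residues_n_def monic_polys_def by auto
    show "\<exists>g. g \<in> residues_n n Q \<and> cong_coeffs Q f g"
      by (rule ex_residue[OF that(1) fn]) blast
  qed
  define h where "h f = (r Q1 f, r Q2 f)" for f
  let ?X = "residues_n n (Q1 * Q2)" and ?Y = "residues_n n Q1 \<times> residues_n n Q2"
  have inj: "inj_on h ?X"
  proof (rule inj_onI)
    fix f g assume fg: "f \<in> ?X" "g \<in> ?X" "h f = h g"
    have "cong_coeffs Q1 f g" "cong_coeffs Q2 f g"
      using r[OF Q(1) fg(1)] r[OF Q(1) fg(2)] r[OF Q(2) fg(1)] r[OF Q(2) fg(2)] fg(3)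
      unfolding h_def cong_coeffs_def by (metis Pair_inject cong_sym cong_trans)+
    then have "cong_coeffs (Q1 * Q2) f g" unfolding cong_coeffs_def
      using cop by (auto simp: cong_iff_dvd_diff intro!: divides_mult)
    then show "f = g" using fg residues_eqI by blast
  qed
  moreover have "h ` ?X \<subseteq> ?Y" using r[OF Q(1)] r[OF Q(2)] unfolding h_def by auto
  ultimately have im: "h ` ?X = ?Y"
    by (intro card_subset_eq)
      (auto simp: finite_residues_n card_image card_cartesian_product card_residues_n power_mult_distrib)
  have PP: "P1 f = P1 (r Q1 f)" "P2 f = P2 (r Q2 f)" if "f \<in> ?X" for f
    using r[OF Q(1) that] r[OF Q(2) that] P unfolding periodic_def by blast+
  have him: "h ` {f \<in> ?X. P1 f \<and> P2 f} = {f \<in> residues_n n Q1. P1 f} \<times> {f \<in> residues_n n Q2. P2 f}"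
  proof (intro equalityI subsetI)
    fix x assume "x \<in> h ` {f \<in> ?X. P1 f \<and> P2 f}"
    then obtain f where f: "f \<in> ?X" "P1 f" "P2 f" "x = h f" by auto
    then show "x \<in> {f \<in> residues_n n Q1. P1 f} \<times> {f \<in> residues_n n Q2. P2 f}"
      using PP[OF f(1)] r[OF Q(1) f(1)] r[OF Q(2) f(1)] unfolding h_def by simp
  next
    fix x assume "x \<in> {f \<in> residues_n n Q1. P1 f} \<times> {f \<in> residues_n n Q2. P2 f}"
    then have x: "x \<in> ?Y" "P1 (fst x)" "P2 (snd x)" by auto
    from x(1) have "x \<in> h ` ?X" by (simp only: im)
    then obtain f where f: "f \<in> ?X" "x = h f" by blast
    then have "P1 f \<and> P2 f" using PP[OF f(1)] x(2,3) unfolding h_def by simp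
    then show "x \<in> h ` {f \<in> ?X. P1 f \<and> P2 f}" using f by blast
  qed
  have "inj_on h {f \<in> ?X. P1 f \<and> P2 f}" using inj by (rule inj_on_subset) auto
  from card_image[OF this] show ?thesis unfolding him card_cartesian_product by (rule sym)
qed

lemma card_residues_primes:
  assumes "finite A" "\<And>q. q \<in> A \<Longrightarrow> prime q" "\<And>q. q \<in> A \<Longrightarrow> periodic q (P q)"
  shows "card {f \<in> residues_n n (\<Prod>A). \<forall>q\<in>A. P q f} = (\<Prod>q\<in>A. card {f \<in> residues_n n q. P q f}) \<and>
    periodic (\<Prod>A) (\<lambda>f. \<forall>q\<in>A. P q f)"
  using assms
proof (induction A rule: finite_induct)
  case empty
  then show ?case by (simp add: card_residues_n periodic_def)
next
  case (insert q A)
  have pr: "prime q" "\<And>q'. q' \<in> A \<Longrightarrow> prime q'" using insert by auto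
  have cop: "algebraic_semidom_class.coprime q (\<Prod>A)"
    using insert pr primes_coprime[OF pr(1)] by (intro prod_coprime_right) metis
  have pos: "q > 0" "\<Prod>A > 0" using pr prime_gt_0_nat by (auto intro!: prod_pos)
  have "{f \<in> residues_n n (\<Prod>(insert q A)). \<forall>q\<in>insert q A. P q f} =
      {f \<in> residues_n n (q * \<Prod>A). P q f \<and> (\<forall>q\<in>A. P q f)}" using insert by auto
  then have "card {f \<in> residues_n n (\<Prod>(insert q A)). \<forall>q\<in>insert q A. P q f} =
      card {f \<in> residues_n n q. P q f} * card {f \<in> residues_n n (\<Prod>A). \<forall>q\<in>A. P q f}"
    using card_residues_mult[OF cop pos] insert by simp
  moreover have "periodic (\<Prod>(insert q A)) (\<lambda>f. \<forall>q\<in>insert q A. P q f)"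
    unfolding periodic_def
  proof (intro allI impI)
    fix f g assume "cong_coeffs (\<Prod>(insert q A)) f g"
    then have "cong_coeffs q f g" "cong_coeffs (\<Prod>A) f g"
      using insert(1,2) cong_coeffs_dvd[of _ f g q] cong_coeffs_dvd[of _ f g "\<Prod>A"] by auto
    moreover have "periodic q (P q)" "periodic (\<Prod>A) (\<lambda>f. \<forall>q\<in>A. P q f)" using insert by simp_all
    ultimately have "P q f = P q g" "(\<forall>q\<in>A. P q f) = (\<forall>q\<in>A. P q g)"
      unfolding periodic_def by simp_all
    then show "(\<forall>q\<in>insert q A. P q f) = (\<forall>q\<in>insert q A. P q g)" by simp
  qed
  ultimately show ?case using insert by simp
qed

text \<open>For k primes the polynomials that avoid \<open>T\<close> at all of them have density at
  most (1 - \<delta>')^k, where \<delta>' is the smaller of \<delta> and 1. Each \<epsilon> needs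
  only finitely many primes, hence a single modulus, so no estimate uniform in the modulus is
  involved.\<close>

lemma sieve_density_zero:
  fixes T :: "nat \<Rightarrow> int poly \<Rightarrow> bool" and \<delta> :: real
  assumes T: "\<And>q. prime q \<Longrightarrow> periodic q (T q)" and \<delta>: "\<delta> > 0"
    and low: "\<And>q. prime q \<Longrightarrow> q \<ge> q0 \<Longrightarrow> real (card {f \<in> residues_n n q. T q f}) \<ge> \<delta> * real q ^ n"
  shows "(proportion n (\<lambda>f. \<forall>q. prime q \<longrightarrow> q \<ge> q0 \<longrightarrow> \<not> T q f) \<longlongrightarrow> 0) at_top"
proof (rule tendstoI)
  fix \<epsilon> :: real assume \<epsilon>: "\<epsilon> > 0"
  define \<delta>' where "\<delta>' = min \<delta> 1"
  have d': "0 < \<delta>'" "\<delta>' \<le> 1" "\<delta>' \<le> \<delta>" using \<delta> unfolding \<delta>'_def by simp_all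
  obtain k where k: "(1 - \<delta>') ^ k < \<epsilon>" using real_arch_pow_inv[OF \<epsilon>, of "1 - \<delta>'"] d' by auto
  have "infinite {q::nat. prime q \<and> q \<ge> q0}"
  proof
    assume "finite {q::nat. prime q \<and> q \<ge> q0}"
    moreover have "{q::nat. prime q} \<subseteq> {q. prime q \<and> q \<ge> q0} \<union> {..<q0}" by auto
    ultimately show False using primes_infinite by (meson finite_UnI finite_lessThan finite_subset)
  qed
  then obtain A where A: "finite A" "card A = k" "A \<subseteq> {q. prime q \<and> q \<ge> q0}"
    using infinite_arbitrarily_large by blast
  have per: "periodic q (\<lambda>f. \<not> T q f)" if "q \<in> A" for q using T A that unfolding periodic_def by blast
  have *: "card {f \<in> residues_n n (\<Prod>A). \<forall>q\<in>A. \<not> T q f} = (\<Prod>q\<in>A. card {f \<in> residues_n n q. \<not> T q f})"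
    "periodic (\<Prod>A) (\<lambda>f. \<forall>q\<in>A. \<not> T q f)"
    using card_residues_primes[of A "\<lambda>q f. \<not> T q f" n] A per by auto
  have pos: "\<Prod>A > 0" using A prime_gt_0_nat by (auto intro!: prod_pos)
  define \<alpha> where "\<alpha> = real (card {f \<in> residues_n n (\<Prod>A). \<forall>q\<in>A. \<not> T q f}) / real (\<Prod>A) ^ n"
  have lim: "(proportion n (\<lambda>f. \<forall>q\<in>A. \<not> T q f) \<longlongrightarrow> \<alpha>) at_top"
    unfolding \<alpha>_def by (rule periodic_density[OF pos *(2)])
  have "\<alpha> = (\<Prod>q\<in>A. real (card {f \<in> residues_n n q. \<not> T q f}) / real q ^ n)"
    unfolding \<alpha>_def *(1) by (simp add: prod_dividef prod_power_distrib)
  also have "\<dots> \<le> (\<Prod>q\<in>A. 1 - \<delta>')"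
  proof (intro prod_mono conjI)
    fix q assume q: "q \<in> A"
    then have pq: "prime q" "q \<ge> q0" using A by auto
    have q0: "real q ^ n > 0" using prime_gt_0_nat[OF pq(1)] by simp
    have "{f \<in> residues_n n q. \<not> T q f} = residues_n n q - {f \<in> residues_n n q. T q f}" by auto
    moreover have "card {f \<in> residues_n n q. T q f} \<le> q ^ n"
      using card_mono[OF finite_residues_n, of "{f \<in> residues_n n q. T q f}" n q] card_residues_n by auto
    ultimately have "card {f \<in> residues_n n q. \<not> T q f} + card {f \<in> residues_n n q. T q f} = q ^ n"
      using finite_residues_n[of n q] card_residues_n[of n q] by (simp add: card_Diff_subset)
    then have "real (card {f \<in> residues_n n q. \<not> T q f}) + real (card {f \<in> residues_n n q. T q f}) = real q ^ n"
      by (metis of_nat_add of_nat_power)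
    then have "real (card {f \<in> residues_n n q. \<not> T q f}) \<le> (1 - \<delta>) * real q ^ n"
      using low[OF pq] by (simp add: algebra_simps)
    also have "\<dots> \<le> (1 - \<delta>') * real q ^ n" using d' by (intro mult_right_mono) auto
    finally show "real (card {f \<in> residues_n n q. \<not> T q f}) / real q ^ n \<le> 1 - \<delta>'"
      using q0 by (simp add: pos_divide_le_eq)
  qed auto
  also have "\<dots> = (1 - \<delta>') ^ k" using A by simp
  finally have "\<alpha> < \<epsilon>" using k by simp
  from order_tendstoD(2)[OF lim this]
  show "\<forall>\<^sub>F B in at_top. dist (proportion n (\<lambda>f. \<forall>q. prime q \<longrightarrow> q \<ge> q0 \<longrightarrow> \<not> T q f) B) 0 < \<epsilon>"
  proof eventually_elim
    case (elim B)
    have "proportion n (\<lambda>f. \<forall>q. prime q \<longrightarrow> q \<ge> q0 \<longrightarrow> \<not> T q f) B \<le> proportion n (\<lambda>f. \<forall>q\<in>A. \<not> T q f) B"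
      using A by (intro proportion_mono) auto
    then show ?case using elim proportion_nonneg by (simp add: dist_norm)
  qed
qed

subsection \<open>Generic polynomials\<close>

text \<open>The condition on the factors is a parameter so that one bijection,
  \<open>card_separable_with\<close>, counts both all separable polynomials and those of a given
  type.\<close>

definition separable_with :: "(int poly multiset \<Rightarrow> bool) \<Rightarrow> nat \<Rightarrow> int poly \<Rightarrow> bool" where
  "separable_with C q f \<longleftrightarrow> (\<exists>fs. set_mset fs \<subseteq> poly_mod_prime.irr_m (int q) \<and>
     poly_mod.eq_m (int q) f (prod_mset fs) \<and> (\<forall>g. count fs g \<le> 1) \<and> C fs)"

abbreviation separable_mod :: "nat \<Rightarrow> int poly \<Rightarrow> bool" where
  "separable_mod \<equiv> separable_with (\<lambda>_. True)"

abbreviation separable_type :: "nat \<Rightarrow> nat multiset \<Rightarrow> int poly \<Rightarrow> bool" where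
  "separable_type q \<mu> \<equiv> separable_with (\<lambda>fs. image_mset degree fs = \<mu>) q"

lemma poly_mod_primeI: "prime q \<Longrightarrow> poly_mod_prime (int q)"
  by unfold_locales simp

lemma cong_coeffs_Mp: "cong_coeffs q f g \<longleftrightarrow> poly_mod.eq_m (int q) f g"
  unfolding cong_coeffs_def poly_eq_iff poly_mod.Mp_coeff poly_mod.M_def cong_def ..

lemma periodic_separable: "periodic q (separable_with C q)"
  unfolding periodic_def cong_coeffs_Mp separable_with_def by simp

lemma residues_n_iff:
  assumes "prime q"
  shows "f \<in> residues_n n q \<longleftrightarrow> degree f = n \<and> monic f \<and> poly_mod.Mp (int q) f = f"
proof -
  interpret poly_mod_prime "int q" by (rule poly_mod_primeI[OF assms])
  show ?thesis
  proof (cases "degree f = n \<and> monic f")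
    case True
    have "(\<forall>j<n. coeff f j \<in> {0..<int q}) \<longleftrightarrow> (\<forall>j. coeff f j \<in> {0..<int q})"
    proof (intro iffI allI)
      fix j assume a: "\<forall>j<n. coeff f j \<in> {0..<int q}"
      consider "j < n" | "j = n" | "j > n" by linarith
      then show "coeff f j \<in> {0..<int q}"
      proof cases
        case 3
        then show ?thesis using True m1 by (simp add: coeff_eq_0)
      qed (use a True m1 in auto)
    qed auto
    then show ?thesis using True Mp_ident_iff[of f] unfolding residues_n_def monic_polys_def by simp
  next
    case False
    then show ?thesis unfolding residues_n_def monic_polys_def by auto
  qed
qed

lemma bij_residues:
  assumes "prime q"
  shows "bij_betw (\<lambda>fs. poly_mod.Mp (int q) (prod_mset fs))
    {fs. set_mset fs \<subseteq> poly_mod_prime.irr_m (int q) \<and> sum_mset (image_mset degree fs) = n}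
    (residues_n n q)"
proof -
  interpret poly_mod_prime "int q" by (rule poly_mod_primeI[OF assms])
  show ?thesis
    unfolding bij_betw_def
  proof
    show "inj_on (\<lambda>fs. Mp (prod_mset fs)) {fs. set_mset fs \<subseteq> irr_m \<and> sum_mset (image_mset degree fs) = n}"
      by (intro inj_onI) (auto intro: irr_factorization_unique)
    show "(\<lambda>fs. Mp (prod_mset fs)) ` {fs. set_mset fs \<subseteq> irr_m \<and> sum_mset (image_mset degree fs) = n} = residues_n n q"
    proof (intro equalityI subsetI)
      fix f assume "f \<in> (\<lambda>fs. Mp (prod_mset fs)) ` {fs. set_mset fs \<subseteq> irr_m \<and> sum_mset (image_mset degree fs) = n}"
      then obtain fs where fs: "set_mset fs \<subseteq> irr_m" "sum_mset (image_mset degree fs) = n" "f = Mp (prod_mset fs)" by auto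
      show "f \<in> residues_n n q"
        unfolding residues_n_iff[OF assms]
        using degree_prod_irr[OF fs(1)] fs monic_degree_m[OF monic_prod_irr[OF fs(1)]]
          monic_Mp[OF monic_prod_irr[OF fs(1)]] by simp
    next
      fix f assume "f \<in> residues_n n q"
      then have f: "degree f = n" "monic f" "Mp f = f" unfolding residues_n_iff[OF assms] by auto
      obtain fs where fs: "set_mset fs \<subseteq> irr_m" "f =m prod_mset fs"
        using irr_factorization_exists[OF f(2)] by blast
      have "degree (prod_mset fs) = n"
        using fs(2) f monic_degree_m[OF f(2)] monic_degree_m[OF monic_prod_irr[OF fs(1)]] by simp
      then have "sum_mset (image_mset degree fs) = n" using degree_prod_irr[OF fs(1)] by simp
      then show "f \<in> (\<lambda>fs. Mp (prod_mset fs)) ` {fs. set_mset fs \<subseteq> irr_m \<and> sum_mset (image_mset degree fs) = n}"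
        using fs f(3) by (intro image_eqI[of _ _ fs]) auto
    qed
  qed
qed

lemma graded_primes_irr:
  assumes "prime q" shows "graded_primes (poly_mod_prime.irr_m (int q)) degree q"
proof
  interpret poly_mod_prime "int q" by (rule poly_mod_primeI[OF assms])
  show "\<And>g. g \<in> irr_m \<Longrightarrow> degree g > 0" by (rule irr_mD(4))
  show "q \<ge> 2" by (rule prime_ge_2_nat[OF assms])
  show "\<And>n. card {fs. set_mset fs \<subseteq> irr_m \<and> sum_mset (image_mset degree fs) = n} = q ^ n"
    using bij_betw_same_card[OF bij_residues[OF assms]] card_residues_n by simp
qed

lemma card_separable_with:
  assumes q: "prime q"
    and X: "\<X> = {A. finite A \<and> A \<subseteq> poly_mod_prime.irr_m (int q) \<and> C (mset_set A)}"
    and C: "\<And>fs. C fs \<Longrightarrow> sum_mset (image_mset degree fs) = n"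
  shows "card {f \<in> residues_n n q. separable_with C q f} = card \<X>"
proof -
  interpret poly_mod_prime "int q" by (rule poly_mod_primeI[OF q])
  define b where "b = (\<lambda>fs. Mp (prod_mset fs))"
  define W where "W = {fs. set_mset fs \<subseteq> irr_m \<and> sum_mset (image_mset degree fs) = n}"
  have b: "bij_betw b W (residues_n n q)" unfolding b_def W_def by (rule bij_residues[OF q])
  have sub: "mset_set ` \<X> \<subseteq> W" unfolding X W_def using C by auto
  have inj: "inj_on (b \<circ> mset_set) \<X>"
  proof (rule comp_inj_on)
    show "inj_on mset_set \<X>" unfolding X
      by (intro inj_onI) (metis (mono_tags, lifting) finite_set_mset_mset_set mem_Collect_eq)
    show "inj_on b (mset_set ` \<X>)" using bij_betw_imp_inj_on[OF b] sub by (rule inj_on_subset)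
  qed
  have "{f \<in> residues_n n q. separable_with C q f}
      = (b \<circ> mset_set) ` \<X>"
  proof (intro equalityI subsetI)
    fix f assume "f \<in> {f \<in> residues_n n q. separable_with C q f}"
    then obtain fs where f: "f \<in> residues_n n q" and fs: "set_mset fs \<subseteq> irr_m" "f =m prod_mset fs"
      "\<forall>g. count fs g \<le> 1" "C fs" unfolding separable_with_def by blast
    have eq: "mset_set (set_mset fs) = fs"
    proof (rule multiset_eqI)
      fix g show "count (mset_set (set_mset fs)) g = count fs g"
        using fs(3)[rule_format, of g] by (cases "g \<in># fs") (auto simp: count_greater_zero_iff[symmetric] not_in_iff simp del: count_greater_zero_iff)
    qed
    have "set_mset fs \<in> \<X>" unfolding X using fs eq by simp
    moreover have "f = (b \<circ> mset_set) (set_mset fs)"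
      using f fs(2) eq unfolding residues_n_iff[OF q] b_def by simp
    ultimately show "f \<in> (b \<circ> mset_set) ` \<X>" by blast
  next
    fix f assume "f \<in> (b \<circ> mset_set) ` \<X>"
    then obtain A where A: "A \<in> \<X>" "f = b (mset_set A)" by auto
    have A': "finite A" "A \<subseteq> irr_m" "C (mset_set A)" using A unfolding X by auto
    have "f \<in> residues_n n q" using A sub bij_betwE[OF b] by blast
    moreover have "f =m prod_mset (mset_set A)" using A(2) unfolding b_def by simp
    moreover have "\<forall>g. count (mset_set A) g \<le> 1" by (simp add: count_mset_set')
    ultimately show "f \<in> {f \<in> residues_n n q. separable_with C q f}"
      unfolding separable_with_def using A' by (intro CollectI conjI exI[of _ "mset_set A"]) auto
  qed
  then show ?thesis using card_image[OF inj] by simp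
qed

lemma card_separable_mod:
  assumes q: "prime q" and n: "n \<ge> 2"
  shows "card {f \<in> residues_n n q. separable_mod q f} = q ^ n - q ^ (n - 1)"
proof -
  interpret gp: graded_primes "poly_mod_prime.irr_m (int q)" degree q by (rule graded_primes_irr[OF q])
  interpret poly_mod_prime "int q" by (rule poly_mod_primeI[OF q])
  \<comment> \<open>\<open>card_separable_with\<close> demands a condition that fixes the total
    degree; for members of \<open>residues_n n q\<close> that is automatic.\<close>
  have iff: "separable_mod q f \<longleftrightarrow> separable_with (\<lambda>fs. sum_mset (image_mset degree fs) = n) q f"
    if f: "f \<in> residues_n n q" for f
  proof -
    have "sum_mset (image_mset degree fs) = n" if fs: "set_mset fs \<subseteq> irr_m" "f =m prod_mset fs" for fs
      using f fs(2) monic_degree_m[of f] monic_degree_m[OF monic_prod_irr[OF fs(1)]] degree_prod_irr[OF fs(1)]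
      unfolding residues_n_iff[OF q] by simp
    then show ?thesis unfolding separable_with_def by blast
  qed
  have "{f \<in> residues_n n q. separable_mod q f} =
      {f \<in> residues_n n q. separable_with (\<lambda>fs. sum_mset (image_mset degree fs) = n) q f}"
    using iff by blast
  also have "card \<dots> = card (gp.sets_of_degree n)"
    by (rule card_separable_with[OF q]) (auto simp: gp.sets_of_degree_def gp.sum_mset_set)
  also have "\<dots> = q ^ n - q ^ (n - 1)" by (rule gp.card_sets_of_degree[OF n])
  finally show ?thesis .
qed

lemma card_separable_type:
  assumes q: "prime q" and \<mu>: "is_partition_of \<mu> n"
  shows "card {f \<in> residues_n n q. separable_type q \<mu> f} =
    card (graded_primes.sets_of_type (poly_mod_prime.irr_m (int q)) degree \<mu>)"
proof -
  interpret gp: graded_primes "poly_mod_prime.irr_m (int q)" degree q by (rule graded_primes_irr[OF q])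
  show ?thesis
    by (rule card_separable_with[OF q]) (use \<mu> in \<open>auto simp: gp.sets_of_type_def is_partition_of_def\<close>)
qed

lemma coprime_discriminant_separable:
  assumes p: "prime p" and f: "monic f" "degree f > 0"
  shows "gcd (discriminant f) (int p) = 1 \<longleftrightarrow> separable_mod p f"
proof -
  interpret poly_mod_prime "int p" by (rule poly_mod_primeI[OF p])
  show ?thesis
    unfolding coprime_discriminant_iff[OF f] separable_with_def
    using separable_iff[OF f(1)] irr_factorization_exists[OF f(1)] by blast
qed

text \<open>The factors in \<open>has_splitting_type\<close> need not be reduced. Applying
  \<open>Mp\<close> brings them into \<open>irr_m\<close>, where uniqueness identifies them with the
  distinct factors.\<close>

lemma separable_splitting_type:
  assumes p: "prime p" and f: "monic f"
  shows "separable_mod p f \<and> has_splitting_type p f \<mu> \<longleftrightarrow> separable_type p \<mu> f"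
proof -
  interpret poly_mod_prime "int p" by (rule poly_mod_primeI[OF p])
  show ?thesis
  proof
    assume "separable_type p \<mu> f"
    then obtain fs where fs: "set_mset fs \<subseteq> irr_m" "f =m prod_mset fs" "\<forall>g. count fs g \<le> 1"
      "image_mset degree fs = \<mu>" unfolding separable_with_def by blast
    have "factorization_m f (1, fs)" unfolding factorization_m_def using fs irr_mD by auto
    moreover have "image_mset (\<lambda>g. degree (Mp g)) fs = \<mu>"
      unfolding fs(4)[symmetric] using fs(1) by (intro image_mset_cong) (auto simp: irr_mD(3))
    ultimately show "separable_mod p f \<and> has_splitting_type p f \<mu>"
      using fs unfolding separable_with_def has_splitting_type_def by blast
  next
    assume a: "separable_mod p f \<and> has_splitting_type p f \<mu>"
    then obtain fs where fs: "set_mset fs \<subseteq> irr_m" "f =m prod_mset fs" "\<forall>g. count fs g \<le> 1"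
      unfolding separable_with_def by blast
    from a obtain gs where gs: "factorization_m f (1, gs)" "image_mset (\<lambda>g. degree (Mp g)) gs = \<mu>"
      unfolding has_splitting_type_def by blast
    have "set_mset (image_mset Mp gs) \<subseteq> irr_m"
      using gs(1) unfolding factorization_m_def irr_m_def by auto
    moreover have "f =m prod_mset (image_mset Mp gs)"
      using gs(1) Mp_prod_mset[of gs] unfolding factorization_m_def by simp
    ultimately have "fs = image_mset Mp gs" using fs by (intro irr_factorization_unique) auto
    then have "image_mset degree fs = \<mu>" using gs(2) by (simp add: multiset.map_comp comp_def)
    then show "separable_type p \<mu> f" using fs unfolding separable_with_def by blast
  qed
qed

section \<open>From splitting types to irreducibility and the full symmetric group\<close>

context root_set
begin

lemma ex_prime_above:
  assumes f: "of_int_poly f = (\<Prod>s\<in>S. [:- s, 1:])" and q: "prime q" and t: "separable_type q \<mu> f"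
  obtains J u v w fs where "prime_above S q J f u v w" "set_mset fs \<subseteq> poly_mod_prime.irr_m (int q)"
    "poly_mod.eq_m (int q) f (prod_mset fs)" "image_mset degree fs = \<mu>"
proof -
  interpret poly_mod_prime "int q" by (rule poly_mod_primeI[OF q])
  obtain fs where fs: "set_mset fs \<subseteq> irr_m" "f =m prod_mset fs" "\<forall>g. count fs g \<le> 1" "image_mset degree fs = \<mu>"
    using t unfolding separable_with_def by blast
  have "lead_coeff f = 1"
    using arg_cong[OF f, of lead_coeff] by (simp add: lead_coeff_prod)
  then obtain u v w where uvw: "u * f + v * pderiv f = 1 + smult (int q) w"
    using separable_iff[OF _ fs(1,2)] fs(3) by blast
  obtain J where J: "is_ideal J" "of_nat q \<in> J" "1 \<notin> J"
    "\<And>x y. x \<in> R \<Longrightarrow> y \<in> R \<Longrightarrow> x * y \<in> J \<Longrightarrow> x \<in> J \<or> y \<in> J"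
    using ex_prime_ideal[OF prime_ge_2_nat[OF q]] by metis
  have "prime_above S q J f u v w"
    by unfold_locales (use q J f uvw in auto)
  then show ?thesis using that fs by blast
qed

lemma G_full_if_types:
  assumes f: "of_int_poly f = (\<Prod>s\<in>S. [:- s, 1:])"
    and q: "prime q1" "prime q2" "prime q3"
    and big: "q1 > card S * fact (card S)" "q2 > card S * fact (card S)" "q3 > card S * fact (card S)"
    and t: "separable_type q1 {#card S#} f" "separable_type q2 {#1, card S - 1#} f"
      "separable_type q3 (add_mset 2 (replicate_mset (card S - 2) 1)) f"
  shows "\<And>s t. s \<in> S \<Longrightarrow> t \<in> S \<Longrightarrow> \<exists>\<pi>\<in>G. \<pi> s = t" "\<And>\<pi>. \<pi> permutes S \<Longrightarrow> \<pi> \<in> G"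
proof -
  obtain J u v w fs where 1: "prime_above S q1 J f u v w" "set_mset fs \<subseteq> poly_mod_prime.irr_m (int q1)"
    "poly_mod.eq_m (int q1) f (prod_mset fs)" "image_mset degree fs = {#card S#}"
    using ex_prime_above[OF f q(1) t(1)] by metis
  interpret p1: prime_above S q1 J f u v w by (rule 1)
  show trans: "\<exists>\<pi>\<in>G. \<pi> s = t" if "s \<in> S" "t \<in> S" for s t
    using p1.type_full[OF 1(2-4) that] G_funpow[OF p1.\<phi>_in_G[OF big(1)]] by metis
  obtain J2 u2 v2 w2 fs2 where 2: "prime_above S q2 J2 f u2 v2 w2" "set_mset fs2 \<subseteq> poly_mod_prime.irr_m (int q2)"
    "poly_mod.eq_m (int q2) f (prod_mset fs2)" "image_mset degree fs2 = {#1, card S - 1#}"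
    using ex_prime_above[OF f q(2) t(2)] by metis
  interpret p2: prime_above S q2 J2 f u2 v2 w2 by (rule 2)
  from p2.type_point_stabilizer[OF 2(2-4)] obtain s0 where s0: "s0 \<in> S" "p2.\<phi> s0 = s0"
    "\<forall>s\<in>S - {s0}. \<forall>t\<in>S - {s0}. \<exists>k. (p2.\<phi> ^^ k) s = t" by blast
  have fix0: "(p2.\<phi> ^^ k) s0 = s0" for k by (induction k) (auto simp: s0)
  have stab: "\<exists>\<pi>\<in>G. \<pi> s0 = s0 \<and> \<pi> s = t" if "s \<in> S - {s0}" "t \<in> S - {s0}" for s t
    using s0(3) that G_funpow[OF p2.\<phi>_in_G[OF big(2)]] fix0 by metis
  obtain J3 u3 v3 w3 fs3 where 3: "prime_above S q3 J3 f u3 v3 w3" "set_mset fs3 \<subseteq> poly_mod_prime.irr_m (int q3)"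
    "poly_mod.eq_m (int q3) f (prod_mset fs3)" "image_mset degree fs3 = add_mset 2 (replicate_mset (card S - 2) 1)"
    using ex_prime_above[OF f q(3) t(3)] by metis
  interpret p3: prime_above S q3 J3 f u3 v3 w3 by (rule 3)
  from p3.type_transposition[OF 3(2-4)] obtain a b where ab: "a \<in> S" "b \<in> S" "a \<noteq> b"
    "p3.\<phi> = Transposition.transpose a b" by blast
  have "Transposition.transpose a b \<in> G" using p3.\<phi>_in_G[OF big(3)] ab(4) by simp
  then show "\<And>\<pi>. \<pi> permutes S \<Longrightarrow> \<pi> \<in> G" using G_full[OF trans s0(1) stab ab(1-3)] by blast
qed

lemma ext_poly:
  assumes \<pi>: "\<pi> \<in> G" and s: "s \<in> S"
  shows "poly (map_poly of_rat a) s \<in> K" (is ?A)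
    and "ext \<pi> (poly (map_poly of_rat a) s) = poly (map_poly of_rat a) (\<pi> s)" (is ?B)
proof -
  have "?A \<and> ?B"
  proof (induction a)
    case 0
    then show ?case using ext_Rats[OF \<pi>, of 0] K_Rats[of 0] by simp
  next
    case (pCons c a)
    have e: "poly (map_poly of_rat (pCons c a)) y = of_rat c + y * poly (map_poly of_rat a) y" for y :: complex
      using pCons(1) by (simp add: map_poly_pCons)
    have c: "(of_rat c :: complex) \<in> \<rat>" by simp
    have sK: "s * poly (map_poly of_rat a) s \<in> K" using pCons K_S[OF s] by (intro K_mult) auto
    have "ext \<pi> (of_rat c + s * poly (map_poly of_rat a) s) = of_rat c + \<pi> s * poly (map_poly of_rat a) (\<pi> s)"
      using pCons ext_add_mult(1)[OF \<pi> K_Rats[OF c] sK] ext_add_mult(2)[OF \<pi> K_S[OF s]] ext_S[OF \<pi> s] ext_Rats[OF \<pi> c]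
      by simp
    then show ?case unfolding e using K_add[OF K_Rats[OF c] sK] by simp
  qed
  then show ?A ?B by auto
qed

text \<open>A rational factor of positive degree vanishes at some root, hence by \<open>ext\<close>
  at every conjugate of it, that is, on all of \<open>S\<close>; so it has full degree.\<close>

lemma irreducible_if_transitive:
  assumes f: "of_int_poly f = (\<Prod>s\<in>S. [:- s, 1:])" and n: "card S \<ge> 2"
    and trans: "\<And>s t. s \<in> S \<Longrightarrow> t \<in> S \<Longrightarrow> \<exists>\<pi>\<in>G. \<pi> s = t"
  shows "irreducible (map_poly rat_of_int f)"
proof -
  let ?f = "map_poly rat_of_int f"
  have fC: "map_poly of_rat ?f = (of_int_poly f :: complex poly)"
    by (rule poly_eqI) (simp add: coeff_map_poly)
  have df: "degree ?f = card S"
    using arg_cong[OF f, of degree] by (simp add: degree_prod_eq_sum_degree)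
  have *: "degree b = 0" if ab: "?f = a * b" "degree a > 0" for a b
  proof -
    have nz: "a \<noteq> 0" "b \<noteq> 0" using ab df n by auto
    let ?a = "map_poly of_rat a :: complex poly"
    have fab: "of_int_poly f = ?a * map_poly of_rat b"
      unfolding fC[symmetric] ab(1)
      by (rule poly_eqI) (simp add: coeff_map_poly coeff_mult of_rat_sum of_rat_mult)
    have "\<not> constant (poly ?a)" using ab(2) by (simp add: constant_degree)
    then obtain s where s: "poly ?a s = 0" using fundamental_theorem_of_algebra by blast
    then have "poly (of_int_poly f) s = 0" unfolding fab by simp
    then have sS: "s \<in> S" unfolding f using fin_S by (auto simp: poly_prod)
    have "poly ?a t = 0" if t: "t \<in> S" for t
    proof -
      obtain \<pi> where \<pi>: "\<pi> \<in> G" "\<pi> s = t" using trans[OF sS t] by blast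
      show ?thesis using ext_poly(2)[OF \<pi>(1) sS, of a] \<pi>(2) s ext_Rats[OF \<pi>(1), of 0] by simp
    qed
    then have "S \<subseteq> {x. poly ?a x = 0}" by auto
    then have "card S \<le> card {x. poly ?a x = 0}" using nz by (intro card_mono poly_roots_finite) auto
    also have "\<dots> \<le> degree ?a" using nz by (intro card_poly_roots_bound) auto
    finally have "card S \<le> degree a" by simp
    moreover have "card S = degree a + degree b" using df ab(1) nz by (simp add: degree_mult_eq)
    ultimately show ?thesis by simp
  qed
  show ?thesis
  proof (rule irreducibleI)
    show "?f \<noteq> 0" using df n by auto
    show "\<not> ?f dvd 1" using df n by (auto simp: poly_dvd_1)
    fix a b assume ab: "?f = a * b"
    then have nz: "a \<noteq> 0" "b \<noteq> 0" using df n by auto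
    have "degree a = 0 \<or> degree b = 0" using *[OF ab] by (cases "degree a = 0") simp_all
    then show "a dvd 1 \<or> b dvd 1" using nz by (auto simp: is_unit_iff_degree)
  qed
qed

end

text \<open>Separability modulo a single prime makes the resultant of \<open>f\<close> and its
  derivative a nonzero integer. So the complex roots are simple, and \<open>f\<close> is the product
  of linear factors over a set \<open>S\<close>, as the locale arguments presuppose.\<close>

lemma generic_if_types:
  fixes f :: "int poly"
  assumes f: "monic f" "degree f = n" and n: "n \<ge> 2"
    and q: "prime q1" "prime q2" "prime q3"
    and big: "q1 > n * fact n" "q2 > n * fact n" "q3 > n * fact n"
    and t: "separable_type q1 {#n#} f" "separable_type q2 {#1, n - 1#} f"
      "separable_type q3 (add_mset 2 (replicate_mset (n - 2) 1)) f"
  shows "irreducible (map_poly rat_of_int f)"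
    and "galois_group (splitting_field (map_poly rat_of_int f)) \<rat> \<cong> sym_group n"
proof -
  interpret poly_mod_prime "int q1" by (rule poly_mod_primeI[OF q(1)])
  have d0: "degree f > 0" using f n by simp
  have "separable_mod q1 f" using t(1) unfolding separable_with_def by blast
  then obtain u v w where "u * f + v * pderiv f = 1 + smult (int q1) w"
    unfolding coprime_discriminant_separable[OF q(1) f(1) d0, symmetric] coprime_discriminant_iff[OF f(1) d0] by blast
  then have "\<not> int q1 dvd resultant f (pderiv f)" by (rule resultant_not_dvd_if[OF f(1)])
  then have r0: "resultant f (pderiv f) \<noteq> 0" by auto
  obtain a b where ab: "[:resultant f (pderiv f):] = a * f + b * pderiv f"
    using resultant_combination[of f "pderiv f"] d0 by auto
  let ?F = "of_int_poly f :: complex poly"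
  have "rsquarefree ?F"
    unfolding rsquarefree_roots
  proof (intro allI notI)
    fix z assume z: "poly ?F z = 0 \<and> poly (pderiv ?F) z = 0"
    have "poly (of_int_poly [:resultant f (pderiv f):]) z = poly (of_int_poly (a * f + b * pderiv f)) z"
      using ab by simp
    moreover have "poly (of_int_poly [:resultant f (pderiv f):]) z = of_int (resultant f (pderiv f))"
      using r0 by (simp add: map_poly_pCons)
    ultimately have "of_int (resultant f (pderiv f)) = poly (of_int_poly a) z * poly ?F z + poly (of_int_poly b) z * poly (pderiv ?F) z"
      by (simp add: of_int_hom.map_poly_hom_add of_int_poly_hom.hom_mult of_int_hom.map_poly_pderiv)
    then show False using z r0 by simp
  qed
  from complex_poly_decompose_rsquarefree[OF this] f
  have fS: "?F = (\<Prod>s\<in>{z. poly ?F z = 0}. [:- s, 1:])" by simp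
  define S where "S = {z. poly ?F z = 0}"
  have F0: "?F \<noteq> 0" using f by auto
  have fin: "finite S" unfolding S_def by (rule poly_roots_finite[OF F0])
  have fS': "?F = (\<Prod>s\<in>S. [:- s, 1:])" using fS unfolding S_def .
  have card: "card S = n" using arg_cong[OF fS', of degree] f by (simp add: degree_prod_eq_sum_degree)
  interpret root_set S by unfold_locales (use fin power_sums_int[OF fin fS'] in auto)
  note full = G_full_if_types[OF fS' q, unfolded card, OF big t]
  show "irreducible (map_poly rat_of_int f)"
    using irreducible_if_transitive[OF fS'] full(1) n card by simp
  show "galois_group (splitting_field (map_poly rat_of_int f)) \<rat> \<cong> sym_group n"
    using galois_symmetric[OF fS' full(2)] card by simp
qed

section \<open>Density of the exceptional polynomials and the limits\<close>

lemma missing_type_density: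
  assumes \<mu>: "is_partition_of \<mu> n" and q0: "2 * n * n \<le> q0"
  shows "(proportion n (\<lambda>f. \<forall>q. prime q \<longrightarrow> q \<ge> q0 \<longrightarrow> \<not> separable_type q \<mu> f) \<longlongrightarrow> 0) at_top"
proof (rule sieve_density_zero)
  show "\<And>q. prime q \<Longrightarrow> periodic q (separable_type q \<mu>)" by (rule periodic_separable)
  show "(\<Prod>i=1..n. (1 / (2 * real i * real (count \<mu> i))) ^ count \<mu> i) > 0"
  proof (rule prod_pos)
    fix i assume "i \<in> {1..n}"
    then show "(1 / (2 * real i * real (count \<mu> i))) ^ count \<mu> i > 0"
      by (cases "count \<mu> i = 0") (auto intro!: zero_less_power divide_pos_pos)
  qed
  fix q :: nat assume q: "prime q" "q \<ge> q0"
  interpret gp: graded_primes "poly_mod_prime.irr_m (int q)" degree q by (rule graded_primes_irr[OF q(1)])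
  show "real (card {f \<in> residues_n n q. separable_type q \<mu> f}) \<ge>
      (\<Prod>i=1..n. (1 / (2 * real i * real (count \<mu> i))) ^ count \<mu> i) * real q ^ n"
    unfolding card_separable_type[OF q(1) \<mu>] using q q0 by (intro gp.card_sets_of_type_ge[OF \<mu>]) simp
qed

definition is_generic :: "nat \<Rightarrow> int poly \<Rightarrow> bool" where
  "is_generic n f \<longleftrightarrow> irreducible (map_poly rat_of_int f) \<and>
     galois_group (splitting_field (map_poly rat_of_int f)) \<rat> \<cong> sym_group n"

lemma generic_density_one:
  assumes n: "n \<ge> 2"
  shows "(proportion n (\<lambda>f. \<not> is_generic n f) \<longlongrightarrow> 0) at_top"
proof -
  \<comment> \<open>The first summand serves the lower bound for the number of polynomials of each
    type, the others the strict pigeonhole bound in \<open>\<phi>_in_G\<close>.\<close>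
  define q0 where "q0 = 2 * n * n + n * fact n + 1"
  define bad where "bad \<mu> f \<longleftrightarrow> (\<forall>q. prime q \<longrightarrow> q \<ge> q0 \<longrightarrow> \<not> separable_type q \<mu> f)" for \<mu> f
  define \<mu>1 \<mu>2 \<mu>3 where "\<mu>1 = {#n#}" and "\<mu>2 = {#1, n - 1#}" and "\<mu>3 = add_mset 2 (replicate_mset (n - 2) (1::nat))"
  have parts: "is_partition_of \<mu>1 n" "is_partition_of \<mu>2 n" "is_partition_of \<mu>3 n"
    using n by (auto simp: is_partition_of_def \<mu>1_def \<mu>2_def \<mu>3_def)
  have q0: "2 * n * n \<le> q0" "\<And>q. q \<ge> q0 \<Longrightarrow> q > n * fact n" unfolding q0_def by auto
  have lim: "(proportion n (bad \<mu>) \<longlongrightarrow> 0) at_top" if "is_partition_of \<mu> n" for \<mu>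
    unfolding bad_def by (rule missing_type_density[OF that q0(1)])
  have sum: "((\<lambda>B. proportion n (bad \<mu>1) B + (proportion n (bad \<mu>2) B + proportion n (bad \<mu>3) B))
      \<longlongrightarrow> 0 + (0 + 0)) at_top"
    by (intro tendsto_add lim parts)
  have le: "proportion n (\<lambda>f. \<not> is_generic n f) B \<le>
      proportion n (bad \<mu>1) B + (proportion n (bad \<mu>2) B + proportion n (bad \<mu>3) B)" for B
  proof -
    have "proportion n (\<lambda>f. \<not> is_generic n f) B \<le> proportion n (\<lambda>f. bad \<mu>1 f \<or> bad \<mu>2 f \<or> bad \<mu>3 f) B"
    proof (rule proportion_mono, rule ccontr)
      fix f assume f: "f \<in> monic_box n B" "\<not> is_generic n f" "\<not> (bad \<mu>1 f \<or> bad \<mu>2 f \<or> bad \<mu>3 f)"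
      then have fm: "monic f" "degree f = n" by (auto simp: monic_box_def)
      from f(3) obtain q1 q2 q3 where q: "prime q1" "prime q2" "prime q3" "q1 \<ge> q0" "q2 \<ge> q0" "q3 \<ge> q0"
        "separable_type q1 \<mu>1 f" "separable_type q2 \<mu>2 f" "separable_type q3 \<mu>3 f"
        unfolding bad_def by blast
      have "is_generic n f" unfolding is_generic_def
        using generic_if_types[OF fm n q(1-3) q0(2)[OF q(4)] q0(2)[OF q(5)] q0(2)[OF q(6)]
          q(7)[unfolded \<mu>1_def] q(8)[unfolded \<mu>2_def] q(9)[unfolded \<mu>3_def]] by blast
      then show False using f by simp
    qed
    also have "\<dots> \<le> proportion n (bad \<mu>1) B + proportion n (\<lambda>f. bad \<mu>2 f \<or> bad \<mu>3 f) B"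
      by (rule proportion_disj)
    also have "\<dots> \<le> proportion n (bad \<mu>1) B + (proportion n (bad \<mu>2) B + proportion n (bad \<mu>3) B)"
      by (intro add_left_mono proportion_disj)
    finally show ?thesis .
  qed
  show ?thesis
    by (rule tendsto_sandwich[OF _ _ tendsto_const sum[simplified]]) (simp_all add: le proportion_nonneg)
qed

text \<open>The proportion is squeezed between that of \<open>P\<close> and that of \<open>P\<close>
  minus the proportion of exceptional polynomials, which tends to 0.\<close>

lemma generic_periodic_density:
  assumes n: "n \<ge> 2" and Q: "Q > 0" and P: "periodic Q P"
  shows "(proportion n (\<lambda>f. P f \<and> is_generic n f)
     \<longlongrightarrow> real (card {f \<in> residues_n n Q. P f}) / real Q ^ n) at_top"
proof -
  let ?x = "proportion n P" and ?y = "proportion n (\<lambda>f. \<not> is_generic n f)"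
    and ?z = "proportion n (\<lambda>f. P f \<and> is_generic n f)"
  have x: "(?x \<longlongrightarrow> real (card {f \<in> residues_n n Q. P f}) / real Q ^ n) at_top"
    by (rule periodic_density[OF Q P])
  have y: "(?y \<longlongrightarrow> 0) at_top" by (rule generic_density_one[OF n])
  have up: "?z B \<le> ?x B" for B by (rule proportion_mono) simp
  have low: "?x B - ?y B \<le> ?z B" for B
  proof -
    have "?x B \<le> proportion n (\<lambda>f. (P f \<and> is_generic n f) \<or> \<not> is_generic n f) B"
      by (rule proportion_mono) auto
    also have "\<dots> \<le> ?z B + ?y B" by (rule proportion_disj)
    finally show ?thesis by simp
  qed
  show ?thesis
    by (rule tendsto_sandwich[OF _ _ tendsto_diff[OF x y, simplified] x]) (simp_all add: low up)
qed

theorem theorem2p4: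
  fixes n p :: nat
  assumes "n \<ge> 2" and "prime p"
  shows "((\<lambda>B. real (card (generic_box n B p)) / real (card (monic_box n B)))
            \<longlongrightarrow> 1 - 1 / real p) at_top \<and>
         (\<forall>\<mu>. is_partition_of \<mu> n \<longrightarrow>
           ((\<lambda>B. real (card {f \<in> generic_box n B p. has_splitting_type p f \<mu>})
                   / real (card (generic_box n B p)))
              \<longlongrightarrow> splitting_measure n p \<mu>) at_top)"
proof -
  have p0: "p > 0" "real p > 1" using prime_gt_0_nat[OF assms(2)] prime_gt_1_nat[OF assms(2)] by auto
  have pn: "real p ^ n = real p * real p ^ (n - 1)" using assms(1) by (cases n) auto
  have box: "monic f" "degree f > 0" if "f \<in> monic_box n B" for f B
    using that assms(1) by (auto simp: monic_box_def)
  have cds: "gcd (discriminant f) (int p) = 1 \<longleftrightarrow> separable_mod p f" if "f \<in> monic_box n B" for f B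
    by (rule coprime_discriminant_separable[OF assms(2) box(1)[OF that] box(2)[OF that]])
  have gen: "generic_box n B p = {f \<in> monic_box n B. separable_mod p f \<and> is_generic n f}" for B
    unfolding generic_box_def is_generic_def
    by (rule Collect_cong) (simp only: cds cong: conj_cong)
  have gen\<mu>: "{f \<in> generic_box n B p. has_splitting_type p f \<mu>} =
      {f \<in> monic_box n B. separable_type p \<mu> f \<and> is_generic n f}" for B \<mu>
  proof -
    have "separable_mod p f \<and> has_splitting_type p f \<mu> \<longleftrightarrow> separable_type p \<mu> f" if "f \<in> monic_box n B" for f
      by (rule separable_splitting_type[OF assms(2) box(1)[OF that]])
    then show ?thesis unfolding gen by blast
  qed
  have "real (p ^ n - p ^ (n - 1)) = real p ^ n - real p ^ (n - 1)"
    using p0 by (subst of_nat_diff) (auto intro!: power_increasing)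
  then have d: "real (card {f \<in> residues_n n p. separable_mod p f}) / real p ^ n = 1 - 1 / real p"
    unfolding card_separable_mod[OF assms(2,1)] pn using p0 by (simp add: field_simps)
  have 1: "((\<lambda>B. real (card (generic_box n B p)) / real (card (monic_box n B))) \<longlongrightarrow> 1 - 1 / real p) at_top"
    unfolding gen d[symmetric] proportion_def[symmetric]
    by (rule generic_periodic_density[OF assms(1) p0(1) periodic_separable])
  have 2: "((\<lambda>B. real (card {f \<in> generic_box n B p. has_splitting_type p f \<mu>}) / real (card (generic_box n B p)))
      \<longlongrightarrow> splitting_measure n p \<mu>) at_top" if \<mu>: "is_partition_of \<mu> n" for \<mu>
  proof -
    interpret gp: graded_primes "poly_mod_prime.irr_m (int p)" degree p by (rule graded_primes_irr[OF assms(2)])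
    define a where "a = real (card {f \<in> residues_n n p. separable_type p \<mu> f}) / real p ^ n"
    \<comment> \<open>Both counts are first taken relative to the whole box, where limits are known;
      the limit of the denominator is nonzero.\<close>
    have lim: "((\<lambda>B. (real (card {f \<in> generic_box n B p. has_splitting_type p f \<mu>}) / real (card (monic_box n B))) /
        (real (card (generic_box n B p)) / real (card (monic_box n B)))) \<longlongrightarrow> a / (1 - 1 / real p)) at_top"
    proof (intro tendsto_divide 1)
      show "((\<lambda>B. real (card {f \<in> generic_box n B p. has_splitting_type p f \<mu>}) / real (card (monic_box n B))) \<longlongrightarrow> a) at_top"
        unfolding gen\<mu> a_def proportion_def[symmetric]
        by (rule generic_periodic_density[OF assms(1) p0(1) periodic_separable])
      show "1 - 1 / real p \<noteq> 0" using p0 by simp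
    qed
    have "real (card {f \<in> residues_n n p. separable_type p \<mu> f}) = (\<Prod>i=1..n. necklace i (real p) gchoose count \<mu> i)"
      unfolding card_separable_type[OF assms(2) \<mu>] gp.card_sets_of_type[OF \<mu>] of_nat_prod
      by (intro prod.cong refl) (simp add: binomial_gbinomial gp.N_eq_necklace)
    then have "a / (1 - 1 / real p) = splitting_measure n p \<mu>"
      unfolding a_def splitting_measure_def pn using p0 by (simp add: field_simps)
    moreover have "\<forall>\<^sub>F B in at_top. (real (card {f \<in> generic_box n B p. has_splitting_type p f \<mu>}) / real (card (monic_box n B))) /
        (real (card (generic_box n B p)) / real (card (monic_box n B))) =
        real (card {f \<in> generic_box n B p. has_splitting_type p f \<mu>}) / real (card (generic_box n B p))"
      using eventually_gt_at_top[of 0]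
    proof eventually_elim
      case (elim B)
      \<comment> \<open>For positive \<open>B\<close> the box contains x^n, so its cardinality can
        be cancelled from the quotient.\<close>
      have "0 \<in> interval B" using elim by (simp add: interval_def)
      then have "card (interval B) \<noteq> 0" using finite_interval[of B] by auto
      then have "real (card (monic_box n B)) \<noteq> 0" unfolding monic_box_eq card_monic_polys by simp
      then show ?case by simp
    qed
    ultimately show ?thesis using Lim_transform_eventually[OF lim] by simp
  qed
  from 1 2 show ?thesis by blast
qed

end
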